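(* Let $G$ be a graph with the minimum spectral gap in the family of connected quartic graphs on $n$ vertices. (1) If $G$ is a block (i.e. $G$ has no cut vertex), then either $n\le 9$ and $G$ is isomorphic to one of the graphs $G_5,G_6,G_7,G_8,G_{8'},G_9$, or $n\ge 10$ and $G$ is a long complete block. (2) If $G$ is not itself a block, then $G$ has a path-like structure in which each left end block is either one of $D_1,D_2,D_3,D_4$ or a long end block; each middle block is either one of $M,M_1,M_2,M_3,\tilde M_3$ or a long middle block; and each right end block is the mirror image of some left end block (that is, the mirror image of one of $D_1,\dots,D_4$ or of a long end block).
   Context: All graphs are simple and finite; quartic means $4$-regular. The spectral gap of a graph is the difference between the two largest eigenvalues (with multiplicity) of its adjacency matrix; for a regular graph it equals the algebraic connectivity, the second smallest eigenvalue of the Laplacian. A block of a graph is a maximal connected subgraph without a cut vertex (of itself); a connected graph without cut vertex is itself called a block. Path-like structure: the blocks of $G$ can be ordered $C_1,\dots,C_t$ ($t\ge2$) from left to right so that consecutive blocks $C_i,C_{i+1}$ share exactly one vertex (a cut vertex of $G$), which has degree $2$ in each of them, and non-consecutive blocks are disjoint. $C_1$ is the left end block, $C_t$ the right end block, the others are middle blocks. End blocks have exactly one vertex of degree $2$ and middle blocks exactly two (a left one, shared with the previous block, and a right one, shared with the next block). Short blocks (vertices are digits, $ij$ denotes the edge joining $i$ and $j$): $M$ on $0,\dots,6$: $01,02,12,13,14,23,25,34,35,45,46,56$ (left vertex $0$, right vertex $6$). $M_1$ on $0,\dots,5$: $01,02,12,13,14,23,24,34,35,45$ (left $0$, right $5$).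 $M_2$ on $0,\dots,7$: $01,02,12,13,14,23,24,35,36,45,46,56,57,67$ (left $0$, right $7$). $M_3$ on $0,\dots,8$: $01,02,12,13,14,23,25,34,35,46,47,56,57,67,68,78$ (left $0$, right $8$). $D_1$ on $1,\dots,7$: $12,13,14,15,23,24,25,34,36,46,56,57,67$ (right vertex $7$). $D_2$ on $1,\dots,8$: $12,13,14,15,23,24,25,34,36,47,56,57,67,68,78$ (right vertex $8$). $D_3$ on $1,\dots,9$: $12,13,14,15,23,24,25,34,36,46,57,58,67,68,78,79,89$ (right vertex $9$). $D_4$ on $0,\dots,5$: $01,02,03,04,12,13,14,23,24,35,45$ (right vertex $5$). The named left/right vertices are the degree-$2$ vertices; all other vertices have degree $4$. Bricks: $M'_1,M'_2,M'_3,D'_3,D'_4$ are obtained from $M_1,M_2,M_3,D_3,D_4$ by deleting the right degree-$2$ vertex; their right ports are the two neighbours of the deleted vertex, namely $\{3,4\}$, $\{5,6\}$, $\{6,7\}$, $\{7,8\}$, $\{3,4\}$ respectively. $M''_1,M''_2$ are obtained from $M_1,M_2$ by deleting both degree-$2$ vertices; their left ports are $\{1,2\}$ and their right ports are $\{3,4\}$ and $\{5,6\}$, respectively. For any of these graphs (or any block) $B$, $\tilde B$ denotes its mirror image: the same graph with the roles of left and right interchanged. Long blocks: a long block is built from disjoint bricks $B_1,\dots,B_s$, $s\ge2$, by joining, for each $i<s$, the two right ports of $B_i$ to the two left ports of $B_{i+1}$ by two disjoint edges (which of the two matchings is used does not matter up to isomorphism). In all types $B_2,\dots,B_{s-1}\in\{M''_1,M''_2\}$.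 Long end block: $B_1\in\{D'_3,D'_4\}$, $B_s\in\{\tilde M'_1,\tilde M'_2,\tilde M'_3\}$ (its right vertex is its degree-$2$ vertex, in $B_s$). Long middle block: $B_1\in\{M'_1,M'_2,M'_3\}$, $B_s\in\{\tilde M'_1,\tilde M'_2,\tilde M'_3\}$ (its left and right vertices are its degree-$2$ vertices in $B_1$ and $B_s$). Long complete block: $B_1\in\{D'_3,D'_4\}$, $B_s\in\{\tilde D'_3,\tilde D'_4\}$ (it is $4$-regular). Small graphs: $G_5=K_5$. $G_6$ on $1,\dots,6$: $12,13,14,15,23,24,26,35,36,45,46,56$. $G_7$ on $1,\dots,7$: $12,13,14,15,23,24,25,36,37,46,47,56,57,67$. $G_8$ on $1,\dots,8$: $12,13,14,15,23,24,26,34,37,48,56,57,58,67,68,78$. $G_{8'}$ on $1,\dots,8$: $12,13,14,15,23,24,25,36,38,46,47,57,58,67,68,78$. $G_9$ on $1,\dots,9$: $12,13,14,15,23,24,25,34,36,47,58,59,67,68,69,78,79,89$. *)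

theory Defs
  imports
    "Graph_Theory.Graph_Theory"
    "Jordan_Normal_Form.Char_Poly"
begin

section \<open>Graphs, cut vertices and blocks\<close>

text \<open>
  A finite simple graph is a \<open>pair_graph\<close>: a finite, loop-free, symmetric digraph whose arcs are
  ordered pairs, so each edge \<open>uv\<close> is represented by the two arcs \<open>(u, v)\<close> and \<open>(v, u)\<close>. Hence the
  degree of a vertex of the graph is its \<open>out_degree\<close>. The name \<open>connected\<close> is qualified because it
  is also a topological notion.
\<close>

definition quartic :: "'a pair_pre_digraph \<Rightarrow> bool" where
  "quartic G \<longleftrightarrow> pair_graph G \<and> (\<forall>v \<in> pverts G. out_degree G v = 4)"

definition connected_quartic_graphs :: "nat \<Rightarrow> 'a pair_pre_digraph set" where
  "connected_quartic_graphs n =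
     {G. quartic G \<and> Digraph_Component.connected G \<and> card (pverts G) = n}"

definition cut_vertex :: "('a, 'b) pre_digraph \<Rightarrow> 'a \<Rightarrow> bool" where
  "cut_vertex G v \<longleftrightarrow> v \<in> verts G \<and>
     (\<exists>u w. u \<noteq> v \<and> w \<noteq> v \<and> u \<rightarrow>\<^sup>*\<^bsub>G\<^esub> w \<and> \<not> u \<rightarrow>\<^sup>*\<^bsub>pre_digraph.del_vert G v\<^esub> w)"

text \<open>
  \<open>is_block G\<close>: the graph \<open>G\<close> is itself a block. The requirement \<open>graph G\<close> (symmetry) also restricts
  the subdigraphs that \<open>max_subgraph\<close> ranges over in \<open>block_of\<close> to subgraphs in the undirected sense.
\<close>

definition is_block :: "('a, 'b) pre_digraph \<Rightarrow> bool" where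
  "is_block G \<longleftrightarrow> graph G \<and> Digraph_Component.connected G \<and> (\<nexists>v. cut_vertex G v)"

definition block_of :: "'a pair_pre_digraph \<Rightarrow> 'a pair_pre_digraph \<Rightarrow> bool" where
  "block_of G C \<longleftrightarrow> pre_digraph.max_subgraph (with_proj G) is_block (with_proj C)"


section \<open>Spectral gap\<close>

definition adjacency_matrix :: "'a pair_pre_digraph \<Rightarrow> 'a list \<Rightarrow> real mat" where
  "adjacency_matrix G vs =
     mat (length vs) (length vs) (\<lambda>(i, j). if (vs ! i, vs ! j) \<in> parcs G then 1 else 0)"

text \<open>
  The eigenvalues, with multiplicity, in increasing order. The multiset does not depend on the chosen
  enumeration of the vertices, as different enumerations yield similar matrices; and since a real
  symmetric matrix has only real eigenvalues, no eigenvalue is missed by taking real roots.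
\<close>

definition adjacency_eigenvalues :: "'a pair_pre_digraph \<Rightarrow> real list" where
  "adjacency_eigenvalues G =
     sorted_list_of_multiset (proots (char_poly
       (adjacency_matrix G (SOME vs. distinct vs \<and> set vs = pverts G))))"

definition spectral_gap :: "'a pair_pre_digraph \<Rightarrow> real" where
  "spectral_gap G =
     rev (adjacency_eigenvalues G) ! 0 - rev (adjacency_eigenvalues G) ! 1"


section \<open>Graphs with left and right attachment vertices\<close>

text \<open>
  A piece is a graph together with its set of left and its set of right attachment vertices. For a
  block these are its left and right vertex (a singleton, or empty on a side on which the block has
  none); for a brick they are its left and right ports, or its remaining degree-2 vertex.
\<close>

record 'a piece =
  body :: "'a pair_pre_digraph"
  lports :: "'a set"
  rports :: "'a set"

definition mirror :: "'a piece \<Rightarrow> 'a piece" where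
  "mirror P = \<lparr>body = body P, lports = rports P, rports = lports P\<rparr>"

definition piece_iso :: "'a piece \<Rightarrow> 'b piece \<Rightarrow> bool" where
  "piece_iso P Q \<longleftrightarrow>
     (\<exists>h. pre_digraph.digraph_isomorphism (with_proj (body P)) h \<and>
          with_proj (body Q) = app_iso h (with_proj (body P)) \<and>
          lports Q = iso_verts h ` lports P \<and>
          rports Q = iso_verts h ` rports P)"

definition delete_right :: "'a piece \<Rightarrow> 'a piece" where
  "delete_right P =
     \<lparr>body = \<lparr>pverts = pverts (body P) - rports P,
              parcs = {(u, v) \<in> parcs (body P). u \<notin> rports P \<and> v \<notin> rports P}\<rparr>,
      lports = lports P,
      rports = {u \<in> pverts (body P) - rports P. \<exists>v \<in> rports P. (u, v) \<in> parcs (body P)}\<rparr>"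

definition delete_left :: "'a piece \<Rightarrow> 'a piece" where
  "delete_left P = mirror (delete_right (mirror P))"


section \<open>Small graphs and short blocks\<close>

definition graph_of_edges :: "('a \<times> 'a) list \<Rightarrow> 'a pair_pre_digraph" where
  "graph_of_edges es =
     \<lparr>pverts = fst ` set es \<union> snd ` set es, parcs = set es \<union> (set es)\<inverse>\<rparr>"

definition graph_G5 :: "nat pair_pre_digraph" where
  "graph_G5 = graph_of_edges
     [(1,2),(1,3),(1,4),(1,5),(2,3),(2,4),(2,5),(3,4),(3,5),(4,5)]"

definition graph_G6 :: "nat pair_pre_digraph" where
  "graph_G6 = graph_of_edges
     [(1,2),(1,3),(1,4),(1,5),(2,3),(2,4),(2,6),(3,5),(3,6),(4,5),(4,6),(5,6)]"

definition graph_G7 :: "nat pair_pre_digraph" where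
  "graph_G7 = graph_of_edges
     [(1,2),(1,3),(1,4),(1,5),(2,3),(2,4),(2,5),(3,6),(3,7),(4,6),(4,7),(5,6),(5,7),(6,7)]"

definition graph_G8 :: "nat pair_pre_digraph" where
  "graph_G8 = graph_of_edges
     [(1,2),(1,3),(1,4),(1,5),(2,3),(2,4),(2,6),(3,4),(3,7),(4,8),(5,6),(5,7),(5,8),(6,7),
      (6,8),(7,8)]"

definition graph_G8' :: "nat pair_pre_digraph" where
  "graph_G8' = graph_of_edges
     [(1,2),(1,3),(1,4),(1,5),(2,3),(2,4),(2,5),(3,6),(3,8),(4,6),(4,7),(5,7),(5,8),(6,7),
      (6,8),(7,8)]"

definition graph_G9 :: "nat pair_pre_digraph" where
  "graph_G9 = graph_of_edges
     [(1,2),(1,3),(1,4),(1,5),(2,3),(2,4),(2,5),(3,4),(3,6),(4,7),(5,8),(5,9),(6,7),(6,8),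
      (6,9),(7,8),(7,9),(8,9)]"

definition block_M :: "nat piece" where
  "block_M = \<lparr>body = graph_of_edges
     [(0,1),(0,2),(1,2),(1,3),(1,4),(2,3),(2,5),(3,4),(3,5),(4,5),(4,6),(5,6)],
     lports = {0}, rports = {6}\<rparr>"

definition block_M1 :: "nat piece" where
  "block_M1 = \<lparr>body = graph_of_edges
     [(0,1),(0,2),(1,2),(1,3),(1,4),(2,3),(2,4),(3,4),(3,5),(4,5)],
     lports = {0}, rports = {5}\<rparr>"

definition block_M2 :: "nat piece" where
  "block_M2 = \<lparr>body = graph_of_edges
     [(0,1),(0,2),(1,2),(1,3),(1,4),(2,3),(2,4),(3,5),(3,6),(4,5),(4,6),(5,6),(5,7),(6,7)],
     lports = {0}, rports = {7}\<rparr>"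

definition block_M3 :: "nat piece" where
  "block_M3 = \<lparr>body = graph_of_edges
     [(0,1),(0,2),(1,2),(1,3),(1,4),(2,3),(2,5),(3,4),(3,5),(4,6),(4,7),(5,6),(5,7),(6,7),
      (6,8),(7,8)],
     lports = {0}, rports = {8}\<rparr>"

definition block_D1 :: "nat piece" where
  "block_D1 = \<lparr>body = graph_of_edges
     [(1,2),(1,3),(1,4),(1,5),(2,3),(2,4),(2,5),(3,4),(3,6),(4,6),(5,6),(5,7),(6,7)],
     lports = {}, rports = {7}\<rparr>"

definition block_D2 :: "nat piece" where
  "block_D2 = \<lparr>body = graph_of_edges
     [(1,2),(1,3),(1,4),(1,5),(2,3),(2,4),(2,5),(3,4),(3,6),(4,7),(5,6),(5,7),(6,7),(6,8),
      (7,8)],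
     lports = {}, rports = {8}\<rparr>"

definition block_D3 :: "nat piece" where
  "block_D3 = \<lparr>body = graph_of_edges
     [(1,2),(1,3),(1,4),(1,5),(2,3),(2,4),(2,5),(3,4),(3,6),(4,6),(5,7),(5,8),(6,7),(6,8),
      (7,8),(7,9),(8,9)],
     lports = {}, rports = {9}\<rparr>"

definition block_D4 :: "nat piece" where
  "block_D4 = \<lparr>body = graph_of_edges
     [(0,1),(0,2),(0,3),(0,4),(1,2),(1,3),(1,4),(2,3),(2,4),(3,5),(4,5)],
     lports = {}, rports = {5}\<rparr>"


section \<open>Bricks and long blocks\<close>

text \<open>
  Deleting the right vertex of a block gives the bricks written with one prime, deleting both of its
  degree-2 vertices gives those written with two primes.
\<close>

definition D_bricks :: "nat piece set" where
  "D_bricks = {delete_right block_D3, delete_right block_D4}"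

definition M_bricks :: "nat piece set" where
  "M_bricks = {delete_right block_M1, delete_right block_M2, delete_right block_M3}"

definition inner_bricks :: "nat piece set" where
  "inner_bricks = {delete_left (delete_right block_M1), delete_left (delete_right block_M2)}"

text \<open>
  The \<open>i\<close>-th brick is tagged with its index to make the bricks disjoint; \<open>m i\<close> is the matching
  between the right ports of brick \<open>i\<close> and the left ports of brick \<open>i + 1\<close>.
\<close>

definition port_matching :: "'a piece list \<Rightarrow> (nat \<Rightarrow> 'a \<Rightarrow> 'a) \<Rightarrow> bool" where
  "port_matching Bs m \<longleftrightarrow>
     (\<forall>i. Suc i < length Bs \<longrightarrow> bij_betw (m i) (rports (Bs ! i)) (lports (Bs ! Suc i)))"

definition link_arcs :: "'a piece list \<Rightarrow> (nat \<Rightarrow> 'a \<Rightarrow> 'a) \<Rightarrow> (nat \<times> 'a) rel" where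
  "link_arcs Bs m =
     {((i, p), (Suc i, m i p)) | i p. Suc i < length Bs \<and> p \<in> rports (Bs ! i)}"

definition join_bricks :: "'a piece list \<Rightarrow> (nat \<Rightarrow> 'a \<Rightarrow> 'a) \<Rightarrow> (nat \<times> 'a) piece" where
  "join_bricks Bs m =
     \<lparr>body =
        \<lparr>pverts = {(i, v). i < length Bs \<and> v \<in> pverts (body (Bs ! i))},
         parcs = {((i, u), (i, v)) | i u v. i < length Bs \<and> (u, v) \<in> parcs (body (Bs ! i))}
                 \<union> link_arcs Bs m \<union> (link_arcs Bs m)\<inverse>\<rparr>,
      lports = Pair 0 ` lports (hd Bs),
      rports = Pair (length Bs - 1) ` rports (last Bs)\<rparr>"

definition long_block :: "nat piece set \<Rightarrow> nat piece set \<Rightarrow> 'a piece \<Rightarrow> bool" where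
  "long_block S T P \<longleftrightarrow>
     (\<exists>Bs m. 2 \<le> length Bs \<and> hd Bs \<in> S \<and> last Bs \<in> T \<and>
        (\<forall>i. 0 < i \<and> Suc i < length Bs \<longrightarrow> Bs ! i \<in> inner_bricks) \<and>
        port_matching Bs m \<and> piece_iso P (join_bricks Bs m))"

definition long_end_block :: "'a piece \<Rightarrow> bool" where
  "long_end_block P \<longleftrightarrow> long_block D_bricks (mirror ` M_bricks) P"

definition long_middle_block :: "'a piece \<Rightarrow> bool" where
  "long_middle_block P \<longleftrightarrow> long_block M_bricks (mirror ` M_bricks) P"

definition long_complete_block :: "'a pair_pre_digraph \<Rightarrow> bool" where
  "long_complete_block G \<longleftrightarrow>
     long_block D_bricks (mirror ` D_bricks) \<lparr>body = G, lports = {}, rports = {}\<rparr>"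


section \<open>Path-like structure\<close>

definition path_like_structure :: "'a pair_pre_digraph \<Rightarrow> 'a pair_pre_digraph list \<Rightarrow> bool" where
  "path_like_structure G Cs \<longleftrightarrow>
     2 \<le> length Cs \<and> distinct Cs \<and> set Cs = {C. block_of G C} \<and>
     (\<forall>i. Suc i < length Cs \<longrightarrow>
        (\<exists>v. pverts (Cs ! i) \<inter> pverts (Cs ! Suc i) = {v} \<and> cut_vertex G v \<and>
             out_degree (Cs ! i) v = 2 \<and> out_degree (Cs ! Suc i) v = 2)) \<and>
     (\<forall>i j. Suc i < j \<and> j < length Cs \<longrightarrow> pverts (Cs ! i) \<inter> pverts (Cs ! j) = {})"

text \<open>
  The \<open>i\<close>-th block of the structure, with the vertex shared with the previous (next) block, if any,
  as its left (right) vertex.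
\<close>

definition placed_block :: "'a pair_pre_digraph list \<Rightarrow> nat \<Rightarrow> 'a piece" where
  "placed_block Cs i =
     \<lparr>body = Cs ! i,
      lports = (if i = 0 then {} else pverts (Cs ! (i - 1)) \<inter> pverts (Cs ! i)),
      rports = (if Suc i < length Cs then pverts (Cs ! i) \<inter> pverts (Cs ! Suc i) else {})\<rparr>"

definition left_end_type :: "'a piece \<Rightarrow> bool" where
  "left_end_type P \<longleftrightarrow>
     (\<exists>Q \<in> {block_D1, block_D2, block_D3, block_D4}. piece_iso P Q) \<or> long_end_block P"

definition middle_type :: "'a piece \<Rightarrow> bool" where
  "middle_type P \<longleftrightarrow>
     (\<exists>Q \<in> {block_M, block_M1, block_M2, block_M3, mirror block_M3}. piece_iso P Q) \<or>
     long_middle_block P"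

definition right_end_type :: "'a piece \<Rightarrow> bool" where
  "right_end_type P \<longleftrightarrow> left_end_type (mirror P)"

end

(*
  Let x be an eigenvector of the Laplacian for the spectral gap. If replacing two edges by two
  others on the same four vertices keeps the graph connected and does not increase the energy of x,
  then the result is again optimal with the same eigenvector, and comparing the two eigenvector
  equations shows that values of x coincide. Number the vertices by decreasing x, breaking ties so
  that the sum of the products of the numbers of adjacent vertices is maximal. Then no switch is
  possible along p < q < r < s unless further edges or a 2-edge cut prevent it, and this has the
  following consequence: if p is adjacent to s but not to some r with p < r < s, then r has more
  neighbours before p than s.

  So the graph is almost determined from left to right. Starting at the first vertex, at a cut
  vertex or at a cut by two disjoint edges, a finite search meets the end of the graph, a cut vertex
  or such a 2-edge cut after at most 14 vertices, and what lies in between is a small graph, a short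
  block or a brick. The same applies to the reversed numbering, which yields the right end block.
*)
theory Submission
  imports Defs "HOL-Analysis.Function_Topology" "Jordan_Normal_Form.Schur_Decomposition"
begin

section \<open>The Laplacian and the spectral gap\<close>

text \<open>The claim concerns every minimiser, so a neutral switch may not be used to replace the
  given graph by a more convenient one; only the numbering can be chosen. This suffices because a
  neutral switch that keeps the graph connected has the effect of interchanging two vertices with
  equal eigenvector value: one of the two tied pairs agrees outside the four switched vertices
  (\<open>neutral_switch_twins\<close>). If the switch increased the sum of products, renumbering by
  this transposition would increase it for the original graph.

  The recurring obstacle is that a switch may disconnect the graph. It does so only if the two
  removed edges form an edge cut. As all degrees are 4, no edge cut has odd size, and the sides of
  two competing cuts tend to intersect in a set left by one or three edges; this is how cuts are
  excluded.

  On the spectral side, the gap counts roots of the characteristic polynomial with algebraic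
  multiplicity. So the largest eigenvalue 4 has to be a simple root, not merely one with a
  one-dimensional eigenspace.\<close>

text \<open>Connectedness is expressed by closed sets because a set that violates it after a switch
  is directly one side of the obstructing cut.\<close>

locale quartic_rel =
  fixes V :: "'a set" and E :: "'a \<Rightarrow> 'a \<Rightarrow> bool"
  assumes finite_verts: "finite V" and verts_nonempty: "V \<noteq> {}"
    and adj_in_verts: "E u v \<Longrightarrow> u \<in> V" and adj_irrefl: "E u v \<Longrightarrow> u \<noteq> v" and adj_sym: "E u v \<Longrightarrow> E v u"
    and degree_4: "u \<in> V \<Longrightarrow> card {v. E u v} = 4"
    and closed_set: "S \<subseteq> V \<Longrightarrow> S \<noteq> {} \<Longrightarrow> (\<And>u v. u \<in> S \<Longrightarrow> E u v \<Longrightarrow> v \<in> S) \<Longrightarrow> S = V"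

lemma quartic_relD:
  assumes "quartic_rel V E"
  shows "finite V" "V \<noteq> {}" "E u v \<Longrightarrow> u \<in> V" "E u v \<Longrightarrow> v \<in> V" "E u v \<Longrightarrow> u \<noteq> v" "E u v \<Longrightarrow> E v u"
    "u \<in> V \<Longrightarrow> card {v. E u v} = 4" "finite {v. E u v}"
    "S \<subseteq> V \<Longrightarrow> S \<noteq> {} \<Longrightarrow> (\<And>u v. u \<in> S \<Longrightarrow> E u v \<Longrightarrow> v \<in> S) \<Longrightarrow> S = V"
proof -
  interpret quartic_rel V E by fact
  show "finite V" "V \<noteq> {}" "E u v \<Longrightarrow> u \<in> V" "E u v \<Longrightarrow> v \<in> V" "E u v \<Longrightarrow> u \<noteq> v" "E u v \<Longrightarrow> E v u"
    "u \<in> V \<Longrightarrow> card {v. E u v} = 4"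
    "S \<subseteq> V \<Longrightarrow> S \<noteq> {} \<Longrightarrow> (\<And>u v. u \<in> S \<Longrightarrow> E u v \<Longrightarrow> v \<in> S) \<Longrightarrow> S = V"
    by (fact finite_verts verts_nonempty adj_in_verts adj_in_verts[OF adj_sym] adj_irrefl adj_sym degree_4 closed_set)+
  show "finite {v. E u v}"
    by (rule finite_subset[OF _ finite_verts]) (blast intro: adj_in_verts adj_sym)
qed

section \<open>Connected quartic graphs as symmetric relations\<close>

text \<open>A symmetric digraph is its own symmetric closure, so connectedness is strong
  connectedness; and the vertices reachable from a given one form a closed set.\<close>

lemma (in pair_graph) connected_iff_closed_sets:
  "Digraph_Component.connected (with_proj G) \<longleftrightarrow>
     pverts G \<noteq> {} \<and>
     (\<forall>S. S \<subseteq> pverts G \<and> S \<noteq> {} \<and> (\<forall>u\<in>S. \<forall>v. (u, v) \<in> parcs G \<longrightarrow> v \<in> S) \<longrightarrow> S = pverts G)"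
proof -
  have conn: "Digraph_Component.connected (with_proj G) \<longleftrightarrow> strongly_connected (with_proj G)"
  proof -
    have "mk_symmetric (with_proj G) = G"
      using pair_sym_arcs by (cases G) (auto simp: mk_symmetric_def symmetric_def dest: symD)
    then show ?thesis by (simp add: Digraph_Component.connected_def)
  qed
  show ?thesis
  proof (intro iffI conjI allI impI)
    assume "Digraph_Component.connected (with_proj G)"
    then have sc: "strongly_connected (with_proj G)" using conn by simp
    then show "pverts G \<noteq> {}" by (simp add: strongly_connected_def)
    fix S assume S: "S \<subseteq> pverts G \<and> S \<noteq> {} \<and> (\<forall>u\<in>S. \<forall>v. (u, v) \<in> parcs G \<longrightarrow> v \<in> S)"
    then obtain u where u: "u \<in> S" by auto
    have "v \<in> S" if "u \<rightarrow>\<^sup>*\<^bsub>with_proj G\<^esub> v" for v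
      using that
      by (induction rule: reachable_induct) (use S u in auto)
    then have "pverts G \<subseteq> S" using sc u S by (auto simp: strongly_connected_def)
    with S show "S = pverts G" by auto
  next
    assume *: "pverts G \<noteq> {} \<and>
      (\<forall>S. S \<subseteq> pverts G \<and> S \<noteq> {} \<and> (\<forall>u\<in>S. \<forall>v. (u, v) \<in> parcs G \<longrightarrow> v \<in> S) \<longrightarrow> S = pverts G)"
    have "u \<rightarrow>\<^sup>*\<^bsub>with_proj G\<^esub> v" if u: "u \<in> pverts G" and v: "v \<in> pverts G" for u v
    proof -
      let ?S = "{w. u \<rightarrow>\<^sup>*\<^bsub>with_proj G\<^esub> w}"
      have "?S \<subseteq> pverts G" using reachable_in_verts(2) by auto
      moreover have "u \<in> ?S" using u by simp
      moreover have "w' \<in> ?S" if "w \<in> ?S" "(w, w') \<in> parcs G" for w w'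
        using that by (metis mem_Collect_eq reachable_adj_trans with_proj_simps(3))
      ultimately have "?S = pverts G" using * by blast
      then show ?thesis using v by auto
    qed
    then have "strongly_connected (with_proj G)" using * by (auto simp: strongly_connected_def)
    then show "Digraph_Component.connected (with_proj G)" using conn by simp
  qed
qed

lemma quartic_rel_of_graph:
  assumes "G \<in> connected_quartic_graphs n"
  shows "quartic_rel (pverts G) (\<lambda>u v. (u, v) \<in> parcs G)" "card (pverts G) = n" "pair_graph G"
proof -
  show g: "pair_graph G" and "card (pverts G) = n"
    using assms by (auto simp: connected_quartic_graphs_def quartic_def)
  interpret pair_graph G by fact
  have c: "Digraph_Component.connected (with_proj G)"
    using assms by (auto simp: connected_quartic_graphs_def)
  have "card {v. (u, v) \<in> parcs G} = 4" if "u \<in> pverts G" for u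
  proof -
    have "out_degree G u = 4" using assms that by (auto simp: connected_quartic_graphs_def quartic_def)
    moreover have "out_arcs G u = Pair u ` {v. (u, v) \<in> parcs G}" by (auto simp: out_arcs_def)
    ultimately show ?thesis by (simp add: out_degree_def card_image inj_on_def)
  qed
  moreover have "sym (parcs G)" using pair_sym_arcs by (simp add: symmetric_def)
  moreover have "u \<noteq> v" if "(u, v) \<in> parcs G" for u v using pair_no_loops[OF that] by simp
  ultimately show "quartic_rel (pverts G) (\<lambda>u v. (u, v) \<in> parcs G)"
    using connected_iff_closed_sets[THEN iffD1, OF c] pair_finite_verts
    by unfold_locales (auto dest: in_arcsD1 symD)
qed

lemma graph_of_quartic_rel:
  assumes E: "quartic_rel V E"
  shows "\<lparr>pverts = V, parcs = {(u, v). E u v}\<rparr> \<in> connected_quartic_graphs (card V)"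
proof -
  let ?G = "\<lparr>pverts = V, parcs = {(u, v). E u v}\<rparr>"
  have "parcs ?G \<subseteq> V \<times> V" using quartic_relD(3,4)[OF E] by auto
  then have "finite (parcs ?G)" using quartic_relD(1)[OF E] finite_subset by blast
  then interpret pair_graph ?G
    using quartic_relD[OF E] by unfold_locales (auto simp: symmetric_def intro: symI)
  have "out_degree ?G u = 4" if "u \<in> V" for u
  proof -
    have "out_arcs ?G u = Pair u ` {v. E u v}" by (auto simp: out_arcs_def)
    then show ?thesis
      using quartic_relD(7)[OF E that] by (simp add: out_degree_def card_image inj_on_def)
  qed
  moreover have "Digraph_Component.connected (with_proj ?G)"
    unfolding connected_iff_closed_sets using quartic_relD(2)[OF E] quartic_relD(9)[OF E] by simp
  ultimately show ?thesis
    by (auto simp: connected_quartic_graphs_def quartic_def intro: pair_graph_axioms)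
qed

section \<open>The quadratic form of the Laplacian\<close>

definition laplacian :: "'a set \<Rightarrow> ('a \<Rightarrow> 'a \<Rightarrow> bool) \<Rightarrow> ('a \<Rightarrow> real) \<Rightarrow> 'a \<Rightarrow> real" where
  "laplacian V E x u = (\<Sum>v\<in>V. if E u v then x u - x v else 0)"

text \<open>Each edge is counted in both directions, so this is twice the quadratic form of the
  Laplacian. Hence the factor 2 before \<open>\<mu>\<close> in the Rayleigh bounds.\<close>

definition energy :: "'a set \<Rightarrow> ('a \<Rightarrow> 'a \<Rightarrow> bool) \<Rightarrow> ('a \<Rightarrow> real) \<Rightarrow> real" where
  "energy V E x = (\<Sum>u\<in>V. \<Sum>v\<in>V. if E u v then (x u - x v)\<^sup>2 else 0)"

text \<open>Summation by parts: exchanging the two summation variables turns the terms with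
  \<open>z v\<close> into the negatives of those with \<open>z u\<close>.\<close>

lemma energy_bilinear:
  assumes "\<And>u v. E u v \<Longrightarrow> E v u"
  shows "(\<Sum>u\<in>V. \<Sum>v\<in>V. if E u v then (x u - x v) * (z u - z v) else 0) = 2 * (\<Sum>u\<in>V. laplacian V E x u * z u)"
proof -
  have "(\<Sum>u\<in>V. \<Sum>v\<in>V. if E u v then (x u - x v) * z v else 0)
      = (\<Sum>u\<in>V. \<Sum>v\<in>V. if E v u then (x v - x u) * z u else 0)"
    by (rule sum.swap)
  also have "\<dots> = - (\<Sum>u\<in>V. \<Sum>v\<in>V. if E u v then (x u - x v) * z u else 0)"
    unfolding sum_negf[symmetric] by (intro sum.cong refl) (use assms in \<open>auto simp: algebra_simps\<close>)
  finally have *: "(\<Sum>u\<in>V. \<Sum>v\<in>V. if E u v then (x u - x v) * z v else 0)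
    = - (\<Sum>u\<in>V. \<Sum>v\<in>V. if E u v then (x u - x v) * z u else 0)" .
  have "(\<Sum>u\<in>V. \<Sum>v\<in>V. if E u v then (x u - x v) * (z u - z v) else 0)
      = (\<Sum>u\<in>V. \<Sum>v\<in>V. (if E u v then (x u - x v) * z u else 0) - (if E u v then (x u - x v) * z v else 0))"
    by (intro sum.cong refl) (auto simp: algebra_simps)
  also have "\<dots> = 2 * (\<Sum>u\<in>V. \<Sum>v\<in>V. if E u v then (x u - x v) * z u else 0)"
    unfolding sum_subtractf * by simp
  also have "(\<Sum>u\<in>V. \<Sum>v\<in>V. if E u v then (x u - x v) * z u else 0) = (\<Sum>u\<in>V. laplacian V E x u * z u)"
    unfolding laplacian_def sum_distrib_right by (intro sum.cong refl) auto
  finally show ?thesis .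
qed

lemma energy_eq_laplacian:
  assumes "\<And>u v. E u v \<Longrightarrow> E v u"
  shows "energy V E x = 2 * (\<Sum>u\<in>V. laplacian V E x u * x u)"
  using energy_bilinear[where E = E and x = x and z = x and V = V, OF assms]
  by (simp only: energy_def power2_eq_square)

lemma sum_laplacian_eq_0:
  assumes "\<And>u v. E u v \<Longrightarrow> E v u"
  shows "(\<Sum>u\<in>V. laplacian V E x u) = 0"
  using energy_bilinear[where E = E and x = x and z = "\<lambda>_. 1" and V = V] assms by (simp cong: if_cong)

lemma energy_add:
  assumes "\<And>u v. E u v \<Longrightarrow> E v u"
  shows "energy V E (\<lambda>u. x u + t * z u)
    = energy V E x + 4 * t * (\<Sum>u\<in>V. laplacian V E x u * z u) + t\<^sup>2 * energy V E z"
proof -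
  have "energy V E (\<lambda>u. x u + t * z u)
    = (\<Sum>u\<in>V. \<Sum>v\<in>V. (if E u v then (x u - x v)\<^sup>2 else 0)
        + 2 * t * (if E u v then (x u - x v) * (z u - z v) else 0) + t\<^sup>2 * (if E u v then (z u - z v)\<^sup>2 else 0))"
    unfolding energy_def by (intro sum.cong refl) (auto simp: algebra_simps power2_eq_square)
  also have "\<dots> = energy V E x + 2 * t * (2 * (\<Sum>u\<in>V. laplacian V E x u * z u)) + t\<^sup>2 * energy V E z"
    unfolding sum.distrib sum_distrib_left[symmetric]
    using energy_bilinear[where E = E and x = x and z = z and V = V] assms by (simp add: energy_def)
  finally show ?thesis by simp
qed

section \<open>Minimisers of the Rayleigh quotient\<close>

lemma linear_coeff_eq_0:
  fixes b c :: real
  assumes "\<And>t. 0 \<le> t * b + t\<^sup>2 * c"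
  shows "b = 0"
proof (rule ccontr)
  assume b: "b \<noteq> 0"
  \<comment> \<open>At \<open>t = - b / d\<close> the expression equals
    \<open>(b\<^sup>2 / d\<^sup>2) * (c - d)\<close>, so any positive \<open>d\<close> above
    \<open>c\<close> gives a negative value.\<close>
  define d where "d = \<bar>c\<bar> + 1"
  have d: "d > 0" "c < d" by (auto simp: d_def)
  have "0 \<le> (- b / d) * b + (- b / d)\<^sup>2 * c" by (rule assms)
  also have "\<dots> = (b\<^sup>2 / d\<^sup>2) * (c - d)" using d by (simp add: field_simps power2_eq_square)
  also have "\<dots> < 0" using b d by (intro mult_pos_neg) auto
  finally show False by simp
qed

text \<open>The minimum of the Rayleigh quotient is an eigenvector: the first variation of
  \<open>energy x - 2 \<mu> |x|\<^sup>2 \<ge> 0\<close> vanishes at a zero of it.\<close>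

lemma rayleigh_minimum_eigenvector:
  assumes fin: "finite V" and sym: "\<And>u v. E u v \<Longrightarrow> E v u"
    and low: "\<And>y. (\<Sum>u\<in>V. y u) = 0 \<Longrightarrow> 2 * \<mu> * (\<Sum>u\<in>V. (y u)\<^sup>2) \<le> energy V E y"
    and x0: "(\<Sum>u\<in>V. x u) = 0" and eq: "energy V E x \<le> 2 * \<mu> * (\<Sum>u\<in>V. (x u)\<^sup>2)"
    and u: "u \<in> V"
  shows "laplacian V E x u = \<mu> * x u"
proof -
  define z where "z v = laplacian V E x v - \<mu> * x v" for v
  have z0: "(\<Sum>v\<in>V. z v) = 0"
    unfolding z_def sum_subtractf sum_distrib_left[symmetric] using sum_laplacian_eq_0[of E V x] sym x0 by simp
  have eq: "energy V E x = 2 * \<mu> * (\<Sum>u\<in>V. (x u)\<^sup>2)" using low[OF x0] eq by simp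
  have "0 \<le> t * (4 * (\<Sum>v\<in>V. z v * z v)) + t\<^sup>2 * (energy V E z - 2 * \<mu> * (\<Sum>v\<in>V. (z v)\<^sup>2))" for t
  proof -
    have "(\<Sum>v\<in>V. x v + t * z v) = 0" using x0 z0 by (simp add: sum.distrib sum_distrib_left[symmetric])
    from low[OF this]
    have "0 \<le> energy V E x + 4 * t * (\<Sum>u\<in>V. laplacian V E x u * z u) + t\<^sup>2 * energy V E z
      - 2 * \<mu> * (\<Sum>u\<in>V. (x u + t * z u)\<^sup>2)" using energy_add[of E V x t z] sym by simp
    also have "(\<Sum>u\<in>V. (x u + t * z u)\<^sup>2)
      = (\<Sum>u\<in>V. (x u)\<^sup>2) + 2 * t * (\<Sum>u\<in>V. x u * z u) + t\<^sup>2 * (\<Sum>v\<in>V. (z v)\<^sup>2)"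
      unfolding sum_distrib_left sum.distrib[symmetric]
      by (intro sum.cong refl) (simp add: power2_eq_square algebra_simps)
    also have "(\<Sum>u\<in>V. laplacian V E x u * z u) = (\<Sum>v\<in>V. z v * z v) + \<mu> * (\<Sum>u\<in>V. x u * z u)"
      unfolding sum_distrib_left sum.distrib[symmetric] by (intro sum.cong refl) (simp add: z_def algebra_simps)
    finally show ?thesis using eq by (simp add: algebra_simps)
  qed
  from linear_coeff_eq_0[OF this] have "(\<Sum>v\<in>V. z v * z v) = 0" by simp
  then have "z u * z u = 0" using sum_nonneg_eq_0_iff[OF fin, of "\<lambda>v. z v * z v"] u by simp
  then show ?thesis by (simp add: z_def)
qed

text \<open>Compactness: the functions of sum 0 and norm 1 form a closed subset of a product of
  compact sets, on which the energy attains its minimum. Other functions of sum 0 are scaled into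
  this set.\<close>

lemma rayleigh_minimum_exists:
  assumes fin: "finite V" and uv: "u \<in> V" "v \<in> V" "u \<noteq> v"
  obtains x \<mu> where "\<exists>u\<in>V. x u \<noteq> 0" "(\<Sum>u\<in>V. x u) = 0" "energy V E x = 2 * \<mu> * (\<Sum>u\<in>V. (x u)\<^sup>2)"
    "\<And>y. (\<Sum>u\<in>V. y u) = 0 \<Longrightarrow> 2 * \<mu> * (\<Sum>u\<in>V. (y u)\<^sup>2) \<le> energy V E y"
proof -
  \<comment> \<open>Functions are defined on the whole type; fixing the value 0 outside
    \<open>V\<close> keeps every factor compact, so that the product is compact.\<close>
  define K :: "'a \<Rightarrow> real set" where "K w = (if w \<in> V then {-1..1} else {0})" for w
  define C where "C = PiE UNIV K"
  define Z where "Z = C \<inter> {y. (\<Sum>w\<in>V. y w) = 0} \<inter> {y. (\<Sum>w\<in>V. (y w)\<^sup>2) = 1}"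
  have cont: "continuous_on A (\<lambda>y :: 'a \<Rightarrow> real. y w)" for w A
    by (rule continuous_on_subset[OF continuous_on_product_coordinates]) simp
  have "compactin (product_topology (\<lambda>_. euclidean) UNIV) C"
    unfolding C_def compactin_PiE by (auto simp: K_def)
  then have "compact C" by (simp add: euclidean_product_topology)
  moreover have "closed {y :: 'a \<Rightarrow> real. (\<Sum>w\<in>V. y w) = 0}" "closed {y :: 'a \<Rightarrow> real. (\<Sum>w\<in>V. (y w)\<^sup>2) = 1}"
    by (intro closed_Collect_eq continuous_intros cont)+
  ultimately have "compact Z" unfolding Z_def by (intro compact_Int_closed)
  \<comment> \<open>The normalised difference of two point masses shows that \<open>Z\<close> is not
    empty.\<close>
  moreover define y0 :: "'a \<Rightarrow> real" where "y0 w = (if w = u then 1 / sqrt 2 else if w = v then - 1 / sqrt 2 else 0)" for w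
  have sums: "(\<Sum>w\<in>V. y0 w) = 0" "(\<Sum>w\<in>V. (y0 w)\<^sup>2) = 1"
  proof -
    have "(\<Sum>w\<in>V. y0 w) = (\<Sum>w\<in>{u,v}. y0 w)"
      by (rule sum.mono_neutral_right[OF fin]) (use uv in \<open>auto simp: y0_def\<close>)
    moreover have "(\<Sum>w\<in>V. (y0 w)\<^sup>2) = (\<Sum>w\<in>{u,v}. (y0 w)\<^sup>2)"
      by (rule sum.mono_neutral_right[OF fin]) (use uv in \<open>auto simp: y0_def\<close>)
    ultimately show "(\<Sum>w\<in>V. y0 w) = 0" "(\<Sum>w\<in>V. (y0 w)\<^sup>2) = 1" using uv by (auto simp: y0_def power_divide)
  qed
  have "- 1 \<le> 1 / sqrt (2::real)" by (rule order_trans[of _ 0]) auto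
  then have "y0 w \<in> K w" for w using uv by (auto simp: K_def y0_def)
  then have "y0 \<in> Z" using sums by (simp add: Z_def C_def PiE_UNIV_domain)
  moreover have "continuous_on Z (energy V E)"
  proof -
    have "continuous_on Z (\<lambda>y. if E a b then (y a - y b)\<^sup>2 else 0)" for a b
      by (cases "E a b") (auto intro!: continuous_intros cont)
    then show ?thesis unfolding energy_def by (intro continuous_intros)
  qed
  ultimately obtain x where x: "x \<in> Z" "\<And>y. y \<in> Z \<Longrightarrow> energy V E x \<le> energy V E y"
    using continuous_attains_inf[of Z "energy V E"] by auto
  show thesis
  proof
    show "\<exists>u\<in>V. x u \<noteq> 0"
    proof (rule ccontr)
      assume "\<not> ?thesis"
      then have "(\<Sum>w\<in>V. (x w)\<^sup>2) = 0" by simp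
      then show False using x by (simp add: Z_def)
    qed
    show "(\<Sum>u\<in>V. x u) = 0" "energy V E x = 2 * (energy V E x / 2) * (\<Sum>u\<in>V. (x u)\<^sup>2)"
      using x by (auto simp: Z_def)
    fix y :: "'a \<Rightarrow> real" assume y: "(\<Sum>u\<in>V. y u) = 0"
    define q where "q = (\<Sum>w\<in>V. (y w)\<^sup>2)"
    show "2 * (energy V E x / 2) * (\<Sum>w\<in>V. (y w)\<^sup>2) \<le> energy V E y"
    proof (cases "q = 0")
      case True
      moreover have "0 \<le> energy V E y" unfolding energy_def by (intro sum_nonneg) auto
      ultimately show ?thesis by (simp add: q_def)
    next
      case False
      have q: "q > 0" using False unfolding q_def by (simp add: order_less_le sum_nonneg)
      define y' where "y' w = (if w \<in> V then y w / sqrt q else 0)" for w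
      have le: "(y w)\<^sup>2 \<le> q" if "w \<in> V" for w
        unfolding q_def using fin that by (intro member_le_sum) auto
      have "- sqrt q \<le> y w \<and> y w \<le> sqrt q" if "w \<in> V" for w
        using real_le_rsqrt[of "\<bar>y w\<bar>" q] le[OF that] by (simp add: abs_le_iff)
      then have "y' \<in> C" using q by (auto simp: C_def K_def y'_def abs_le_iff field_simps)
      moreover have "(\<Sum>w\<in>V. y' w) = 0" using y by (simp add: y'_def sum_divide_distrib[symmetric])
      moreover have "(\<Sum>w\<in>V. (y' w)\<^sup>2) = 1"
        using q by (simp add: y'_def power_divide sum_divide_distrib[symmetric] q_def[symmetric])
      ultimately have "energy V E x \<le> energy V E y'" using x by (simp add: Z_def)
      also have "energy V E y' = energy V E y / q"
        unfolding energy_def sum_divide_distrib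
        by (intro sum.cong refl) (use q in \<open>auto simp: y'_def power_divide diff_divide_distrib[symmetric]\<close>)
      finally show ?thesis using q by (simp add: field_simps q_def[symmetric])
    qed
  qed
qed

text \<open>No edge can join different values, so a level set is closed under adjacency and by
  connectedness contains all vertices.\<close>

lemma energy_eq_0_imp_const:
  assumes E: "quartic_rel V E" and e: "energy V E x \<le> 0" and uv: "u \<in> V" "v \<in> V"
  shows "x u = x v"
proof -
  have inner: "0 \<le> (\<Sum>v\<in>V. if E u v then (x u - x v)\<^sup>2 else 0)" for u by (intro sum_nonneg) auto
  then have "energy V E x = 0" using e unfolding energy_def by (intro antisym sum_nonneg) auto
  then have "\<forall>u\<in>V. (\<Sum>v\<in>V. if E u v then (x u - x v)\<^sup>2 else 0) = 0"
    unfolding energy_def by (subst (asm) sum_nonneg_eq_0_iff[OF quartic_relD(1)[OF E]]) (use inner in auto)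
  then have "\<forall>u\<in>V. \<forall>v\<in>V. (if E u v then (x u - x v)\<^sup>2 else 0) = 0"
    by (subst (asm) sum_nonneg_eq_0_iff[OF quartic_relD(1)[OF E]]) auto
  then have eq: "x a = x b" if "E a b" for a b
    using that quartic_relD(3,4)[OF E that] by fastforce
  have "{w\<in>V. x w = x u} = V"
    using uv eq quartic_relD(4)[OF E] by (intro quartic_relD(9)[OF E]) auto
  then have "v \<in> {w\<in>V. x w = x u}" using uv by simp
  then show ?thesis by simp
qed

lemma laplacian_quartic:
  assumes E: "quartic_rel V E" and u: "u \<in> V"
  shows "laplacian V E x u = 4 * x u - (\<Sum>v\<in>V. if E u v then x v else 0)"
proof -
  have "laplacian V E x u = (\<Sum>v\<in>V. (if E u v then x u else 0) - (if E u v then x v else 0))"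
    unfolding laplacian_def by (intro sum.cong) auto
  also have "\<dots> = (\<Sum>v\<in>V. if E u v then x u else 0) - (\<Sum>v\<in>V. if E u v then x v else 0)"
    by (rule sum_subtractf)
  also have "(\<Sum>v\<in>V. if E u v then x u else 0) = (\<Sum>v\<in>{v. E u v}. x u)"
    by (rule sum.mono_neutral_cong_right) (use quartic_relD[OF E] in auto)
  also have "\<dots> = 4 * x u" using quartic_relD(7)[OF E u] by simp
  finally show ?thesis .
qed

text \<open>The real and the imaginary part both have energy 0. Complex values occur because the
  triangularisation in \<open>order_4_char_poly\<close> is over the complex numbers.\<close>

lemma harmonic_const:
  fixes f :: "'a \<Rightarrow> complex"
  assumes E: "quartic_rel V E" and f: "\<And>u. u \<in> V \<Longrightarrow> (\<Sum>v\<in>V. if E u v then f v else 0) = 4 * f u"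
    and uv: "u \<in> V" "v \<in> V"
  shows "f u = f v"
proof -
  have *: "g u = g v" if g: "\<And>u. u \<in> V \<Longrightarrow> (\<Sum>v\<in>V. if E u v then g v else 0) = 4 * g u" for g :: "'a \<Rightarrow> real"
  proof -
    have "energy V E g = 0"
      using energy_eq_laplacian[of E V g] quartic_relD(6)[OF E] laplacian_quartic[OF E] g by simp
    then show ?thesis using energy_eq_0_imp_const[OF E _ uv] by simp
  qed
  have "(\<Sum>v\<in>V. if E u v then Re (f v) else 0) = 4 * Re (f u)" if "u \<in> V" for u
    using arg_cong[OF f[OF that], of Re] by (simp add: if_distrib cong: if_cong)
  moreover have "(\<Sum>v\<in>V. if E u v then Im (f v) else 0) = 4 * Im (f u)" if "u \<in> V" for u
    using arg_cong[OF f[OF that], of Im] by (simp add: if_distrib cong: if_cong)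
  ultimately show ?thesis using *[of "\<lambda>u. Re (f u)"] *[of "\<lambda>u. Im (f u)"] by (simp add: complex_eq_iff)
qed

section \<open>The adjacency spectrum\<close>

lemma adjacency_matrix_carrier: "adjacency_matrix G vs \<in> carrier_mat (length vs) (length vs)"
  by (simp add: adjacency_matrix_def)

lemma sum_list_index:
  assumes "distinct vs" "set vs = V"
  shows "(\<Sum>j<length vs. f (vs ! j)) = (\<Sum>v\<in>V. f v)"
  using sum.reindex_bij_betw[OF bij_betw_nth[OF assms(1) refl refl], of f] assms(2) by simp

text \<open>If 4 were a double root, there would be a Schur form with 4, 4 leading its diagonal. The
  first column of \<open>P\<close> is then an eigenvector for 4, hence constant; the second
  satisfies the same equation up to a multiple of the first. Summing entries shows that this
  multiple is 0, so the second column is constant as well, which contradicts the invertibility of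
  \<open>P\<close>.\<close>

lemma order_4_char_poly:
  assumes G: "G \<in> connected_quartic_graphs n" and vs: "distinct vs" "set vs = pverts G"
  shows "Polynomial.order 4 (char_poly (adjacency_matrix G vs)) \<le> 1"
proof (rule ccontr)
  define V where "V = pverts G"
  define E where "E u v \<longleftrightarrow> (u, v) \<in> parcs G" for u v
  define n where "n = length vs"
  define A where "A = adjacency_matrix G vs"
  define C :: "complex mat" where "C = map_mat of_real A"
  have E: "quartic_rel V E" using quartic_rel_of_graph[OF G] by (simp add: V_def E_def[abs_def])
  have vs: "distinct vs" "set vs = V" using vs by (auto simp: V_def)
  have vsV: "vs ! i \<in> V" if "i < n" for i using that vs n_def by auto
  have A: "A \<in> carrier_mat n n" by (simp add: A_def n_def adjacency_matrix_carrier)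
  then have C: "C \<in> carrier_mat n n" by (simp add: C_def)
  assume "\<not> Polynomial.order 4 (char_poly (adjacency_matrix G vs)) \<le> 1"
  then have "[:- 4, 1:]\<^sup>2 dvd char_poly A"
    using power_le_dvd order_1 unfolding A_def by (metis not_less_eq_eq numeral_2_eq_2 One_nat_def)
  then obtain q0 where q0: "char_poly A = [:- 4, 1:]\<^sup>2 * q0" by auto
  define q where "q = map_poly complex_of_real q0"
  have lin: "map_poly complex_of_real [:- 4, 1:] = [:- 4, 1:]" by simp
  interpret of_real_poly: map_poly_comm_ring_hom complex_of_real ..
  have cp: "char_poly C = [:- 4, 1:] * ([:- 4, 1:] * q)"
    unfolding C_def of_real_hom.char_poly_hom[OF A] q0 power2_eq_square of_real_poly.hom_mult lin q_def
    by (rule mult.assoc)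
  obtain as where as: "Polynomial.smult (lead_coeff q) (\<Prod>a\<leftarrow>as. [:- a, 1:]) = q"
    using fundamental_theorem_algebra_factorized[of q] by blast
  have "lead_coeff (char_poly C) = 1" using degree_monic_char_poly[OF C] by simp
  then have "lead_coeff q = 1" unfolding cp lead_coeff_mult by simp
  then have cp: "char_poly C = (\<Prod>a\<leftarrow>4 # 4 # as. [:- a, 1:])" using as cp by simp
  obtain B P Q where "schur_decomposition C (4 # 4 # as) = (B, P, Q)" by (metis prod_cases3)
  from schur_decomposition[OF C cp this]
  have sim: "similar_mat_wit C B P Q" and ut: "upper_triangular B" and diag: "diag_mat B = 4 # 4 # as" by auto
  from similar_mat_witD2[OF C sim] have PQ: "Q * P = 1\<^sub>m n" and CPB: "C = P * B * Q"
    and B: "B \<in> carrier_mat n n" and P: "P \<in> carrier_mat n n" and Q: "Q \<in> carrier_mat n n" by auto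
  have "length (diag_mat B) = n" using B by (simp add: diag_mat_def)
  with diag have n: "1 < n" by auto
  have B00: "B $$ (0, 0) = 4" "B $$ (1, 1) = 4"
    using arg_cong[OF diag, of "\<lambda>l. l ! 0"] arg_cong[OF diag, of "\<lambda>l. l ! 1"] B n by (auto simp: diag_mat_def)
  have "C * P = P * B * (Q * P)" unfolding CPB by (rule assoc_mult_mat[of _ n n _ n _ n]) (use P B Q in auto)
  then have CP: "C * P = P * B" using PQ P B by simp
  have idx: "(\<Sum>v\<in>V. if E (vs ! i) v then g v else 0) = (\<Sum>j<n. C $$ (i, j) * g (vs ! j))" if "i < n"
    for i and g :: "'a \<Rightarrow> complex"
  proof -
    have "(\<Sum>j<n. C $$ (i, j) * g (vs ! j)) = (\<Sum>j<n. if E (vs ! i) (vs ! j) then g (vs ! j) else 0)"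
      by (intro sum.cong refl) (use that in \<open>auto simp: C_def A_def adjacency_matrix_def n_def E_def\<close>)
    also have "\<dots> = (\<Sum>v\<in>V. if E (vs ! i) v then g v else 0)" unfolding n_def by (rule sum_list_index[OF vs])
    finally show ?thesis by simp
  qed
  have entry: "(\<Sum>j<n. C $$ (i, j) * P $$ (j, k)) = (\<Sum>j<n. P $$ (i, j) * B $$ (j, k))" if "i < n" "k < n" for i k
  proof -
    have "(C * P) $$ (i, k) = (P * B) $$ (i, k)" using CP by simp
    then show ?thesis using that C P B by (simp add: scalar_prod_def atLeast0LessThan)
  qed
  have QP: "(\<Sum>j<n. Q $$ (i, j) * P $$ (j, k)) = (if i = k then 1 else 0)" if "i < n" "k < n" for i k
  proof -
    have "(Q * P) $$ (i, k) = 1\<^sub>m n $$ (i, k)" using PQ by simp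
    then show ?thesis using that Q P by (simp add: scalar_prod_def atLeast0LessThan)
  qed
  have Bz: "B $$ (i, j) = 0" if "j < i" "i < n" for i j using ut that B by auto
  have col0: "(\<Sum>j<n. P $$ (i, j) * B $$ (j, 0)) = 4 * P $$ (i, 0)" for i
  proof -
    have "(\<Sum>j<n. P $$ (i, j) * B $$ (j, 0)) = (\<Sum>j\<in>{0}. P $$ (i, j) * B $$ (j, 0))"
      by (rule sum.mono_neutral_right) (use n Bz in auto)
    then show ?thesis using B00 by simp
  qed
  have col1: "(\<Sum>j<n. P $$ (i, j) * B $$ (j, 1)) = P $$ (i, 0) * B $$ (0, 1) + 4 * P $$ (i, 1)" for i
  proof -
    have "(\<Sum>j<n. P $$ (i, j) * B $$ (j, 1)) = (\<Sum>j\<in>{0, 1}. P $$ (i, j) * B $$ (j, 1))"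
      by (rule sum.mono_neutral_right) (use n Bz in auto)
    then show ?thesis using B00 by simp
  qed
  define pos where "pos = the_inv_into {..<n} ((!) vs)"
  have pos: "pos (vs ! i) = i" if "i < n" for i
    unfolding pos_def using that vs by (intro the_inv_into_f_f) (auto simp: inj_on_def nth_eq_iff_index_eq n_def)
  have const: "P $$ (i, k) = P $$ (0, k)"
    if k: "k < n" and ev: "\<And>i. i < n \<Longrightarrow> (\<Sum>j<n. C $$ (i, j) * P $$ (j, k)) = 4 * P $$ (i, k)" and i: "i < n" for i k
  proof -
    define g where "g u = P $$ (pos u, k)" for u
    have "(\<Sum>v\<in>V. if E u v then g v else 0) = 4 * g u" if "u \<in> V" for u
    proof -
      obtain i where i: "i < n" "u = vs ! i" using \<open>u \<in> V\<close> vs n_def by (metis in_set_conv_nth)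
      have "(\<Sum>v\<in>V. if E u v then g v else 0) = (\<Sum>j<n. C $$ (i, j) * P $$ (j, k))"
        unfolding i(2) idx[OF i(1)] by (intro sum.cong refl) (simp add: g_def pos)
      then show ?thesis using ev[OF i(1)] i by (simp add: g_def pos)
    qed
    then have "g (vs ! i) = g (vs ! 0)" using harmonic_const[OF E] vsV n i by simp
    then show ?thesis using n i by (simp add: g_def pos)
  qed
  have c0: "P $$ (i, 0) = P $$ (0, 0)" if "i < n" for i
    using const[of 0 i] n that entry[of _ 0] col0 by simp
  have nz: "P $$ (0, 0) \<noteq> 0"
  proof
    assume "P $$ (0, 0) = 0"
    then have "P $$ (j, 0) = 0" if "j < n" for j using c0[OF that] by simp
    then have "(\<Sum>j<n. Q $$ (0, j) * P $$ (j, 0)) = 0" by simp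
    then show False using QP[of 0 0] n by simp
  qed
  have colsum: "(\<Sum>i<n. C $$ (i, j)) = 4" if j: "j < n" for j
  proof -
    have "(\<Sum>i<n. C $$ (i, j)) = (\<Sum>i<n. C $$ (j, i) * 1)"
    proof (intro sum.cong refl)
      fix i assume "i \<in> {..<n}"
      moreover have "E (vs ! i) (vs ! j) \<longleftrightarrow> E (vs ! j) (vs ! i)" using quartic_relD(6)[OF E] by blast
      ultimately show "C $$ (i, j) = C $$ (j, i) * 1"
        using j by (simp add: C_def A_def adjacency_matrix_def n_def E_def)
    qed
    also have "\<dots> = (\<Sum>v\<in>V. if E (vs ! j) v then 1 else 0)" using idx[OF j, of "\<lambda>_. 1"] by simp
    also have "\<dots> = (\<Sum>v\<in>{v. E (vs ! j) v}. 1)"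
      by (rule sum.mono_neutral_cong_right) (use quartic_relD[OF E] in auto)
    finally show ?thesis using quartic_relD(7)[OF E vsV[OF j]] by simp
  qed
  \<comment> \<open>Since all column sums of \<open>C\<close> are 4, the entries of the second
    column of \<open>P\<close> cancel in the sum, and only \<open>n\<close> times the off-diagonal
    contribution remains.\<close>
  have "(\<Sum>i<n. \<Sum>j<n. C $$ (i, j) * P $$ (j, 1)) = (\<Sum>j<n. 4 * P $$ (j, 1))"
    by (subst sum.swap) (simp add: sum_distrib_right[symmetric] colsum)
  moreover have "(\<Sum>i<n. \<Sum>j<n. C $$ (i, j) * P $$ (j, 1)) = (\<Sum>i<n. P $$ (0, 0) * B $$ (0, 1) + 4 * P $$ (i, 1))"
  proof (intro sum.cong refl)
    fix i assume "i \<in> {..<n}"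
    then show "(\<Sum>j<n. C $$ (i, j) * P $$ (j, 1)) = P $$ (0, 0) * B $$ (0, 1) + 4 * P $$ (i, 1)"
      using entry[of i 1] col1[of i] c0[of i] n by simp
  qed
  ultimately have "of_nat n * (P $$ (0, 0) * B $$ (0, 1)) = 0" by (simp add: sum.distrib)
  then have "B $$ (0, 1) = 0" using nz n by simp
  then have c1: "P $$ (i, 1) = P $$ (0, 1)" if "i < n" for i
    using const[of 1 i] n that entry[of _ 1] col1 by simp
  have "(\<Sum>j<n. Q $$ (0, j) * P $$ (j, 0)) = (\<Sum>j<n. Q $$ (0, j)) * P $$ (0, 0)"
    "(\<Sum>j<n. Q $$ (0, j) * P $$ (j, 1)) = (\<Sum>j<n. Q $$ (0, j)) * P $$ (0, 1)"
    "(\<Sum>j<n. Q $$ (1, j) * P $$ (j, 1)) = (\<Sum>j<n. Q $$ (1, j)) * P $$ (0, 1)"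
    unfolding sum_distrib_right by (rule sum.cong[OF refl]; metis c0 c1 lessThan_iff)+
  then show False using QP[of 0 0] QP[of 0 1] QP[of 1 1] n by auto
qed

text \<open>An adjacency eigenvalue \<open>e\<close> is a Laplacian eigenvalue \<open>4 - e\<close>.
  For \<open>e \<noteq> 4\<close> its eigenvector has sum 0, because Laplacian values always sum to
  0, so the Rayleigh bound yields \<open>e \<le> 4 - \<mu>\<close>. As 4 is a simple root, the
  increasing list of eigenvalues ends with \<open>4 - \<mu>\<close> and 4.\<close>

lemma spectral_gap_eq:
  assumes G: "G \<in> connected_quartic_graphs n"
    and V: "V = pverts G" and Edef: "E = (\<lambda>u v. (u, v) \<in> parcs G)"
    and x0: "\<exists>u\<in>V. x u \<noteq> 0" and xsum: "(\<Sum>u\<in>V. x u) = 0"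
    and low: "\<And>y. (\<Sum>u\<in>V. y u) = 0 \<Longrightarrow> 2 * \<mu> * (\<Sum>u\<in>V. (y u)\<^sup>2) \<le> energy V E y"
    and eig: "\<And>u. u \<in> V \<Longrightarrow> laplacian V E x u = \<mu> * x u"
  shows "spectral_gap G = \<mu>" "0 < \<mu>"
proof -
  have E: "quartic_rel V E" using quartic_rel_of_graph[OF G] by (simp add: V Edef)
  note symE = quartic_relD(6)[OF E]
  have finV: "finite V" using quartic_relD(1)[OF E] .
  define vs where "vs = (SOME vs. distinct vs \<and> set vs = pverts G)"
  have "\<exists>vs. distinct vs \<and> set vs = pverts G" using finite_distinct_list finV V by metis
  from someI_ex[OF this] have vs: "distinct vs" "set vs = V" unfolding vs_def V by auto
  define m where "m = length vs"
  define A where "A = adjacency_matrix G vs"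
  have A: "A \<in> carrier_mat m m" by (simp add: A_def m_def adjacency_matrix_carrier)
  define p where "p = char_poly A"
  have p0: "p \<noteq> 0" using degree_monic_char_poly[OF A] unfolding p_def by auto
  have mult: "(A *\<^sub>v vec m (\<lambda>i. f (vs ! i))) = vec m (\<lambda>i. \<Sum>v\<in>V. if E (vs ! i) v then f v else 0)" for f
  proof (intro eq_vecI)
    fix i assume "i < dim_vec (vec m (\<lambda>i. \<Sum>v\<in>V. if E (vs ! i) v then f v else 0))"
    then have i: "i < m" by simp
    have "vec_index (A *\<^sub>v vec m (\<lambda>i. f (vs ! i))) i = (\<Sum>j<m. if E (vs ! i) (vs ! j) then f (vs ! j) else 0)"
      using i A by (auto simp: scalar_prod_def A_def adjacency_matrix_def m_def Edef atLeast0LessThan intro!: sum.cong)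
    also have "\<dots> = (\<Sum>v\<in>V. if E (vs ! i) v then f v else 0)" unfolding m_def by (rule sum_list_index[OF vs])
    finally show "vec_index (A *\<^sub>v vec m (\<lambda>i. f (vs ! i))) i = vec_index (vec m (\<lambda>i. \<Sum>v\<in>V. if E (vs ! i) v then f v else 0)) i"
      using i by simp
  qed (use A in simp)
  have vsV: "vs ! i \<in> V" if "i < m" for i using that vs m_def by auto
  have ex_idx: "\<exists>i<m. u = vs ! i" if "u \<in> V" for u using that vs m_def by (metis in_set_conv_nth)
  have rootI: "poly p e = 0" if f: "\<exists>u\<in>V. f u \<noteq> 0" "\<And>u. u \<in> V \<Longrightarrow> laplacian V E f u = (4 - e) * f u" for e f
  proof -
    have "eigenvector A (vec m (\<lambda>i. f (vs ! i))) e"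
      unfolding eigenvector_def
    proof (intro conjI)
      show "vec m (\<lambda>i. f (vs ! i)) \<noteq> 0\<^sub>v (dim_row A)"
      proof
        assume *: "vec m (\<lambda>i. f (vs ! i)) = 0\<^sub>v (dim_row A)"
        obtain u where "u \<in> V" "f u \<noteq> 0" using f by auto
        then obtain i where i: "i < m" "f (vs ! i) \<noteq> 0" using ex_idx by metis
        then show False using arg_cong[OF *, of "\<lambda>v. vec_index v i"] A by auto
      qed
      have "(\<Sum>v\<in>V. if E u v then f v else 0) = e * f u" if "u \<in> V" for u
        using f(2)[OF that] laplacian_quartic[OF E that, of f] by (simp add: algebra_simps)
      then show "A *\<^sub>v vec m (\<lambda>i. f (vs ! i)) = e \<cdot>\<^sub>v vec m (\<lambda>i. f (vs ! i))"
        unfolding mult using vsV by auto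
    qed (use A in simp)
    then show ?thesis unfolding p_def eigenvalue_root_char_poly[OF A, symmetric] eigenvalue_def by blast
  qed
  have root_le: "e \<le> 4 - \<mu>" if "poly p e = 0" "e \<noteq> 4" for e
  proof -
    have "eigenvalue A e" using that unfolding p_def by (simp add: eigenvalue_root_char_poly[OF A])
    then obtain w where w: "w \<in> carrier_vec m" "w \<noteq> 0\<^sub>v m" "A *\<^sub>v w = e \<cdot>\<^sub>v w"
      using A unfolding eigenvalue_def eigenvector_def by auto
    define pos where "pos = the_inv_into {..<m} ((!) vs)"
    have pos: "pos (vs ! i) = i" if "i < m" for i
      unfolding pos_def using that vs by (intro the_inv_into_f_f) (auto simp: inj_on_def nth_eq_iff_index_eq m_def)
    define f where "f u = vec_index w (pos u)" for u
    have wf: "w = vec m (\<lambda>i. f (vs ! i))" using w(1) by (intro eq_vecI) (auto simp: f_def pos)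
    have ev: "(\<Sum>v\<in>V. if E u v then f v else 0) = e * f u" if u: "u \<in> V" for u
    proof -
      obtain i where i: "i < m" "u = vs ! i" using ex_idx[OF u] by blast
      have "vec_index (A *\<^sub>v w) i = vec_index (e \<cdot>\<^sub>v w) i" using w by simp
      then show ?thesis using i unfolding wf mult by simp
    qed
    have lap: "laplacian V E f u = (4 - e) * f u" if "u \<in> V" for u
      using laplacian_quartic[OF E that, of f] ev[OF that] by (simp add: algebra_simps)
    then have "(\<Sum>u\<in>V. (4 - e) * f u) = 0" using sum_laplacian_eq_0[of E V f] symE by simp
    then have f0: "(\<Sum>u\<in>V. f u) = 0" using that by (simp add: sum_distrib_left[symmetric])
    have "\<exists>i<m. f (vs ! i) \<noteq> 0"
    proof (rule ccontr)
      assume "\<not> ?thesis"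
      then have "w = 0\<^sub>v m" unfolding wf by (intro eq_vecI) auto
      then show False using w by simp
    qed
    then obtain u where u: "u \<in> V" "f u \<noteq> 0" using vsV by blast
    have "0 < (f u)\<^sup>2" using u by simp
    also have "\<dots> \<le> (\<Sum>u\<in>V. (f u)\<^sup>2)" using finV u by (intro member_le_sum) auto
    finally have pos: "0 < (\<Sum>u\<in>V. (f u)\<^sup>2)" .
    have "energy V E f = 2 * (\<Sum>u\<in>V. laplacian V E f u * f u)" using energy_eq_laplacian[of E V f] symE by simp
    also have "(\<Sum>u\<in>V. laplacian V E f u * f u) = (4 - e) * (\<Sum>u\<in>V. (f u)\<^sup>2)"
      unfolding sum_distrib_left by (intro sum.cong refl) (simp add: lap power2_eq_square)
    finally have "\<mu> * (\<Sum>u\<in>V. (f u)\<^sup>2) \<le> (4 - e) * (\<Sum>u\<in>V. (f u)\<^sup>2)" using low[OF f0] by simp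
    then show ?thesis using pos by simp
  qed
  show mu: "0 < \<mu>"
  proof (rule ccontr)
    assume "\<not> 0 < \<mu>"
    moreover have "energy V E x = 2 * \<mu> * (\<Sum>u\<in>V. (x u)\<^sup>2)"
    proof -
      have "(\<Sum>u\<in>V. laplacian V E x u * x u) = \<mu> * (\<Sum>u\<in>V. (x u)\<^sup>2)"
        unfolding sum_distrib_left by (intro sum.cong refl) (simp add: eig power2_eq_square)
      then show ?thesis using energy_eq_laplacian[of E V x] symE by simp
    qed
    ultimately have "energy V E x \<le> 0" by (simp add: mult_nonpos_nonneg sum_nonneg)
    then have c: "x u = x v" if "u \<in> V" "v \<in> V" for u v using energy_eq_0_imp_const[OF E] that by blast
    obtain u where u: "u \<in> V" "x u \<noteq> 0" using x0 by auto
    have "(\<Sum>v\<in>V. x v) = (\<Sum>v\<in>V. x u)" by (rule sum.cong[OF refl], rule c) (use u in auto)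
    also have "\<dots> = real (card V) * x u" by simp
    finally have "real (card V) * x u = 0" using xsum by simp
    moreover have "card V \<noteq> 0" using u(1) finV by auto
    ultimately show False using u(2) by simp
  qed
  have r4: "poly p 4 = 0"
    by (rule rootI[of "\<lambda>_. 1"]) (use quartic_relD(2)[OF E] in \<open>auto simp: laplacian_def\<close>)
  have rmu: "poly p (4 - \<mu>) = 0" by (rule rootI[of x]) (use x0 eig in auto)
  have ord: "Polynomial.order 4 p = 1"
  proof -
    have "Polynomial.order 4 p \<le> 1" unfolding p_def A_def by (rule order_4_char_poly[OF G]) (use vs V in auto)
    moreover have "Polynomial.order 4 p \<noteq> 0" using r4 p0 by (simp add: order_root)
    ultimately show ?thesis by simp
  qed
  define M where "M = proots p - {#4, 4 - \<mu>#}"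
  have count: "count (proots p) e = Polynomial.order e p" for e using p0 by simp
  have "Polynomial.order (4 - \<mu>) p \<noteq> 0" using rmu p0 by (simp add: order_root)
  then have sub: "{#4, 4 - \<mu>#} \<subseteq># proots p" using ord mu count
    by (auto simp: subseteq_mset_def)
  then have pr: "proots p = M + {#4, 4 - \<mu>#}" unfolding M_def by (rule subset_mset.diff_add[symmetric])
  have M_le: "e \<le> 4 - \<mu>" if "e \<in># M" for e
  proof -
    have "count (proots p) e \<noteq> 0" using that pr by simp
    then have "Polynomial.order e p \<noteq> 0" using count by simp
    then have "poly p e = 0" by (simp add: order_root)
    moreover have "e \<noteq> 4"
    proof
      assume "e = 4"
      then have "count M 4 \<noteq> 0" using that by simp
      then have "count (proots p) 4 \<ge> 2" unfolding pr by simp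
      then show False using count ord by simp
    qed
    ultimately show ?thesis by (rule root_le)
  qed
  define l where "l = sorted_list_of_multiset M"
  have "e \<le> 4" if "e \<in># M" for e using M_le[OF that] mu by simp
  then have "sorted (l @ [4 - \<mu>, 4])" using M_le mu by (auto simp: l_def sorted_append)
  then have "sort (l @ [4 - \<mu>, 4]) = l @ [4 - \<mu>, 4]" by (rule sorted_sort_id)
  moreover have "mset (l @ [4 - \<mu>, 4]) = proots p" by (simp add: pr l_def)
  ultimately have "sorted_list_of_multiset (proots p) = l @ [4 - \<mu>, 4]"
    by (metis sorted_list_of_multiset_mset)
  then have "adjacency_eigenvalues G = l @ [4 - \<mu>, 4]"
    unfolding adjacency_eigenvalues_def p_def A_def vs_def by simp
  then show "spectral_gap G = \<mu>" by (simp add: spectral_gap_def)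
qed

lemma quartic_two_vertices:
  assumes E: "quartic_rel V E"
  obtains u v where "u \<in> V" "v \<in> V" "u \<noteq> v"
proof -
  obtain u where u: "u \<in> V" using quartic_relD(2)[OF E] by auto
  have "{v. E u v} \<noteq> {}" using quartic_relD(7)[OF E u] by force
  then obtain v where "E u v" by auto
  then show thesis using that quartic_relD[OF E] by blast
qed

text \<open>The gap \<open>\<nu>\<close> of a competitor \<open>F\<close> is at least
  \<open>\<mu>\<close>, so the Rayleigh bound with \<open>\<mu>\<close> also holds for
  \<open>F\<close>. If the energy of \<open>x\<close> on \<open>F\<close> is no larger than on
  \<open>E\<close>, then \<open>x\<close> attains this bound and is an eigenvector of
  \<open>F\<close> for the same \<open>\<mu>\<close>. Minimality enters the proof only here.\<close>

lemma fiedler_vector_of_minimal: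
  fixes G :: "'a pair_pre_digraph"
  assumes G: "G \<in> connected_quartic_graphs n"
    and min: "\<forall>H \<in> (connected_quartic_graphs n :: 'a pair_pre_digraph set). spectral_gap G \<le> spectral_gap H"
    and V: "V = pverts G" and Edef: "E = (\<lambda>u v. (u, v) \<in> parcs G)"
  obtains x \<mu> where "0 < \<mu>" "\<exists>u\<in>V. \<exists>v\<in>V. x u \<noteq> x v" "\<And>u. u \<in> V \<Longrightarrow> laplacian V E x u = \<mu> * x u"
    "\<And>F u. quartic_rel V F \<Longrightarrow> energy V F x \<le> energy V E x \<Longrightarrow> u \<in> V \<Longrightarrow> laplacian V F x u = \<mu> * x u"
proof -
  have E: "quartic_rel V E" and n: "card V = n" using quartic_rel_of_graph[OF G] by (auto simp: V Edef)
  obtain a b where ab: "a \<in> V" "b \<in> V" "a \<noteq> b" using quartic_two_vertices[OF E] .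
  have fin: "finite V" using quartic_relD(1)[OF E] .
  have main: "\<exists>x \<mu>. (\<exists>u\<in>V. x u \<noteq> 0) \<and> (\<Sum>u\<in>V. x u) = 0 \<and> 0 < \<mu> \<and> energy V F x = 2 * \<mu> * (\<Sum>u\<in>V. (x u)\<^sup>2) \<and>
    (\<forall>u\<in>V. laplacian V F x u = \<mu> * x u) \<and>
    (\<forall>y. (\<Sum>u\<in>V. y u) = 0 \<longrightarrow> 2 * \<mu> * (\<Sum>u\<in>V. (y u)\<^sup>2) \<le> energy V F y) \<and>
    spectral_gap \<lparr>pverts = V, parcs = {(u, v). F u v}\<rparr> = \<mu>" if F: "quartic_rel V F" for F
  proof -
    obtain x \<mu> where x: "\<exists>u\<in>V. x u \<noteq> 0" "(\<Sum>u\<in>V. x u) = 0" "energy V F x = 2 * \<mu> * (\<Sum>u\<in>V. (x u)\<^sup>2)"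
      "\<And>y. (\<Sum>u\<in>V. y u) = 0 \<Longrightarrow> 2 * \<mu> * (\<Sum>u\<in>V. (y u)\<^sup>2) \<le> energy V F y"
      using rayleigh_minimum_exists[OF fin ab] by metis
    have eig: "laplacian V F x u = \<mu> * x u" if "u \<in> V" for u
      by (rule rayleigh_minimum_eigenvector[OF fin quartic_relD(6)[OF F] x(4) x(2) _ that]) (use x in auto)
    have "spectral_gap \<lparr>pverts = V, parcs = {(u, v). F u v}\<rparr> = \<mu>" "0 < \<mu>"
      by (rule spectral_gap_eq[OF graph_of_quartic_rel[OF F], of V F x]; use x eig in simp)+
    then show ?thesis using x eig by blast
  qed
  have GE: "\<lparr>pverts = V, parcs = {(u, v). E u v}\<rparr> = G" by (simp add: V Edef)
  obtain x \<mu> where x: "\<exists>u\<in>V. x u \<noteq> 0" "(\<Sum>u\<in>V. x u) = 0" "0 < \<mu>" "energy V E x = 2 * \<mu> * (\<Sum>u\<in>V. (x u)\<^sup>2)"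
    "\<forall>u\<in>V. laplacian V E x u = \<mu> * x u" "spectral_gap G = \<mu>"
    using main[OF E] unfolding GE by blast
  show thesis
  proof
    show "0 < \<mu>" by fact
    show "\<exists>u\<in>V. \<exists>v\<in>V. x u \<noteq> x v"
    proof (rule ccontr)
      assume c: "\<not> ?thesis"
      obtain u where u: "u \<in> V" "x u \<noteq> 0" using x(1) by auto
      have "x v = x u" if "v \<in> V" for v using c u(1) that by blast
      then have "(\<Sum>v\<in>V. x v) = (\<Sum>v\<in>V. x u)" by (rule sum.cong[OF refl])
      also have "\<dots> = real (card V) * x u" by simp
      finally have "real (card V) * x u = 0" using x(2) by simp
      moreover have "card V \<noteq> 0" using u(1) fin by auto
      ultimately show False using u(2) by simp
    qed
    show "laplacian V E x u = \<mu> * x u" if "u \<in> V" for u using x that by blast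
    fix F u assume F: "quartic_rel V F" and le: "energy V F x \<le> energy V E x" and u: "u \<in> V"
    obtain \<nu> where nu: "0 < \<nu>" "\<forall>y. (\<Sum>u\<in>V. y u) = 0 \<longrightarrow> 2 * \<nu> * (\<Sum>u\<in>V. (y u)\<^sup>2) \<le> energy V F y"
       "spectral_gap \<lparr>pverts = V, parcs = {(u, v). F u v}\<rparr> = \<nu>"
      using main[OF F] by blast
    have "\<mu> \<le> \<nu>" using min graph_of_quartic_rel[OF F] n nu(3) x(6) by auto
    have "2 * \<mu> * (\<Sum>u\<in>V. (y u)\<^sup>2) \<le> energy V F y" if "(\<Sum>u\<in>V. y u) = 0" for y
    proof -
      have "2 * \<mu> * (\<Sum>u\<in>V. (y u)\<^sup>2) \<le> 2 * \<nu> * (\<Sum>u\<in>V. (y u)\<^sup>2)"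
        using \<open>\<mu> \<le> \<nu>\<close> by (intro mult_right_mono sum_nonneg) auto
      then show ?thesis using nu(2) that by force
    qed
    from rayleigh_minimum_eigenvector[OF fin quartic_relD(6)[OF F] this x(2) _ u]
    show "laplacian V F x u = \<mu> * x u" using le x(4) by simp
  qed
qed

section \<open>Switching two edges\<close>

text \<open>The edges \<open>ab\<close> and \<open>cd\<close> give way to \<open>ac\<close> and
  \<open>bd\<close>, so degrees are kept; unordered pairs make the result symmetric.\<close>

definition switch :: "('a \<Rightarrow> 'a \<Rightarrow> bool) \<Rightarrow> 'a \<Rightarrow> 'a \<Rightarrow> 'a \<Rightarrow> 'a \<Rightarrow> 'a \<Rightarrow> 'a \<Rightarrow> bool" where
  "switch E a b c d u v \<longleftrightarrow>
     E u v \<and> {u, v} \<noteq> {a, b} \<and> {u, v} \<noteq> {c, d} \<or> {u, v} = {a, c} \<or> {u, v} = {b, d}"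

definition switchable :: "('a \<Rightarrow> 'a \<Rightarrow> bool) \<Rightarrow> 'a \<Rightarrow> 'a \<Rightarrow> 'a \<Rightarrow> 'a \<Rightarrow> bool" where
  "switchable E a b c d \<longleftrightarrow> E a b \<and> E c d \<and> \<not> E a c \<and> \<not> E b d \<and> a \<noteq> c \<and> b \<noteq> d"

text \<open>The obstruction to a switch: the removed edges \<open>ab\<close> and \<open>cd\<close>
  are the only ones that can leave \<open>S\<close>, while each new edge \<open>ac\<close>,
  \<open>bd\<close> would stay on one side.\<close>

definition cut2 :: "'a set \<Rightarrow> ('a \<Rightarrow> 'a \<Rightarrow> bool) \<Rightarrow> 'a set \<Rightarrow> 'a \<Rightarrow> 'a \<Rightarrow> 'a \<Rightarrow> 'a \<Rightarrow> bool" where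
  "cut2 V E S a b c d \<longleftrightarrow> S \<subseteq> V \<and> a \<in> S \<and> c \<in> S \<and> b \<notin> S \<and> d \<notin> S \<and>
     (\<forall>u v. E u v \<longrightarrow> u \<in> S \<longrightarrow> v \<notin> S \<longrightarrow> u = a \<and> v = b \<or> u = c \<and> v = d)"

context quartic_rel
begin

lemma adj_commute: "E u v \<longleftrightarrow> E v u"
  using adj_sym by blast

lemma adj_in_verts2: "E u v \<Longrightarrow> v \<in> V"
  using adj_in_verts adj_sym by blast

lemma finite_neighbours: "finite {v. E u v}"
  by (rule finite_subset[OF _ finite_verts]) (use adj_in_verts2 in auto)

lemma neighbours_le_4:
  assumes "\<And>v. v \<in> set vs \<Longrightarrow> E u v" "distinct vs"
  shows "length vs \<le> 4"
proof (cases "vs = []")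
  case False
  then have "u \<in> V" using assms(1) adj_in_verts by (metis list.set_intros(1) neq_Nil_conv)
  moreover have "card (set vs) \<le> card {v. E u v}"
    using assms(1) by (intro card_mono finite_neighbours) auto
  ultimately show ?thesis using degree_4 distinct_card[OF assms(2)] by simp
qed simp

lemma switchable_distinct:
  assumes "switchable E a b c d"
  shows "a \<noteq> b" "a \<noteq> c" "a \<noteq> d" "b \<noteq> c" "b \<noteq> d" "c \<noteq> d" "a \<in> V" "b \<in> V" "c \<in> V" "d \<in> V"
  using assms adj_irrefl adj_in_verts adj_in_verts2 adj_sym unfolding switchable_def by blast+

lemma switch_sum:
  fixes w :: "'a \<Rightarrow> 'a \<Rightarrow> real"
  assumes sw: "switchable E a b c d" and w: "\<And>u v. w u v = w v u"
  shows "(\<Sum>u\<in>V. \<Sum>v\<in>V. if switch E a b c d u v then w u v else 0)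
    = (\<Sum>u\<in>V. \<Sum>v\<in>V. if E u v then w u v else 0) + 2 * (w a c + w b d - w a b - w c d)"
proof -
  note dist = switchable_distinct[OF sw]
  define \<delta> where "\<delta> p q u v = (if u = p then if v = q then w p q else 0 else 0)" for p q u v :: 'a
  have sum\<delta>: "(\<Sum>u\<in>V. \<Sum>v\<in>V. \<delta> p q u v) = w p q" if "p \<in> V" "q \<in> V" for p q
  proof -
    have "(\<Sum>u\<in>V. \<Sum>v\<in>V. \<delta> p q u v) = (\<Sum>u\<in>V. if u = p then w p q else 0)"
      by (rule sum.cong[OF refl]) (use that finite_verts in \<open>simp add: \<delta>_def\<close>)
    then show ?thesis using that finite_verts by simp
  qed
  have E: "E a b" "E b a" "E c d" "E d c" "\<not> E a c" "\<not> E c a" "\<not> E b d" "\<not> E d b"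
    using sw adj_sym unfolding switchable_def by blast+
  have "(if switch E a b c d u v then w u v else 0) = (if E u v then w u v else 0)
      + (\<delta> a c u v + \<delta> c a u v + \<delta> b d u v + \<delta> d b u v - \<delta> a b u v - \<delta> b a u v - \<delta> c d u v - \<delta> d c u v)" for u v
    unfolding \<delta>_def switch_def doubleton_eq_iff using dist E
    by (cases "u = a"; cases "u = b"; cases "u = c"; cases "u = d") auto
  then have "(\<Sum>u\<in>V. \<Sum>v\<in>V. if switch E a b c d u v then w u v else 0)
    = (\<Sum>u\<in>V. \<Sum>v\<in>V. (if E u v then w u v else 0)
      + (\<delta> a c u v + \<delta> c a u v + \<delta> b d u v + \<delta> d b u v - \<delta> a b u v - \<delta> b a u v - \<delta> c d u v - \<delta> d c u v))"
    by simp
  also have "\<dots> = (\<Sum>u\<in>V. \<Sum>v\<in>V. if E u v then w u v else 0)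
    + (w a c + w c a + w b d + w d b - w a b - w b a - w c d - w d c)"
    unfolding sum.distrib sum_subtractf using dist by (simp add: sum\<delta>)
  finally show ?thesis using w[of c a] w[of d b] w[of b a] w[of d c] by simp
qed

lemma switch_neighbours:
  assumes sw: "switchable E a b c d"
  shows "{v. switch E a b c d a v} = insert c ({v. E a v} - {b})"
    "{v. switch E a b c d b v} = insert d ({v. E b v} - {a})"
    "{v. switch E a b c d c v} = insert a ({v. E c v} - {d})"
    "{v. switch E a b c d d v} = insert b ({v. E d v} - {c})"
    "u \<notin> {a, b, c, d} \<Longrightarrow> {v. switch E a b c d u v} = {v. E u v}"
  using switchable_distinct[OF sw] by (auto simp: switch_def doubleton_eq_iff)

text \<open>A closed set of the switched graph contains both or neither of \<open>a\<close>,
  \<open>c\<close>, and likewise of \<open>b\<close>, \<open>d\<close>. As it was not closed before,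
  a removed edge leaves it, so it separates the two pairs; the set or its complement is then the
  cut.\<close>

lemma quartic_rel_switch:
  assumes sw: "switchable E a b c d"
  obtains "quartic_rel V (switch E a b c d)" | S where "cut2 V E S a b c d"
proof -
  let ?F = "switch E a b c d"
  note dist = switchable_distinct[OF sw]
  have E: "E a b" "E b a" "E c d" "E d c" "\<not> E a c" "\<not> E c a" "\<not> E b d" "\<not> E d b"
    using sw adj_sym unfolding switchable_def by blast+
  have Fsym: "?F v u" if "?F u v" for u v
    using that by (simp only: switch_def adj_commute[of u v] insert_commute[of u v "{}"])
  have FV: "u \<in> V" if "?F u v" for u v
    using that dist adj_in_verts unfolding switch_def doubleton_eq_iff by blast
  have deg: "card {v. ?F u v} = 4" if u: "u \<in> V" for u
  proof -
    have *: "card (insert q ({v. E p v} - {r})) = 4" if "p \<in> V" "E p r" "\<not> E p q" for p q r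
      using that finite_neighbours[of p] degree_4[OF that(1)] by (simp add: card_insert_if)
    show ?thesis
    proof (cases "u \<in> {a, b, c, d}")
      case True
      then consider "u = a" | "u = b" | "u = c" | "u = d" by blast
      then show ?thesis
        using switch_neighbours(1-4)[OF sw] *[OF dist(7) E(1,5)] *[OF dist(8) E(2,7)] *[OF dist(9) E(3,6)]
          *[OF dist(10) E(4,8)] by cases simp_all
    next
      case False
      then show ?thesis using switch_neighbours(5)[OF sw] degree_4[OF u] by simp
    qed
  qed
  show thesis
  proof (cases "\<forall>S. S \<subseteq> V \<longrightarrow> S \<noteq> {} \<longrightarrow> (\<forall>u\<in>S. \<forall>v. ?F u v \<longrightarrow> v \<in> S) \<longrightarrow> S = V")
    case True
    have Fne: "u \<noteq> v" if "?F u v" for u v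
      using that dist adj_irrefl unfolding switch_def doubleton_eq_iff by blast
    have "quartic_rel V ?F"
    proof (rule quartic_rel.intro)
      fix S assume "S \<subseteq> V" "S \<noteq> {}" "\<And>u v. u \<in> S \<Longrightarrow> ?F u v \<Longrightarrow> v \<in> S"
      then show "S = V" using True by simp
    qed (fact finite_verts verts_nonempty FV Fne Fsym deg)+
    then show ?thesis by (rule that(1))
  next
    case False
    then obtain S where S: "S \<subseteq> V" "S \<noteq> {}" "S \<noteq> V" and cl: "\<And>u v. u \<in> S \<Longrightarrow> ?F u v \<Longrightarrow> v \<in> S" by blast
    have ac: "a \<in> S \<longleftrightarrow> c \<in> S" and bd: "b \<in> S \<longleftrightarrow> d \<in> S"
      using cl[of a c] cl[of c a] cl[of b d] cl[of d b] by (auto simp: switch_def)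
    have leave: "{u, v} = {a, b} \<or> {u, v} = {c, d}" if "E u v" "u \<in> S" "v \<notin> S" for u v
      using cl[of u v] that by (auto simp: switch_def)
    obtain u v where "u \<in> S" "E u v" "v \<notin> S" using closed_set[OF S(1,2)] S(3) by blast
    then have neq: "a \<in> S \<longleftrightarrow> b \<notin> S" using leave[of u v] ac bd by (auto simp: doubleton_eq_iff)
    show ?thesis
    proof (cases "a \<in> S")
      case True
      then have "cut2 V E S a b c d"
        using S ac bd neq leave unfolding cut2_def by (auto simp: doubleton_eq_iff)
      then show ?thesis by (rule that(2))
    next
      case False
      have "u = a \<and> v = b \<or> u = c \<and> v = d" if "E u v" "u \<in> V - S" "v \<notin> V - S" for u v
        using leave[of v u] that adj_sym[OF that(1)] adj_in_verts2[OF that(1)] False ac bd neq by (auto simp: doubleton_eq_iff)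
      then have "cut2 V E (V - S) a b c d"
        using False ac bd neq dist unfolding cut2_def by blast
      then show ?thesis by (rule that(2))
    qed
  qed
qed

lemma cut2_flip:
  assumes "cut2 V E S a b c d" "E a b" "E c d"
  shows "cut2 V E (V - S) d c b a"
  using assms adj_in_verts adj_in_verts2 adj_sym unfolding cut2_def by blast

section \<open>Parity of edge cuts\<close>

lemma even_internal:
  assumes "S \<subseteq> V"
  shows "even (card {(u, v). u \<in> S \<and> v \<in> S \<and> E u v})"
proof -
  have "finite S" using assms finite_verts finite_subset by blast
  then show ?thesis
  proof (induction S)
    case (insert w S)
    let ?I = "{(u, v). u \<in> S \<and> v \<in> S \<and> E u v}"
    let ?N = "{v \<in> S. E w v}"
    have fin: "finite ?I" "finite ?N"
      using insert.hyps(1) by (auto intro: finite_subset[of _ "S \<times> S"])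
    have "{(u, v). u \<in> insert w S \<and> v \<in> insert w S \<and> E u v} = ?I \<union> (Pair w ` ?N \<union> (\<lambda>v. (v, w)) ` ?N)"
      using adj_irrefl adj_sym by blast
    moreover have "card (?I \<union> (Pair w ` ?N \<union> (\<lambda>v. (v, w)) ` ?N)) = card ?I + (card ?N + card ?N)"
    proof -
      have "card (Pair w ` ?N \<union> (\<lambda>v. (v, w)) ` ?N) = card (Pair w ` ?N) + card ((\<lambda>v. (v, w)) ` ?N)"
        using fin insert.hyps(2) by (intro card_Un_disjoint) auto
      also have "\<dots> = card ?N + card ?N" by (simp add: card_image inj_on_def)
      finally show ?thesis
        using fin insert.hyps(2) by (subst card_Un_disjoint) auto
    qed
    ultimately show ?case using insert.IH by simp
  qed simp
qed

text \<open>The degree sum over \<open>S\<close> is a multiple of 4 and counts every internal edge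
  twice.\<close>

lemma even_boundary:
  assumes "S \<subseteq> V"
  shows "even (card {(u, v). u \<in> S \<and> v \<notin> S \<and> E u v})"
proof -
  have fin: "finite S" using assms finite_verts finite_subset by blast
  let ?I = "{(u, v). u \<in> S \<and> v \<in> S \<and> E u v}" and ?B = "{(u, v). u \<in> S \<and> v \<notin> S \<and> E u v}"
  have fV: "finite (V \<times> V)" using finite_verts by simp
  have finI: "finite ?I" "finite ?B"
    by (rule finite_subset[OF _ fV]; use assms adj_in_verts2 in auto)+
  have "card (SIGMA u:S. {v. E u v}) = (\<Sum>u\<in>S. card {v. E u v})"
    using fin finite_neighbours by (intro card_SigmaI) auto
  also have "\<dots> = 4 * card S" using assms degree_4 by (simp add: subset_iff)
  finally have "card (SIGMA u:S. {v. E u v}) = 4 * card S" .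
  moreover have "(SIGMA u:S. {v. E u v}) = ?I \<union> ?B" by auto
  moreover have "card (?I \<union> ?B) = card ?I + card ?B" using finI by (intro card_Un_disjoint) auto
  ultimately have "card ?I + card ?B = 4 * card S" by simp
  then have "even (card ?I + card ?B)" by simp
  then show ?thesis using even_internal[OF assms] by simp
qed

lemma odd_boundary_False:
  assumes "S \<subseteq> V" "{(u, v). u \<in> S \<and> v \<notin> S \<and> E u v} = B" "odd (card B)"
  shows False
  using even_boundary[OF assms(1)] assms(2,3) by simp

text \<open>Each of \<open>w1\<close> and \<open>w2\<close> lies in only one of the two sides, so
  the intersection of the sides is left by the edge \<open>uw\<close> alone, against parity. In
  other words, for given \<open>u\<close>, \<open>w\<close> and \<open>v\<close> at most one partner
  can block the exchange.\<close>

lemma cut2_unique: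
  assumes c1: "cut2 V E S u w w1 v" and c2: "cut2 V E S' u w w2 v"
    and E: "E u w" "E w1 v" "E w2 v" and ne: "w1 \<noteq> w2" "w \<noteq> v"
  shows False
proof -
  have "w1 \<notin> S'" "w2 \<notin> S" using c1 c2 E ne unfolding cut2_def by blast+
  then have "{(p, q). p \<in> S \<inter> S' \<and> q \<notin> S \<inter> S' \<and> E p q} = {(u, w)}"
    using c1 c2 E unfolding cut2_def by blast
  moreover have "S \<inter> S' \<subseteq> V" using c1 unfolding cut2_def by blast
  ultimately show False using odd_boundary_False[of "S \<inter> S'" "{(u, w)}"] by simp
qed

section \<open>Private neighbours of two vertices\<close>

text \<open>On both sides the same number is subtracted from the degree 4: the common neighbours and
  a possible edge \<open>uv\<close>.\<close>

lemma card_private: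
  assumes "u \<in> V" "v \<in> V"
  shows "card {z. E u z \<and> \<not> E v z \<and> z \<noteq> v} = card {z. E v z \<and> \<not> E u z \<and> z \<noteq> u}"
proof -
  let ?C = "{z. E u z \<and> E v z}"
  have *: "card {z. E p z \<and> \<not> E q z \<and> z \<noteq> q} = 4 - card {z. E p z \<and> E q z} - (if E p q then 1 else 0)"
    if "p \<in> V" for p q
  proof -
    have "{z. E p z \<and> \<not> E q z \<and> z \<noteq> q} = {z. E p z} - {z. E p z \<and> E q z} - {q}" by auto
    moreover have "card ({z. E p z} - {z. E p z \<and> E q z}) = 4 - card {z. E p z \<and> E q z}"
      using degree_4[OF that] finite_neighbours
      by (subst card_Diff_subset) (auto intro: finite_subset[OF _ finite_neighbours])
    ultimately show ?thesis using adj_irrefl[of q q] finite_neighbours[of p] by (auto simp: card_Diff_singleton_if)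
  qed
  have "{z. E u z \<and> E v z} = {z. E v z \<and> E u z}" by auto
  then show ?thesis using *[OF assms(1), of v] *[OF assms(2), of u] adj_commute[of u v] by simp
qed

lemma private_exists:
  assumes "u \<in> V" "v \<in> V" "E u w" "\<not> E v w" "w \<noteq> v"
  obtains w' where "E v w'" "\<not> E u w'" "w' \<noteq> u"
proof -
  have "finite {z. E u z \<and> \<not> E v z \<and> z \<noteq> v}" by (rule finite_subset[OF _ finite_neighbours[of u]]) auto
  then have "card {z. E u z \<and> \<not> E v z \<and> z \<noteq> v} \<noteq> 0" using assms by (auto simp: card_eq_0_iff)
  then have "{z. E v z \<and> \<not> E u z \<and> z \<noteq> u} \<noteq> {}" using card_private[OF assms(1,2)] by force
  then show thesis using that by blast
qed

text \<open>Two private neighbours on one side give two on the other, so one of them avoids a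
  prescribed \<open>w'\<close>.\<close>

lemma private_exists2:
  assumes "u \<in> V" "v \<in> V" "E u w" "\<not> E v w" "w \<noteq> v" "E u z" "\<not> E v z" "z \<noteq> v" "z \<noteq> w"
  obtains z' where "E v z'" "\<not> E u z'" "z' \<noteq> u" "z' \<noteq> w'"
proof -
  have "finite {z. E u z \<and> \<not> E v z \<and> z \<noteq> v}" by (rule finite_subset[OF _ finite_neighbours[of u]]) auto
  then have "card {w, z} \<le> card {z. E u z \<and> \<not> E v z \<and> z \<noteq> v}" using assms by (intro card_mono) auto
  then have *: "2 \<le> card {z. E v z \<and> \<not> E u z \<and> z \<noteq> u}" using card_private[OF assms(1,2)] assms(9) by simp
  have "\<not> {z. E v z \<and> \<not> E u z \<and> z \<noteq> u} \<subseteq> {w'}"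
  proof
    assume "{z. E v z \<and> \<not> E u z \<and> z \<noteq> u} \<subseteq> {w'}"
    from card_mono[OF _ this] * show False by simp
  qed
  then show thesis using that by blast
qed

end

section \<open>Graphs sharing an optimal eigenvector\<close>

text \<open>The bound \<open>e\<close> will be the energy of \<open>x\<close> on the given
  minimiser. The assumption speaks of all relations \<open>E\<close>, so it remains available for
  every graph obtained by switches that do not increase the energy.\<close>

locale optimal =
  fixes V :: "'a set" and x :: "'a \<Rightarrow> real" and \<mu> :: real and e :: real
  assumes mu_pos: "0 < \<mu>" and nonconst: "\<exists>u\<in>V. \<exists>v\<in>V. x u \<noteq> x v"
    and eigenvector: "quartic_rel V E \<Longrightarrow> energy V E x \<le> e \<Longrightarrow> u \<in> V \<Longrightarrow> laplacian V E x u = \<mu> * x u"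
begin

definition opt :: "('a \<Rightarrow> 'a \<Rightarrow> bool) \<Rightarrow> bool" where
  "opt E \<longleftrightarrow> quartic_rel V E \<and> energy V E x \<le> e"

lemma opt_quartic: "opt E \<Longrightarrow> quartic_rel V E"
  by (simp add: opt_def)

lemma opt_neighbour_sum:
  assumes "opt E" "u \<in> V"
  shows "(\<Sum>v\<in>{v. E u v}. x v) = (4 - \<mu>) * x u"
proof -
  interpret quartic_rel V E using assms(1) by (rule opt_quartic)
  have "(\<Sum>v\<in>V. if E u v then x u - x v else 0) = \<mu> * x u"
    using eigenvector[OF _ _ assms(2)] assms(1) unfolding opt_def laplacian_def by blast
  moreover have "(\<Sum>v\<in>V. if E u v then x u - x v else 0) = (\<Sum>v\<in>{v. E u v}. x u - x v)"
    by (rule sum.mono_neutral_cong_right) (use finite_verts adj_in_verts2 in auto)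
  ultimately show ?thesis using degree_4[OF assms(2)] by (simp add: sum_subtractf algebra_simps)
qed

text \<open>A switch that does not increase the energy leads to a graph with the same eigenvector, and
  comparing the eigenvector equations at two of the four vertices shows that it was neutral.\<close>

lemma switch_tied:
  assumes opt: "opt E" and sw: "switchable E a b c d" and F: "quartic_rel V (switch E a b c d)"
    and gain: "0 \<le> (x a - x d) * (x c - x b)"
  shows "opt (switch E a b c d)" "x a = x d" "x b = x c"
proof -
  interpret quartic_rel V E using opt by (rule opt_quartic)
  note dist = switchable_distinct[OF sw]
  have "energy V (switch E a b c d) x = energy V E x + 2 * ((x a - x c)\<^sup>2 + (x b - x d)\<^sup>2 - (x a - x b)\<^sup>2 - (x c - x d)\<^sup>2)"
    unfolding energy_def by (rule switch_sum[OF sw]) (rule power2_commute)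
  also have "(x a - x c)\<^sup>2 + (x b - x d)\<^sup>2 - (x a - x b)\<^sup>2 - (x c - x d)\<^sup>2 = - 2 * ((x a - x d) * (x c - x b))"
    by (simp add: power2_eq_square algebra_simps)
  finally have "energy V (switch E a b c d) x \<le> energy V E x" using gain by simp
  then show F': "opt (switch E a b c d)" using F opt by (simp add: opt_def)
  have E: "E a b" "E b a" "\<not> E a c" "\<not> E b d" using sw adj_sym unfolding switchable_def by blast+
  have *: "(\<Sum>v\<in>insert q ({v. E p v} - {r}). x v) = (\<Sum>v\<in>{v. E p v}. x v) - x r + x q" if "E p r" "\<not> E p q" for p q r
    using that finite_neighbours[of p] by (simp add: sum_diff1)
  have "(\<Sum>v\<in>{v. E a v}. x v) = (\<Sum>v\<in>{v. E a v}. x v) - x b + x c"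
    using opt_neighbour_sum[OF F' dist(7)] opt_neighbour_sum[OF opt dist(7)] *[OF E(1,3)]
    by (simp add: switch_neighbours(1)[OF sw])
  then show "x b = x c" by simp
  have "(\<Sum>v\<in>{v. E b v}. x v) = (\<Sum>v\<in>{v. E b v}. x v) - x a + x d"
    using opt_neighbour_sum[OF F' dist(8)] opt_neighbour_sum[OF opt dist(8)] *[OF E(2,4)]
    by (simp add: switch_neighbours(2)[OF sw])
  then show "x a = x d" by simp
qed

text \<open>For tied \<open>u\<close> and \<open>v\<close>, exchanging \<open>w\<close> and
  \<open>w'\<close> between them leaves the energy unchanged.\<close>

lemma tied_private_or_cut:
  assumes opt: "opt E" and tie: "x u = x v"
    and w: "E u w" "\<not> E v w" "w \<noteq> v" and w': "E v w'" "\<not> E u w'" "w' \<noteq> u"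
  shows "x w = x w' \<or> (\<exists>S. cut2 V E S u w w' v)"
proof -
  interpret quartic_rel V E using opt by (rule opt_quartic)
  have sw: "switchable E u w w' v" using w w' adj_commute unfolding switchable_def by blast
  show ?thesis
  proof (rule quartic_rel_switch[OF sw])
    assume "quartic_rel V (switch E u w w' v)"
    from switch_tied(3)[OF opt sw this] tie show ?thesis by simp
  qed blast
qed

text \<open>A cut that blocks the exchange forces \<open>u\<close> and \<open>v\<close> to be
  nonadjacent and without common neighbours, so that every neighbour of one can be tested against
  every neighbour of the other. By \<open>cut2_unique\<close> each neighbour has at most one blocked
  partner, and the remaining exchanges connect the values of \<open>w\<close> and
  \<open>w'\<close>.\<close>

lemma tied_private:
  assumes opt: "opt E" and tie: "x u = x v"
    and w: "E u w" "\<not> E v w" "w \<noteq> v" and w': "E v w'" "\<not> E u w'" "w' \<noteq> u"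
  shows "x w = x w'"
proof (rule ccontr)
  assume ne: "x w \<noteq> x w'"
  interpret quartic_rel V E using opt by (rule opt_quartic)
  note alt = tied_private_or_cut[OF opt tie]
  from alt[OF w w'] ne obtain S where S: "cut2 V E S u w w' v" by blast
  have uV: "u \<in> V" "v \<in> V" using w w' adj_in_verts by auto
  have nc: "\<not> (E u z \<and> E v z)" for z
    using S w w' adj_sym unfolding cut2_def by blast
  have nuv: "\<not> E u v" using S w w' unfolding cut2_def by blast
  have ex: "\<exists>z1 z2. E p z1 \<and> E p z2 \<and> z1 \<noteq> z2 \<and> z1 \<noteq> q \<and> z2 \<noteq> q" if "p \<in> V" for p q
  proof -
    have "card ({z. E p z} - {q}) \<ge> 3" using degree_4[OF that] finite_neighbours[of p] by (simp add: card_Diff_singleton_if)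
    then have "2 \<le> card ({z. E p z} - {q})" by simp
    then obtain Z where "Z \<subseteq> {z. E p z} - {q}" "card Z = 2" by (metis obtain_subset_with_card_n)
    then show ?thesis by (auto simp: card_2_iff)
  qed
  obtain p where p: "E u p" "p \<noteq> w" using ex[OF uV(1)] by blast
  obtain q1 q2 where q: "E v q1" "E v q2" "q1 \<noteq> q2" "q1 \<noteq> w'" "q2 \<noteq> w'" using ex[OF uV(2)] by blast
  have p': "\<not> E v p" "p \<noteq> v" and q': "\<not> E u q1" "q1 \<noteq> u" "\<not> E u q2" "q2 \<noteq> u"
    using p q nc nuv adj_sym by blast+
  have uniq: "\<not> cut2 V E S2 u r s2 v" if "cut2 V E S1 u r s1 v" "E u r" "r \<noteq> v" "E v s1" "E v s2" "s1 \<noteq> s2" for S1 S2 r s1 s2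
    using cut2_unique[OF that(1) _ that(2)] that adj_sym by blast
  have "x w = x q1" using alt[OF w q(1) q'(1,2)] uniq[OF S w(1,3) w'(1) q(1)] q(4) by blast
  moreover have "x w = x q2" using alt[OF w q(2) q'(3,4)] uniq[OF S w(1,3) w'(1) q(2)] q(5) by blast
  moreover have "x p = x w'"
  proof -
    have "\<not> cut2 V E S2 u p w' v" for S2
    proof
      assume S2: "cut2 V E S2 u p w' v"
      have "cut2 V E (V - S) v w' w u" "cut2 V E (V - S2) v w' p u"
        using cut2_flip[OF S w(1)] cut2_flip[OF S2 p(1)] w' adj_sym by blast+
      from cut2_unique[OF this w'(1)] w p w' adj_sym show False by blast
    qed
    then show ?thesis using alt[OF p(1) p' w'] by blast
  qed
  moreover have "x p = x q1 \<or> x p = x q2"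
    using alt[OF p(1) p' q(1) q'(1,2)] alt[OF p(1) p' q(2) q'(3,4)] uniq[OF _ p(1) p'(2) q(1,2)] q(3) by blast
  ultimately show False using ne by auto
qed

text \<open>Every private neighbour of \<open>u\<close> has the same value as every private
  neighbour of \<open>v\<close>, so all of them lie on the level of \<open>w\<close>.\<close>

lemma tied_outside:
  assumes opt: "opt E" and tie: "x u = x v" and uv: "u \<in> V" "v \<in> V"
    and w: "E u w" "\<not> E v w" "w \<noteq> v" and z: "x z \<noteq> x w" "z \<noteq> u" "z \<noteq> v"
  shows "E u z \<longleftrightarrow> E v z"
proof -
  interpret quartic_rel V E using opt by (rule opt_quartic)
  obtain w' where w': "E v w'" "\<not> E u w'" "w' \<noteq> u" using private_exists[OF uv w] .
  show ?thesis
    using tied_private[OF opt tie w w'] tied_private[OF opt tie _ _ z(3) w'] tied_private[OF opt tie w _ _ z(2)] z(1)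
    by metis
qed

text \<open>A neutral switch all of whose vertices share the neighbours outside their level would make
  that level a union of components.\<close>

lemma neutral_switch_same_level:
  assumes opt: "opt E" and opt': "opt (switch E a b c d)" and sw: "switchable E a b c d"
    and tie: "x a = x d" "x b = x c" "x a = x b"
    and b': "E a b'" "\<not> E d b'" "b' \<noteq> d" "b' \<noteq> b"
  shows False
proof -
  interpret quartic_rel V E using opt by (rule opt_quartic)
  note dist = switchable_distinct[OF sw]
  have E: "E a b" "E b a" "E c d" "E d c" "\<not> E a c" "\<not> E c a" "\<not> E b d" "\<not> E d b"
    using sw adj_sym unfolding switchable_def by blast+
  have xb': "x b' = x a"
    using tied_private[OF opt tie(1) b'(1-3) E(4,5) dist(2)[symmetric]] tie by simp
  \<comment> \<open>Otherwise \<open>w\<close> is private to \<open>a\<close>, so \<open>a\<close>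
    and \<open>b\<close> agree on \<open>c\<close>, which is not on the level of \<open>w\<close>.
    This applies before and after the switch, but the switch changes the adjacency of
    \<open>c\<close> to \<open>a\<close> and not to \<open>b\<close>.\<close>
  have step: "E b w" if opt: "opt E" and opt': "opt (switch E a b c d)" and sw: "switchable E a b c d" 
    and tie: "x a = x d" "x b = x c" "x a = x b" and w: "E a w" "x w \<noteq> x a" for a b c d w
  proof (rule ccontr)
    assume nb: "\<not> E b w"
    note dist = switchable_distinct[OF sw]
    have E: "E a b" "\<not> E a c" "\<not> E b d" using sw adj_sym unfolding switchable_def by blast+
    have wne: "w \<notin> {a, b, c, d}" using w tie by auto
    have "\<not> E b c" using tied_outside[OF opt tie(3) dist(7,8) w(1) nb, of c] wne w tie dist E by auto
    moreover have "switch E a b c d a w" "\<not> switch E a b c d b w" "switch E a b c d a c"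
      using w nb wne dist by (auto simp: switch_def doubleton_eq_iff)
    moreover have "switch E a b c d b c \<longleftrightarrow> E b c" using dist by (auto simp: switch_def doubleton_eq_iff)
    ultimately show False
      using tied_outside[OF opt' tie(3) dist(7,8), of w c] wne w tie dist by auto
  qed
  have sw2: "switchable E b a d c" and swsym: "switch E b a d c = switch E a b c d"
    and sw3: "switchable E d c b a" and sw3sym: "switch E d c b a = switch E a b c d"
  proof -
    show "switchable E b a d c" "switchable E d c b a" using E dist by (simp_all add: switchable_def)
    have *: "{b, a} = {a, b}" "{d, c} = {c, d}" "{d, b} = {b, d}" "{c, a} = {a, c}" by blast+
    show "switch E b a d c = switch E a b c d" "switch E d c b a = switch E a b c d"
      unfolding switch_def * by blast+
  qed
  have ad: "E a z \<longleftrightarrow> E d z" if "x z \<noteq> x a" for z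
  proof -
    have "z \<noteq> a" "z \<noteq> d" using that tie by auto
    then show ?thesis using tied_outside[OF opt tie(1) dist(7,10) E(1) E(8) dist(5), of z] that tie by simp
  qed
  \<comment> \<open>A neighbour \<open>z\<close> off the level would be adjacent to all of
    \<open>a\<close>, \<open>b\<close>, \<open>c\<close>, \<open>d\<close> and \<open>b'\<close>,
    one more than its degree allows.\<close>
  have inner: "x z = x a" if "E a z" for z
  proof (rule ccontr)
    assume z: "x z \<noteq> x a"
    have "E b z" using step[OF opt opt' sw tie that z] .
    have "E d z" using ad[OF z] that by simp
    have "E c z" by (rule step[OF opt _ sw3 _ _ _ \<open>E d z\<close>]) (use sw3sym opt' tie z in simp_all)
    have sw': "switchable E a b' c d" using E b' dist adj_sym unfolding switchable_def by blast
    have "E b' z"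
    proof (rule quartic_rel_switch[OF sw'])
      assume F: "quartic_rel V (switch E a b' c d)"
      have F': "opt (switch E a b' c d)" by (rule switch_tied(1)[OF opt sw' F]) (use tie in simp)
      show ?thesis by (rule step[OF opt F' sw' tie(1) _ _ that z]) (use tie xb' in simp_all)
    next
      fix S assume S: "cut2 V E S a b' c d"
      have lv: "u = a \<and> v = b' \<or> u = c \<and> v = d" if "E u v" "u \<in> S" "v \<notin> S" for u v
        using S that unfolding cut2_def by blast
      have S': "a \<in> S" "d \<notin> S" using S by (simp_all add: cut2_def)
      have zne: "z \<noteq> b'" "z \<noteq> c" "z \<noteq> a" using z xb' tie by auto
      have "z \<in> S" using lv[OF that S'(1)] zne dist(2) by auto
      then show ?thesis using lv[OF adj_sym[OF \<open>E d z\<close>] _ S'(2)] zne by auto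
    qed
    note b'z = this
    have "length [a, b, c, d, b'] \<le> 4"
      using adj_sym[OF that] adj_sym[OF \<open>E b z\<close>] adj_sym[OF \<open>E d z\<close>] adj_sym[OF \<open>E c z\<close>]
        adj_sym[OF b'z] dist b' E(5) adj_irrefl[OF b'(1)]
      by (intro neighbours_le_4[of _ z]) auto
    then show False by simp
  qed
  \<comment> \<open>\<open>?Z\<close> contains \<open>a\<close> but not all vertices, so an edge
    leads from it to a vertex \<open>u\<close> of the level with a neighbour \<open>w\<close> off
    the level. The eigenvector equation inside \<open>?Z\<close> makes the value of the level 0;
    then the neighbours of \<open>u\<close> have only the values 0 and \<open>x w\<close>, and their
    sum cannot vanish as it should.\<close>
  let ?Z = "{v\<in>V. x v = x a \<and> (\<forall>z. E v z \<longrightarrow> x z = x a)}"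
  obtain p q where pq: "p \<in> V" "q \<in> V" "x p \<noteq> x q" using nonconst by blast
  have "?Z \<noteq> V"
  proof
    assume "?Z = V"
    then have "p \<in> ?Z" "q \<in> ?Z" using pq by simp_all
    then show False using pq(3) by simp
  qed
  moreover have "a \<in> ?Z" using dist(7) inner by simp
  ultimately obtain v u where v: "v \<in> ?Z" and u: "E v u" "u \<notin> ?Z"
    using closed_set[of ?Z] by (metis (no_types, lifting) empty_iff mem_Collect_eq subsetI)
  have vV: "v \<in> V" and vx: "x v = x a" and vn: "\<And>z. E v z \<Longrightarrow> x z = x a" using v by auto
  have uV: "u \<in> V" and ux: "x u = x a" using u(1) vn adj_in_verts2 by auto
  obtain w where w: "E u w" "x w \<noteq> x a" using u(2) uV ux by blast
  have "(\<Sum>z\<in>{z. E v z}. x z) = (\<Sum>z\<in>{z. E v z}. x a)" by (rule sum.cong) (use vn in auto)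
  then have "4 * x a = (4 - \<mu>) * x a" using opt_neighbour_sum[OF opt vV] degree_4[OF vV] vx by simp
  then have xa: "x a = 0" using mu_pos by simp
  then have sum0: "(\<Sum>z\<in>{z. E u z}. x z) = 0" using opt_neighbour_sum[OF opt uV] ux by simp
  have nv: "\<not> E v w" "w \<noteq> v" using vn vx w(2) by auto
  have all: "x z = x a \<or> x z = x w" if "E u z" for z
  proof (rule ccontr)
    assume z: "\<not> (x z = x a \<or> x z = x w)"
    then have "z \<noteq> u" "z \<noteq> v" using ux vx by auto
    then have "E v z" using tied_outside[OF opt _ uV vV w(1) nv, of z] that z ux vx by simp
    then show False using vn z by blast
  qed
  have "(\<Sum>z\<in>{z. E u z}. x z / x w) \<ge> x w / x w"
    by (rule member_le_sum[OF _ _ finite_neighbours]) (use w all xa in force)+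
  then show False using sum0 w(2) xa by (simp add: sum_divide_distrib[symmetric])
qed

text \<open>If \<open>b\<close>, which is on another level, is adjacent to exactly one of two
  vertices on the level of \<open>a\<close>, then these two agree on that level. Applied to pairs
  from \<open>a\<close>, \<open>d\<close>, \<open>a'\<close>, \<open>d'\<close>, this spreads the
  edge \<open>ad\<close> until \<open>a\<close> has five neighbours.\<close>

lemma neutral_switch_adjacent:
  assumes opt: "opt E" and sw: "switchable E a b c d"
    and tie: "x a = x d" "x b = x c" "x a \<noteq> x b" and ad: "E a d"
    and b': "E a b'" "b' \<noteq> b" "x b' = x b" and a': "E b a'" "\<not> E c a'" "a' \<noteq> a" "x a' = x a"
    and d': "E c d'" "\<not> E b d'" "d' \<noteq> d" "x d' = x a"
  shows False
proof -
  interpret quartic_rel V E using opt by (rule opt_quartic)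
  note dist = switchable_distinct[OF sw]
  have E: "E b a" "E d c" "\<not> E c a" "\<not> E b d" "\<not> E d b" using sw adj_sym unfolding switchable_def by blast+
  have V: "a' \<in> V" "d' \<in> V" using a' d' adj_in_verts2 by auto
  have out: "E p z \<longleftrightarrow> E q z" if "E b p" "\<not> E b q" "x p = x a" "x q = x a" "q \<in> V" "x z = x a" "z \<noteq> p" "z \<noteq> q" for p q z
    by (rule tied_outside[OF opt _ _ _ adj_sym[OF that(1)]])
      (use that tie adj_sym adj_in_verts2 in auto)
  have "a' \<noteq> d'" using a' d' by auto
  have "a' \<noteq> d" "d' \<noteq> a" using a' d' E by auto
  have "E a' a" using out[OF a'(1) E(4) a'(4) tie(1)[symmetric] dist(10) refl a'(3)[symmetric] dist(3)] adj_sym[OF ad] by blast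
  have "E d' d" using out[OF E(1) d'(2) refl d'(4) V(2) tie(1)[symmetric] dist(3)[symmetric] d'(3)[symmetric]] ad by blast
  have "E a d'" using out[OF E(1) E(4) refl tie(1)[symmetric] dist(10) d'(4) \<open>d' \<noteq> a\<close> d'(3)] adj_sym[OF \<open>E d' d\<close>] by blast
  have "length [d, a', d', b, b'] \<le> 4"
    by (rule neighbours_le_4[of _ a])
      (use ad adj_sym[OF \<open>E a' a\<close>] \<open>E a d'\<close> adj_sym[OF E(1)] b' a' d' tie \<open>a' \<noteq> d'\<close> \<open>a' \<noteq> d\<close> dist in auto)
  then show False by simp
qed

text \<open>If neither pair agrees, there are further private neighbours \<open>b'\<close>,
  \<open>c'\<close>, \<open>a'\<close>, \<open>d'\<close>. When the two levels differ,
  \<open>ad\<close> and \<open>bc\<close> cannot be edges, and replacing \<open>ab\<close>,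
  \<open>dc\<close> by \<open>ad\<close>, \<open>bc\<close> would lower the energy strictly, so a
  cut blocks it. With \<open>b'\<close> in place of \<open>b\<close> a second cut is impossible by
  parity; hence \<open>b'c\<close> is an edge, and agreement within the level turns it into the
  forbidden edge \<open>bc\<close>.\<close>

lemma neutral_switch_twins:
  assumes opt: "opt E" and opt': "opt (switch E a b c d)" and sw: "switchable E a b c d"
    and tie: "x a = x d" "x b = x c"
  shows "(\<forall>z. z \<notin> {a, b, c, d} \<longrightarrow> E a z = E d z) \<or> (\<forall>z. z \<notin> {a, b, c, d} \<longrightarrow> E b z = E c z)"
proof (rule ccontr)
  interpret quartic_rel V E using opt by (rule opt_quartic)
  note dist = switchable_distinct[OF sw]
  have E: "E a b" "E b a" "E c d" "E d c" "\<not> E a c" "\<not> E c a" "\<not> E b d" "\<not> E d b"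
    using sw adj_sym unfolding switchable_def by blast+
  assume *: "\<not> ?thesis"
  obtain b' where b': "E a b'" "\<not> E d b'" "b' \<noteq> d" "b' \<noteq> b"
  proof -
    obtain z where z: "z \<notin> {a, b, c, d}" "E a z \<noteq> E d z" using * by blast
    show thesis
    proof (cases "E a z")
      case True then show thesis using z by (intro that[of z]) auto
    next
      case False
      then show thesis
        using private_exists2[OF dist(10,7) E(4,5) dist(2)[symmetric], of z b] z that by auto
    qed
  qed
  obtain c' where c': "E d c'" "\<not> E a c'" "c' \<noteq> a" "c' \<noteq> c"
    using private_exists2[OF dist(7,10) E(1,8) dist(5) b'] .
  obtain a' where a': "E b a'" "\<not> E c a'" "a' \<noteq> c" "a' \<noteq> a"
  proof -
    obtain z where z: "z \<notin> {a, b, c, d}" "E b z \<noteq> E c z" using * by blast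
    show thesis
    proof (cases "E b z")
      case True then show thesis using z by (intro that[of z]) auto
    next
      case False
      then show thesis
        using private_exists2[OF dist(9,8) E(3,7) dist(5)[symmetric], of z a] z that by auto
    qed
  qed
  obtain d' where d': "E c d'" "\<not> E b d'" "d' \<noteq> b" "d' \<noteq> d"
    using private_exists2[OF dist(8,9) E(2,6) dist(2) a'] .
  have xb': "x b' = x b" and xc': "x c' = x b"
    using tied_private[OF opt tie(1) b'(1-3) E(4,5) dist(2)[symmetric]]
      tied_private[OF opt tie(1) E(1,8) dist(5) c'(1-3)] tie by auto
  have xa': "x a' = x a" and xd': "x d' = x a"
    using tied_private[OF opt tie(2) a'(1-3) E(3,7) dist(5)[symmetric]]
      tied_private[OF opt tie(2) E(2,6) dist(2) d'(1-3)] tie by auto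
  show False
  proof (cases "x a = x b")
    case True
    then show False using neutral_switch_same_level[OF opt opt' sw tie _ b'] by blast
  next
    case False
    have nad: "\<not> E a d"
      using neutral_switch_adjacent[OF opt sw tie False _ b'(1,4) xb' a'(1,2,4) xa' d'(1,2,4) xd'] by blast
    have sw2: "switchable E b a d c" using E dist by (auto simp: switchable_def)
    have nbc: "\<not> E b c"
      using neutral_switch_adjacent[OF opt sw2 tie(2,1) _ _ a'(1,4) xa' b'(1,2,4) xb' c'(1,2,4) xc'] False by auto
    have cross: "E p c \<or> (\<exists>S. cut2 V E S a p d c)" if p: "E a p" "x p = x b" "\<not> E d p" for p
    proof (rule ccontr)
      assume **: "\<not> ?thesis"
      have "p \<noteq> c" using p E by auto
      then have swx: "switchable E a p d c" using p ** E nad dist unfolding switchable_def by blast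
      show False
      proof (rule quartic_rel_switch[OF swx])
        assume "quartic_rel V (switch E a p d c)"
        from switch_tied(2)[OF opt swx this] tie p False
        show False by (simp add: mult_le_0_iff flip: power2_eq_square)
      qed (use ** in blast)
    qed
    have "\<exists>S. cut2 V E S a b d c" using cross[of b] E nbc by blast
    then obtain S where S: "cut2 V E S a b d c" by blast
    have "\<not> cut2 V E S' a b' d c" for S'
    proof
      assume S': "cut2 V E S' a b' d c"
      have bb: "b \<in> S'" "b' \<in> S" using S S' b' E unfolding cut2_def by blast+
      have "{(p, q). p \<in> S \<inter> S' \<and> q \<notin> S \<inter> S' \<and> E p q} = {(a, b), (a, b'), (d, c)}"
        using S S' E b' unfolding cut2_def by blast
      moreover have "card {(a, b), (a, b'), (d, c)} = 3" using dist b' by auto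
      moreover have "S \<inter> S' \<subseteq> V" using S unfolding cut2_def by blast
      ultimately show False using odd_boundary_False[of "S \<inter> S'" "{(a, b), (a, b'), (d, c)}"] by simp
    qed
    then have "E b' c" using cross[OF b'(1) xb' b'(2)] by blast
    have V: "b' \<in> V" "c' \<in> V" using b' c' adj_in_verts2 by auto
    have out: "E p z \<longleftrightarrow> E q z" if "E a p" "\<not> E a q" "x p = x b" "x q = x b" "q \<in> V" "x z = x b" "z \<noteq> p" "z \<noteq> q" for p q z
      by (rule tied_outside[OF opt _ _ _ adj_sym[OF that(1)]])
        (use that tie False adj_sym adj_in_verts2 in auto)
    have ne: "b' \<noteq> c'" "b' \<noteq> c" "c' \<noteq> b" "c \<noteq> c'" using b' c' E by auto
    have "E c' c" using out[OF b'(1) c'(2) xb' xc' V(2) tie(2)[symmetric] ne(2)[symmetric] ne(4)] \<open>E b' c\<close> by blast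
    then have "E b c" using out[OF E(1) c'(2) refl xc' V(2) tie(2)[symmetric] dist(4)[symmetric] ne(4)] \<open>E c' c\<close> by blast
    then show False using nbc by blast
  qed
qed

end

section \<open>Numbering the vertices along the eigenvector\<close>

lemma cut2_leave: "cut2 V E S a b c d \<Longrightarrow> E u v \<Longrightarrow> u \<in> S \<Longrightarrow> v \<notin> S \<Longrightarrow> u = a \<and> v = b \<or> u = c \<and> v = d"
  unfolding cut2_def by blast

text \<open>All that later sections retain of the eigenvector is the order. Two nested edges admit
  two different switches, and cuts cannot block both, so no cut appears in the first two conditions;
  crossing edges admit only one such switch.\<close>

locale ordered_quartic = quartic_rel "{..<n}" F for n :: nat and F +
  assumes nested1: "p < q \<Longrightarrow> q < r \<Longrightarrow> r < s \<Longrightarrow> F p s \<Longrightarrow> F q r \<Longrightarrow> F p r \<or> F q s"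
    and nested2: "p < q \<Longrightarrow> q < r \<Longrightarrow> r < s \<Longrightarrow> F p s \<Longrightarrow> F q r \<Longrightarrow> F p q \<or> F r s"
    and crossing: "p < q \<Longrightarrow> q < r \<Longrightarrow> r < s \<Longrightarrow> F p r \<Longrightarrow> F q s \<Longrightarrow>
      F p q \<or> F r s \<or> (\<exists>S. cut2 {..<n} F S p r q s)"

section \<open>Breaking ties by correlation\<close>

context optimal
begin

text \<open>A sum over edges like the energy, so \<open>switch_sum\<close> covers both. As the
  numbers are distinct, it detects the direction of a switch even where values of \<open>x\<close>
  coincide.\<close>

definition correlation :: "('a \<Rightarrow> 'a \<Rightarrow> bool) \<Rightarrow> ('a \<Rightarrow> nat) \<Rightarrow> nat" where
  "correlation E \<sigma> = (\<Sum>u\<in>V. \<Sum>v\<in>V. if E u v then \<sigma> u * \<sigma> v else 0)"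

definition numbering :: "('a \<Rightarrow> nat) \<Rightarrow> bool" where
  "numbering \<sigma> \<longleftrightarrow> bij_betw \<sigma> V {..<card V} \<and> (\<forall>u\<in>V. \<forall>v\<in>V. x v < x u \<longrightarrow> \<sigma> u < \<sigma> v)"

lemma numbering_exists:
  assumes "finite V"
  shows "\<exists>\<sigma>. numbering \<sigma>"
proof -
  obtain us where us: "distinct us" "set us = V" using finite_distinct_list[OF assms] by blast
  define vs where "vs = sort_key (\<lambda>u. - x u) us"
  have vs: "distinct vs" "set vs = V" "length vs = card V" "sorted (map (\<lambda>u. - x u) vs)"
    using us distinct_card[OF us(1)] by (auto simp: vs_def)
  define \<sigma> where "\<sigma> = the_inv_into {..<length vs} ((!) vs)"
  have bij: "bij_betw ((!) vs) {..<length vs} V" using bij_betw_nth[OF vs(1) refl refl] vs(2) by simp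
  then have inv: "bij_betw \<sigma> V {..<length vs}" unfolding \<sigma>_def by (rule bij_betw_the_inv_into)
  have nth: "vs ! \<sigma> u = u" "\<sigma> u < length vs" if "u \<in> V" for u
    using that bij inv unfolding \<sigma>_def
    by (auto simp: bij_betw_def f_the_inv_into_f)
  have "\<sigma> u < \<sigma> v" if "u \<in> V" "v \<in> V" "x v < x u" for u v
  proof (rule ccontr)
    assume "\<not> \<sigma> u < \<sigma> v"
    then have "- x (vs ! \<sigma> v) \<le> - x (vs ! \<sigma> u)"
      using sorted_nth_mono[OF vs(4), of "\<sigma> v" "\<sigma> u"] nth that by simp
    then show False using that nth by simp
  qed
  then show ?thesis using inv vs(3) unfolding numbering_def by auto
qed

lemma best_numbering:
  assumes "finite V"
  obtains \<sigma> where "numbering \<sigma>" "\<And>\<tau>. numbering \<tau> \<Longrightarrow> correlation E \<tau> \<le> correlation E \<sigma>"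
proof -
  obtain \<sigma>0 where "numbering \<sigma>0" using numbering_exists[OF assms] by blast
  moreover have "correlation E \<tau> \<le> (\<Sum>u\<in>V. \<Sum>v\<in>V. card V * card V)" if "numbering \<tau>" for \<tau>
  proof -
    have "\<tau> u \<le> card V" if "u \<in> V" for u
      using bij_betwE[of \<tau> V "{..<card V}"] \<open>numbering \<tau>\<close> that unfolding numbering_def
      by (auto simp: less_imp_le)
    then show ?thesis unfolding correlation_def by (intro sum_mono) (auto intro: mult_le_mono)
  qed
  ultimately have "\<exists>\<sigma>. numbering \<sigma> \<and> (\<forall>\<tau>. numbering \<tau> \<longrightarrow> correlation E \<tau> \<le> correlation E \<sigma>)"
    by (intro ex_has_greatest_nat[where b = "Suc (\<Sum>u\<in>V. \<Sum>v\<in>V. card V * card V)"])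
      (auto simp: less_Suc_eq_le)
  then show thesis using that by blast
qed

text \<open>Without a cut the switch would be neutral, and its result would be the old graph with
  \<open>a\<close>, \<open>d\<close> or \<open>b\<close>, \<open>c\<close> interchanged. These are
  tied, so \<open>\<sigma>\<close> composed with the transposition is again a numbering; on the old
  graph it has the correlation of \<open>\<sigma>\<close> on the new one, which is larger.\<close>

lemma best_numbering_no_gain:
  assumes opt: "opt E" and \<sigma>: "numbering \<sigma>" and best: "\<And>\<tau>. numbering \<tau> \<Longrightarrow> correlation E \<tau> \<le> correlation E \<sigma>"
    and sw: "switchable E a b c d" and less: "\<sigma> a < \<sigma> d" "\<sigma> c < \<sigma> b"
  shows "\<exists>S. cut2 V E S a b c d"
proof -
  interpret quartic_rel V E using opt by (rule opt_quartic)
  note dist = switchable_distinct[OF sw]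
  have E: "E a b" "E b a" "E c d" "E d c" "\<not> E a c" "\<not> E c a" "\<not> E b d" "\<not> E d b"
    using sw adj_sym unfolding switchable_def by blast+
  have bij: "bij_betw \<sigma> V {..<card V}" and mono: "\<And>u v. u \<in> V \<Longrightarrow> v \<in> V \<Longrightarrow> x v < x u \<Longrightarrow> \<sigma> u < \<sigma> v"
    using \<sigma> unfolding numbering_def by blast+
  have gain: "0 \<le> (x a - x d) * (x c - x b)"
    using mono[of d a] mono[of b c] less dist by (intro mult_nonneg_nonneg) force+
  have corr: "real (correlation F \<tau>) = (\<Sum>u\<in>V. \<Sum>v\<in>V. if F u v then real (\<tau> u) * real (\<tau> v) else 0)" for F \<tau>
    unfolding correlation_def of_nat_sum by (intro sum.cong refl) simp
  let ?F = "switch E a b c d"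
  have incr: "correlation E \<sigma> < correlation ?F \<sigma>"
  proof -
    have "real (correlation ?F \<sigma>) = real (correlation E \<sigma>)
        + 2 * (real (\<sigma> a) * real (\<sigma> c) + real (\<sigma> b) * real (\<sigma> d) - real (\<sigma> a) * real (\<sigma> b) - real (\<sigma> c) * real (\<sigma> d))"
      unfolding corr by (rule switch_sum[OF sw]) (rule mult.commute)
    also have "real (\<sigma> a) * real (\<sigma> c) + real (\<sigma> b) * real (\<sigma> d) - real (\<sigma> a) * real (\<sigma> b) - real (\<sigma> c) * real (\<sigma> d)
      = (real (\<sigma> d) - real (\<sigma> a)) * (real (\<sigma> b) - real (\<sigma> c))" by (simp add: algebra_simps)
    finally have "real (correlation ?F \<sigma>) = real (correlation E \<sigma>)
      + 2 * ((real (\<sigma> d) - real (\<sigma> a)) * (real (\<sigma> b) - real (\<sigma> c)))" .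
    moreover have "(real (\<sigma> d) - real (\<sigma> a)) * (real (\<sigma> b) - real (\<sigma> c)) > 0"
      using less by (intro mult_pos_pos) auto
    ultimately show ?thesis by linarith
  qed
  have swap: False if pq: "p \<in> V" "q \<in> V" "p \<noteq> q" "x p = x q"
    and iso: "\<And>u v. ?F u v \<longleftrightarrow> E (transpose p q u) (transpose p q v)" for p q
  proof -
    let ?t = "transpose p q"
    have t: "bij_betw ?t V V" using pq by (intro bij_betw_byWitness[of _ ?t]) (auto simp: transpose_def)
    have "bij_betw (\<lambda>u. \<sigma> (?t u)) V {..<card V}" using bij_betw_trans[OF t bij] by (simp add: o_def)
    moreover have "x (?t u) = x u" for u using pq by (auto simp: transpose_def)
    moreover have "?t u \<in> V" if "u \<in> V" for u using that pq by (auto simp: transpose_def)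
    ultimately have "numbering (\<lambda>u. \<sigma> (?t u))" using mono unfolding numbering_def by simp
    moreover have "correlation E (\<lambda>u. \<sigma> (?t u)) = correlation ?F \<sigma>"
    proof -
      have "correlation ?F \<sigma> = (\<Sum>u\<in>V. \<Sum>v\<in>V. if ?F (?t u) (?t v) then \<sigma> (?t u) * \<sigma> (?t v) else 0)"
        unfolding correlation_def
        by (subst sum.reindex_bij_betw[OF t, symmetric], rule sum.cong[OF refl],
            subst sum.reindex_bij_betw[OF t, symmetric], rule refl)
      also have "\<dots> = correlation E (\<lambda>u. \<sigma> (?t u))" unfolding correlation_def iso by simp
      finally show ?thesis by simp
    qed
    ultimately show False using best[of "\<lambda>u. \<sigma> (?t u)"] incr by simp
  qed
  show ?thesis
  proof (rule quartic_rel_switch[OF sw])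
    assume F: "quartic_rel V ?F"
    note st = switch_tied[OF opt sw F gain]
    from neutral_switch_twins[OF opt st(1) sw st(2,3)] show ?thesis
    proof
      assume tw: "\<forall>z. z \<notin> {a, b, c, d} \<longrightarrow> E a z = E d z"
      have tw: "E a z = E d z" "E z a = E z d" if "z \<notin> {a, b, c, d}" for z
        using tw that adj_commute[of z a] adj_commute[of z d] by blast+
      have "?F u v \<longleftrightarrow> E (transpose a d u) (transpose a d v)" for u v
        unfolding switch_def transpose_def doubleton_eq_iff
        using dist dist(3)[symmetric] E tw[of u] tw[of v] adj_irrefl adj_commute[of a d]
        by (cases "u = a"; cases "u = d"; cases "v = a"; cases "v = d"; simp) (metis insert_iff)+
      then show ?thesis using swap[of a d] dist st by blast
    next
      assume tw: "\<forall>z. z \<notin> {a, b, c, d} \<longrightarrow> E b z = E c z"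
      have tw: "E b z = E c z" "E z b = E z c" if "z \<notin> {a, b, c, d}" for z
        using tw that adj_commute[of z b] adj_commute[of z c] by blast+
      have "?F u v \<longleftrightarrow> E (transpose b c u) (transpose b c v)" for u v
        unfolding switch_def transpose_def doubleton_eq_iff
        using dist dist(4)[symmetric] E tw[of u] tw[of v] adj_irrefl adj_commute[of b c]
        by (cases "u = b"; cases "u = c"; cases "v = b"; cases "v = c"; simp) (metis insert_iff)+
      then show ?thesis using swap[of b c] dist st by blast
    qed
  qed blast
qed

lemma ordered_quartic_exists:
  assumes opt: "opt E"
  obtains vt where "bij_betw vt {..<card V} V"
    "ordered_quartic (card V) (\<lambda>i j. i < card V \<and> j < card V \<and> E (vt i) (vt j))"
proof -
  interpret quartic_rel V E using opt by (rule opt_quartic)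
  let ?n = "card V"
  obtain \<sigma> where \<sigma>: "numbering \<sigma>" and best: "\<And>\<tau>. numbering \<tau> \<Longrightarrow> correlation E \<tau> \<le> correlation E \<sigma>"
    using best_numbering[OF finite_verts, of E] by blast
  have bij: "bij_betw \<sigma> V {..<?n}" using \<sigma> by (simp add: numbering_def)
  define vt where "vt = the_inv_into V \<sigma>"
  have vt: "bij_betw vt {..<?n} V" unfolding vt_def by (rule bij_betw_the_inv_into[OF bij])
  have \<sigma>vt: "\<sigma> (vt i) = i" if "i < ?n" for i
    using bij that unfolding vt_def by (auto simp: bij_betw_def f_the_inv_into_f)
  have vtV: "vt i \<in> V" if "i < ?n" for i using vt that by (auto simp: bij_betw_def)
  have vt_inj: "vt i = vt j \<longleftrightarrow> i = j" if "i < ?n" "j < ?n" for i j using \<sigma>vt that by metis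
  have vt_surj: "\<exists>i<?n. vt i = u" if "u \<in> V" for u
    using vt that unfolding bij_betw_def by (metis imageE lessThan_iff)
  define F where "F i j \<longleftrightarrow> i < ?n \<and> j < ?n \<and> E (vt i) (vt j)" for i j
  interpret F: quartic_rel "{..<?n}" F
  proof (rule quartic_rel.intro)
    show "{..<?n} \<noteq> {}" using finite_verts verts_nonempty by (simp add: lessThan_empty_iff)
    show "card {v. F u v} = 4" if "u \<in> {..<?n}" for u
    proof -
      have "bij_betw vt {v. F u v} {w. E (vt u) w}"
      proof (rule bij_betw_imageI)
        show "inj_on vt {v. F u v}" by (rule inj_onI) (auto simp: F_def vt_inj)
        show "vt ` {v. F u v} = {w. E (vt u) w}"
        proof (intro equalityI subsetI)
          fix w assume "w \<in> {w. E (vt u) w}"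
          then show "w \<in> vt ` {v. F u v}" using vt_surj[OF adj_in_verts2, of "vt u" w] that by (auto simp: F_def)
        qed (auto simp: F_def)
      qed
      from bij_betw_same_card[OF this] show ?thesis using degree_4[OF vtV] that by simp
    qed
    fix S assume S: "S \<subseteq> {..<?n}" "S \<noteq> {}" and cl: "\<And>u v. u \<in> S \<Longrightarrow> F u v \<Longrightarrow> v \<in> S"
    have "vt ` S = V"
    proof (rule closed_set)
      show "vt ` S \<subseteq> V" using S(1) vtV by auto
      fix u v assume u: "u \<in> vt ` S" and uv: "E u v"
      then obtain i where i: "i \<in> S" "u = vt i" by blast
      obtain j where j: "j < ?n" "vt j = v" using vt_surj adj_in_verts2[OF uv] by blast
      have "F i j" using i j uv S(1) unfolding F_def by auto
      then show "v \<in> vt ` S" using cl i j by blast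
    qed (use S in simp)
    show "S = {..<?n}"
    proof
      show "{..<?n} \<subseteq> S"
      proof
        fix i assume i: "i \<in> {..<?n}"
        then have "vt i \<in> vt ` S" using vtV \<open>vt ` S = V\<close> by simp
        then obtain j where "j \<in> S" "vt i = vt j" by blast
        then show "i \<in> S" using vt_inj[of i j] i S(1) by auto
      qed
    qed (use S in simp)
  qed (use adj_irrefl adj_sym in \<open>auto simp: F_def\<close>)
  have no_gain: "\<exists>S. cut2 {..<?n} F S a b c d" if sw: "switchable F a b c d" and less: "a < d" "c < b" for a b c d
  proof -
    note dist = F.switchable_distinct[OF sw]
    have n: "a < ?n" "b < ?n" "c < ?n" "d < ?n" using dist by auto
    have "switchable E (vt a) (vt b) (vt c) (vt d)"
      using sw n vt_inj unfolding switchable_def F_def by blast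
    then obtain S where S: "cut2 V E S (vt a) (vt b) (vt c) (vt d)"
      using best_numbering_no_gain[OF opt \<sigma> best, of "vt a" "vt b" "vt c" "vt d"] less \<sigma>vt n by auto
    have "cut2 {..<?n} F {i. i < ?n \<and> vt i \<in> S} a b c d"
      using S n vt_inj unfolding cut2_def F_def by (auto 0 3)
    then show ?thesis by blast
  qed
  \<comment> \<open>If both switches of the nested edges \<open>ps\<close> and \<open>qr\<close>
    were blocked, the intersection of the two sides would be left by \<open>ps\<close>
    alone.\<close>
  have not_both: False
    if ord: "p < q" "q < r" "r < s" and F: "F p s" "F q r"
      and S: "cut2 {..<?n} F S p s q r" and S': "cut2 {..<?n} F S' p s r q" for p q r s S S'
  proof -
    have "{(u, v). u \<in> S \<inter> S' \<and> v \<notin> S \<inter> S' \<and> F u v} = {(p, s)}"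
      using S S' F unfolding cut2_def by blast
    moreover have "S \<inter> S' \<subseteq> {..<?n}" using S unfolding cut2_def by blast
    ultimately show False using F.odd_boundary_False[of "S \<inter> S'" "{(p, s)}"] by simp
  qed
  have sw1: "switchable F p s r q" if "p < q" "q < r" "r < s" "F p s" "F q r" "\<not> F p r" "\<not> F q s" for p q r s
    using that F.adj_commute unfolding switchable_def by auto
  have sw2: "switchable F p s q r" if "p < q" "q < r" "r < s" "F p s" "F q r" "\<not> F p q" "\<not> F r s" for p q r s
    using that F.adj_commute unfolding switchable_def by auto
  have "ordered_quartic ?n F"
  proof
    fix p q r s :: nat assume ord: "p < q" "q < r" "r < s"
    {
      assume F: "F p s" "F q r"
      show "F p r \<or> F q s"
      proof (rule ccontr)
        assume "\<not> ?thesis"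
        then have nF: "\<not> F p r" "\<not> F q s" by auto
        obtain S' where S': "cut2 {..<?n} F S' p s r q" using no_gain[OF sw1[OF ord F nF]] ord by auto
        have "p \<in> S'" "r \<in> S'" "s \<notin> S'" "q \<notin> S'" using S' by (simp_all add: cut2_def)
        then have "\<not> F p q" "\<not> F r s" using cut2_leave[OF S', of p q] cut2_leave[OF S', of r s] ord by auto
        then obtain S where "cut2 {..<?n} F S p s q r" using no_gain[OF sw2[OF ord F]] ord by auto
        then show False using not_both[OF ord F _ S'] by blast
      qed
      show "F p q \<or> F r s"
      proof (rule ccontr)
        assume "\<not> ?thesis"
        then have nF: "\<not> F p q" "\<not> F r s" by auto
        obtain S where S: "cut2 {..<?n} F S p s q r" using no_gain[OF sw2[OF ord F nF]] ord by auto
        have "p \<in> S" "q \<in> S" "s \<notin> S" "r \<notin> S" using S by (simp_all add: cut2_def)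
        then have "\<not> F p r" "\<not> F q s" using cut2_leave[OF S, of p r] cut2_leave[OF S, of q s] ord by auto
        then obtain S' where "cut2 {..<?n} F S' p s r q" using no_gain[OF sw1[OF ord F]] ord by auto
        then show False using not_both[OF ord F S] by blast
      qed
    next
      assume F: "F p r" "F q s"
      show "F p q \<or> F r s \<or> (\<exists>S. cut2 {..<?n} F S p r q s)"
      proof (rule ccontr)
        assume "\<not> ?thesis"
        moreover from this have "switchable F p r q s" using F ord unfolding switchable_def by auto
        ultimately show False using no_gain[of p r q s] ord by auto
      qed
    }
  qed
  then show thesis using that[OF vt] unfolding F_def[abs_def] by blast
qed

end

section \<open>Exploring the graph from left to right\<close>

text \<open>
  Vertices are given by their offset from a base position. In a state \<open>R\<close>, the list \<open>R ! i\<close>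
  consists of the neighbours of \<open>i\<close> that are greater than \<open>i\<close> and at least \<open>b\<close>; a pair \<open>(r, s)\<close> in
  \<open>eqs\<close> means that \<open>r\<close> and \<open>s\<close> have the same neighbours from \<open>length R\<close> on, apart from \<open>r\<close> and \<open>s\<close>;
  and \<open>t\<close> is greater than all vertices that occur so far. Vertices from \<open>t\<close> on have no earlier
  neighbour, so the next list can use only an initial segment of them.
\<close>

definition backdeg :: "nat list list \<Rightarrow> nat \<Rightarrow> nat" where
  "backdeg R v = length (filter (\<lambda>ns. v \<in> set ns) R)"

fun subsets :: "nat \<Rightarrow> nat list \<Rightarrow> nat list list" where
  "subsets 0 xs = [[]]"
| "subsets (Suc m) [] = []"
| "subsets (Suc m) (x # xs) = map ((#) x) (subsets m xs) @ subsets (Suc m) xs"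

text \<open>Degree 4 fixes the length \<open>d\<close> of the row. It consists of \<open>j\<close>
  fresh vertices and of old ones that can still take an edge.\<close>

definition next_rows :: "nat list list \<Rightarrow> nat \<Rightarrow> nat list list" where
  "next_rows R t = (let k = length R; d = 4 - backdeg R k; c = filter (\<lambda>v. backdeg R v < 4) [Suc k..<t] in
     concat (map (\<lambda>j. map (\<lambda>T. T @ [t..<t + j]) (subsets (d - j) c)) [0..<Suc d]))"

text \<open>The cases give the position of the new vertex relative to the pair. If it is the first
  of the two, nothing can be compared before the row of the second is known.\<close>

definition ok_twins :: "nat list list \<Rightarrow> (nat \<times> nat) list \<Rightarrow> nat list \<Rightarrow> bool" where
  "ok_twins R eqs ns = (let k = length R in
     list_all (\<lambda>(r, s). if r = k then True
        else if s = k then filter (\<lambda>q. k < q) (R ! r) = ns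
        else if r < k then (k \<in> set (R ! r)) = (if s < k then k \<in> set (R ! s) else s \<in> set ns)
        else (r \<in> set ns) = (s \<in> set ns)) eqs)"

definition ok_nested1 :: "nat list list \<Rightarrow> nat list \<Rightarrow> bool" where
  "ok_nested1 R ns = list_all (\<lambda>P. list_all (\<lambda>s. list_all (\<lambda>r. s \<le> r \<or> r \<in> set P \<or> s \<in> set ns) ns) P) R"

text \<open>Here and in \<open>ok_crossing\<close> the vertex \<open>q\<close> starts at
  \<open>b\<close>, because the rows do not record adjacency to vertices before
  \<open>b\<close>.\<close>

definition ok_nested2 :: "nat \<Rightarrow> nat list list \<Rightarrow> nat list \<Rightarrow> bool" where
  "ok_nested2 b R ns = (let k = length R in
     list_all (\<lambda>q. k \<notin> set (R ! q) \<or> list_all (\<lambda>p. q \<in> set (R ! p) \<or>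
        list_all (\<lambda>s. s \<le> k \<or> s \<in> set ns) (R ! p)) [0..<q]) [b..<k])"

text \<open>A violation is tolerated only while a cut might still separate \<open>p\<close>,
  \<open>q\<close> from \<open>k\<close>, \<open>s\<close>. An edge \<open>ps\<close> or
  \<open>qk\<close>, or a third vertex \<open>x\<close> joining one pair to the other, is a
  connection outside the two permitted edges and refutes such a cut.\<close>

definition ok_crossing :: "nat \<Rightarrow> nat list list \<Rightarrow> nat list \<Rightarrow> bool" where
  "ok_crossing b R ns = (let k = length R in
     list_all (\<lambda>q. list_all (\<lambda>p. k \<notin> set (R ! p) \<or> q \<in> set (R ! p) \<or>
        list_all (\<lambda>s. s \<le> k \<or> s \<in> set ns \<or>
          \<not> (s \<in> set (R ! p) \<or> k \<in> set (R ! q) \<or>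
             list_ex (\<lambda>x. x < k \<and> (k \<in> set (R ! x) \<or> s \<in> set (R ! x))) (R ! p @ R ! q))) (R ! q)) [0..<q]) [b..<k])"

definition skipped :: "nat \<Rightarrow> nat list \<Rightarrow> (nat \<times> nat) list" where
  "skipped k ns = concat (map (\<lambda>s. map (\<lambda>r. (r, s)) (filter (\<lambda>r. r \<notin> set ns) [Suc k..<s])) ns)"

definition ok_skipped :: "nat list list \<Rightarrow> nat list \<Rightarrow> bool" where
  "ok_skipped R ns = list_all (\<lambda>(r, s). backdeg R s < backdeg R r) (skipped (length R) ns)"

definition new_twins :: "nat list list \<Rightarrow> nat list \<Rightarrow> (nat \<times> nat) list" where
  "new_twins R ns = filter (\<lambda>(r, s). backdeg R r = Suc (backdeg R s)) (skipped (length R) ns)"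

definition ok_row :: "nat \<Rightarrow> nat list list \<Rightarrow> (nat \<times> nat) list \<Rightarrow> nat list \<Rightarrow> bool" where
  "ok_row b R eqs ns \<longleftrightarrow> ok_twins R eqs ns \<and> ok_skipped R ns \<and> ok_nested1 R ns
     \<and> ok_nested2 b R ns \<and> ok_crossing b R ns"

text \<open>Counts the edges that lead beyond the processed vertices: none at the end of the graph,
  two at a cut vertex or at a cut by two disjoint edges.\<close>

definition final :: "nat list list \<Rightarrow> bool" where
  "final R \<longleftrightarrow> length (filter (\<lambda>v. length R \<le> v) (concat R)) \<le> 2"

text \<open>Without fuel the unfinished state itself is returned, so soundness needs no termination
  argument; the tables reveal that this never happens.\<close>

fun explore :: "nat \<Rightarrow> nat \<Rightarrow> nat list list \<Rightarrow> (nat \<times> nat) list \<Rightarrow> nat \<Rightarrow> nat list list list" where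
  "explore b 0 R eqs t = [R]"
| "explore b (Suc f) R eqs t =
     concat (map (\<lambda>ns. let R' = R @ [ns] in if final R' then [R'] else
        explore b f R' (new_twins R ns @ eqs) (max t (Suc (foldr max ns 0))))
        (filter (ok_row b R eqs) (next_rows R t)))"

lemma subsets_complete: "filter P xs \<in> set (subsets (length (filter P xs)) xs)"
proof (induction xs)
  case (Cons a xs)
  show ?case
  proof (cases "P a")
    case False
    then show ?thesis using Cons.IH by (cases "length (filter P xs)") auto
  qed (use Cons.IH in simp)
qed simp

lemma filter_down_closed:
  assumes "\<And>r s. t \<le> r \<Longrightarrow> r < s \<Longrightarrow> P s \<Longrightarrow> P r"
  shows "filter P [t..<m] = [t..<t + length (filter P [t..<m])]"
proof (induction m)
  case (Suc m)
  show ?case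
  proof (cases "t \<le> m \<and> P m")
    case True
    then have "filter P [t..<m] = [t..<m]" using assms by (auto simp: filter_id_conv)
    then show ?thesis using True by simp
  next
    case False
    then show ?thesis using Suc.IH by (cases "t \<le> m") auto
  qed
qed simp

lemma filter_greater_upt: "a \<le> Suc k \<Longrightarrow> filter (\<lambda>q. k < q) [a..<m] = [Suc k..<m]"
  by (induction m) auto

lemma le_foldr_max: "j \<in> set xs \<Longrightarrow> j \<le> foldr max xs (0 :: nat)"
  by (induction xs) auto

lemma cut2_swap: "cut2 V E S a b c d \<Longrightarrow> cut2 V E S c d a b"
  unfolding cut2_def by blast

context ordered_quartic
begin

lemma adj_less: "F i j \<Longrightarrow> i < n" "F i j \<Longrightarrow> j < n"
  using adj_in_verts adj_in_verts2 by blast+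

text \<open>If \<open>p\<close> skips \<open>r\<close> in favour of the later \<open>s\<close>, then the neighbours of \<open>r\<close> beyond \<open>p\<close> are
  neighbours of \<open>s\<close>; counting degrees forces \<open>r\<close> to have more neighbours before \<open>p\<close> than \<open>s\<close>.\<close>

lemma skip:
  assumes ord: "p < r" "r < s" and ps: "F p s" and pr: "\<not> F p r"
  shows "card {x. x < p \<and> F x s} < card {x. x < p \<and> F x r}" (is "?cs < ?cr")
    and "card {x. x < p \<and> F x r} = Suc (card {x. x < p \<and> F x s}) \<Longrightarrow> p < q \<Longrightarrow> q \<noteq> r \<Longrightarrow> q \<noteq> s \<Longrightarrow> F q r \<longleftrightarrow> F q s"
proof -
  let ?A = "{q. p < q \<and> q \<noteq> s \<and> F q r}" and ?B = "{q. p < q \<and> q \<noteq> r \<and> F q s}"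
  have fin: "finite {x. P x \<and> F x y}" for P y
    by (rule finite_subset[OF _ finite_neighbours[of y]]) (auto intro: adj_sym)
  have finA: "finite ?A" "finite ?B"
    using fin[of "\<lambda>q. p < q \<and> q \<noteq> s" r] fin[of "\<lambda>q. p < q \<and> q \<noteq> r" s] by (simp_all add: conj_assoc)
  have deg: "card {q. F q y} = 4" if "y < n" for y
    using degree_4[of y] that adj_commute[of y] by simp
  have sn: "s < n" "r < n" using adj_less(2)[OF ps] ord by auto
  let ?R = "if F r s then {s} else {}" and ?S = "if F r s then {r} else {}"
  have cA: "card {x. x < p \<and> F x r} + card ?A + (if F r s then 1 else 0) = 4"
  proof -
    have eq: "{q. F q r} = {x. x < p \<and> F x r} \<union> (?A \<union> ?R)"
    proof (rule Set.set_eqI)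
      fix q show "q \<in> {q. F q r} \<longleftrightarrow> q \<in> {x. x < p \<and> F x r} \<union> (?A \<union> ?R)"
        by (cases q p rule: linorder_cases) (use pr ord adj_commute[of r s] in auto)
    qed
    have "{x. x < p \<and> F x r} \<inter> (?A \<union> ?R) = {}" "?A \<inter> ?R = {}" using ord by auto
    then have "card {q. F q r} = card {x. x < p \<and> F x r} + (card ?A + card ?R)"
      unfolding eq using fin finA by (subst card_Un_disjoint, simp, simp, simp, subst card_Un_disjoint) simp_all
    moreover have "card ?R = (if F r s then 1 else 0)" by simp
    ultimately show ?thesis unfolding deg[OF sn(2)] by linarith
  qed
  have cB: "card {x. x < p \<and> F x s} + 1 + card ?B + (if F r s then 1 else 0) = 4"
  proof -
    have eq: "{q. F q s} = {x. x < p \<and> F x s} \<union> (?B \<union> insert p ?S)"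
    proof (rule Set.set_eqI)
      fix q show "q \<in> {q. F q s} \<longleftrightarrow> q \<in> {x. x < p \<and> F x s} \<union> (?B \<union> insert p ?S)"
        by (cases q p rule: linorder_cases) (use ps ord in auto)
    qed
    have "{x. x < p \<and> F x s} \<inter> (?B \<union> insert p ?S) = {}" "?B \<inter> insert p ?S = {}" using ord by auto
    then have "card {q. F q s} = card {x. x < p \<and> F x s} + (card ?B + card (insert p ?S))"
      unfolding eq using fin finA by (subst card_Un_disjoint, simp, simp, simp, subst card_Un_disjoint) simp_all
    moreover have "card (insert p ?S) = 1 + (if F r s then 1 else 0)" using ord by simp
    ultimately show ?thesis unfolding deg[OF sn(1)] by linarith
  qed
  have AB: "F q s \<or> (\<exists>S. cut2 {..<n} F S p s r q)" if q: "q \<in> ?A" for q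
  proof -
    have "q \<noteq> r" using q adj_irrefl by auto
    then consider "q < r" | "r < q" "q < s" | "s < q" using q by force
    then show ?thesis
    proof cases
      case 1
      then show ?thesis using nested1[of p q r s] q ord ps pr by auto
    next
      case 2
      then show ?thesis using nested2[of p r q s] q ord ps pr adj_commute[of q r] by auto
    next
      case 3
      then show ?thesis using crossing[of p r s q] q ord ps pr adj_commute[of q] by auto
    qed
  qed
  have main: "?cs < ?cr \<and> (?cr = Suc ?cs \<longrightarrow> p < q \<longrightarrow> q \<noteq> r \<longrightarrow> q \<noteq> s \<longrightarrow> F q r = F q s)" for q
  proof (cases "?A \<subseteq> ?B")
    case True
    then have le: "card ?A \<le> card ?B" using finA card_mono by blast
    then have "?cs < ?cr" using cA cB by linarith
    moreover have "F q r = F q s" if "?cr = Suc ?cs" "p < q" "q \<noteq> r" "q \<noteq> s"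
    proof -
      have "card ?A = card ?B" using cA cB that(1) by linarith
      then have "?A = ?B" using True finA card_subset_eq by blast
      then show ?thesis using that by blast
    qed
    ultimately show ?thesis by blast
  next
    \<comment> \<open>An exceptional \<open>q0\<close> comes with a cut, and by
      \<open>cut2_unique\<close> it is the only element of \<open>?A\<close>, so \<open>r\<close>
      has three neighbours before \<open>p\<close>. Once \<open>s\<close> is shown to have none, the
      inequality is clear and the second claim is vacuous.\<close>
    case False
    then obtain q0 where q0: "q0 \<in> ?A" "\<not> F q0 s" using adj_irrefl by blast
    then obtain S where S: "cut2 {..<n} F S p s r q0" using AB by blast
    have Sm: "p \<in> S" "r \<in> S" "s \<notin> S" "q0 \<notin> S" "S \<subseteq> {..<n}" using S by (simp_all add: cut2_def)
    note lv = cut2_leave[OF S]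
    have nrs: "\<not> F r s" using lv[of r s] Sm ord q0(1) by auto
    have "?A \<subseteq> {q0}"
    proof
      fix q assume q: "q \<in> ?A"
      show "q \<in> {q0}"
      proof (rule ccontr)
        assume ne: "q \<notin> {q0}"
        have "q \<in> S" using lv[of r q] Sm q ne adj_commute[of r q] ord by auto
        moreover have "q \<noteq> r" using q adj_irrefl by blast
        ultimately have "\<not> F q s" using lv[of q s] Sm q by auto
        then obtain S' where S': "cut2 {..<n} F S' p s r q" using AB[OF q] by blast
        have "cut2 {..<n} F ({..<n} - S) s p q0 r" "cut2 {..<n} F ({..<n} - S') s p q r"
          using cut2_flip[OF S ps] cut2_flip[OF S' ps] q0 q adj_commute[of r] by (auto intro: cut2_swap)
        from cut2_unique[OF this] ps q0 q ne ord adj_commute show False by auto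
      qed
    qed
    then have "?A = {q0}" using q0 by blast
    then have cr: "?cr = 3" using cA nrs by simp
    \<comment> \<open>Neighbours \<open>a\<close> of \<open>s\<close> and \<open>y\<close> of
      \<open>r\<close> before \<open>p\<close> lie on different sides of the cut and are not
      adjacent. If \<open>as\<close> and \<open>yr\<close> are nested, \<open>nested2\<close> is
      violated; if they cross, the resulting second cut contradicts parity.\<close>
    have "{x. x < p \<and> F x s} = {}"
    proof (rule ccontr)
      assume "{x. x < p \<and> F x s} \<noteq> {}"
      then obtain a where a: "a < p" "F a s" by blast
      have "{x. x < p \<and> F x r} \<noteq> {}" using cr by (metis card.empty zero_neq_numeral)
      then obtain y where y: "y < p" "F y r" by blast
      have aS: "a \<notin> S" using lv[of a s] Sm a ord by auto
      have yS: "y \<in> S" using lv[of r y] Sm y q0 ord adj_commute[of r y] by auto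
      have nya: "\<not> F y a" using lv[of y a] aS yS y ord by auto
      have "a \<noteq> y" using aS yS by auto
      then consider "a < y" | "y < a" by linarith
      then show False
      proof cases
        case 1
        then show False using nested2[of a y r s] a y ord nya nrs adj_commute[of y a] by auto
      next
        case 2
        then obtain S2 where S2: "cut2 {..<n} F S2 y r a s"
          using crossing[of y a r s] a y ord nya nrs by auto
        have S2m: "y \<in> S2" "a \<in> S2" "r \<notin> S2" "s \<notin> S2" using S2 by (simp_all add: cut2_def)
        have "p \<notin> S2" using cut2_leave[OF S2 ps] S2m y a by auto
        then have "{(u, v). u \<in> S \<inter> S2 \<and> v \<notin> S \<inter> S2 \<and> F u v} = {(y, r)}"
          using lv cut2_leave[OF S2] S2m Sm aS yS y by blast
        then show False using odd_boundary_False[of "S \<inter> S2" "{(y, r)}"] Sm by auto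
      qed
    qed
    then have cs: "?cs = 0" by (metis card.empty)
    show ?thesis unfolding cr cs by simp
  qed
  show "?cs < ?cr" using main by blast
  show "F q r \<longleftrightarrow> F q s" if "?cr = Suc ?cs" "p < q" "q \<noteq> r" "q \<noteq> s"
    using main[of q] that by blast
qed

section \<open>Soundness of the exploration\<close>

text \<open>The row that the graph itself prescribes at offset \<open>i\<close> from the base
  \<open>o'\<close>. With \<open>b = 2\<close> an edge between the two initial ports is left
  out.\<close>

definition forward :: "nat \<Rightarrow> nat \<Rightarrow> nat \<Rightarrow> nat list" where
  "forward b o' i = filter (\<lambda>j. F (o' + i) (o' + j)) [max (Suc i) b..<n]"

definition consistent :: "nat \<Rightarrow> nat \<Rightarrow> nat list list \<Rightarrow> bool" where
  "consistent b o' R \<longleftrightarrow> (\<forall>i<length R. R ! i = forward b o' i)"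

lemma set_forward: "set (forward b o' i) = {j. i < j \<and> b \<le> j \<and> F (o' + i) (o' + j)}"
  using adj_less(2) by (fastforce simp: forward_def)

context
  fixes b o' :: nat
  assumes b: "1 \<le> b" and region: "\<And>i j. b \<le> i \<Longrightarrow> F (o' + i) j \<Longrightarrow> o' \<le> j"
begin

lemma consistent_mem:
  assumes "consistent b o' R" "i < length R"
  shows "j \<in> set (R ! i) \<longleftrightarrow> i < j \<and> b \<le> j \<and> F (o' + i) (o' + j)"
  using assms set_forward[of b o' i] by (simp add: consistent_def)

text \<open>By \<open>region\<close>, a vertex from offset \<open>b\<close> on has no neighbours
  before the base, so the rows contain all its earlier neighbours.\<close>

lemma backdeg_eq:
  assumes R: "consistent b o' R" and v: "b \<le> v" "length R \<le> v"
  shows "backdeg R v = card {x. x < o' + length R \<and> F x (o' + v)}"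
proof -
  have "backdeg R v = card {i. i < length R \<and> v \<in> set (R ! i)}"
    unfolding backdeg_def by (rule length_filter_conv_card)
  also have "{i. i < length R \<and> v \<in> set (R ! i)} = {i. i < length R \<and> F (o' + i) (o' + v)}"
    using consistent_mem[OF R] v by auto
  also have "card \<dots> = card ((+) o' ` {i. i < length R \<and> F (o' + i) (o' + v)})"
    by (simp add: card_image)
  also have "(+) o' ` {i. i < length R \<and> F (o' + i) (o' + v)} = {x. x < o' + length R \<and> F x (o' + v)}"
  proof (intro equalityI subsetI)
    fix x assume x: "x \<in> {x. x < o' + length R \<and> F x (o' + v)}"
    then have "o' \<le> x" using region[OF v(1), of x] adj_commute by blast
    then show "x \<in> (+) o' ` {i. i < length R \<and> F (o' + i) (o' + v)}"
      using x by (intro image_eqI[of _ _ "x - o'"]) auto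
  qed auto
  finally show ?thesis .
qed

lemma skip_rel:
  assumes R: "consistent b o' R" and bk: "b \<le> length R"
    and rs: "(r, s) \<in> set (skipped (length R) (forward b o' (length R)))"
  shows "backdeg R s < backdeg R r" "length R < r" "r < s"
    "backdeg R r = Suc (backdeg R s) \<Longrightarrow> length R < q \<Longrightarrow> q \<noteq> r \<Longrightarrow> q \<noteq> s \<Longrightarrow> F (o' + q) (o' + r) \<longleftrightarrow> F (o' + q) (o' + s)"
proof -
  let ?k = "length R"
  have rs: "?k < r" "r < s" "s \<in> set (forward b o' ?k)" "r \<notin> set (forward b o' ?k)"
    using rs unfolding skipped_def by auto
  then have F: "F (o' + ?k) (o' + s)" "\<not> F (o' + ?k) (o' + r)" using bk by (auto simp: set_forward)
  show "?k < r" "r < s" using rs by auto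
  note sk = skip[of "o' + ?k" "o' + r" "o' + s"]
  show "backdeg R s < backdeg R r" using sk(1) rs F bk by (simp add: backdeg_eq[OF R])
  show "F (o' + q) (o' + r) \<longleftrightarrow> F (o' + q) (o' + s)"
    if "backdeg R r = Suc (backdeg R s)" "?k < q" "q \<noteq> r" "q \<noteq> s"
    using sk(2)[of "o' + q"] rs F bk that by (simp add: backdeg_eq[OF R])
qed

text \<open>A fresh vertex has no processed neighbour, so by \<open>skip\<close> it cannot be passed
  over in favour of a later one. Hence the fresh vertices used form an initial segment.\<close>

lemma forward_in_next_rows:
  assumes R: "consistent b o' R" and bk: "b \<le> length R"
    and t: "\<And>i j. i < length R \<Longrightarrow> j \<in> set (R ! i) \<Longrightarrow> j < t" and kt: "length R < t"
    and kn: "o' + length R < n"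
  shows "forward b o' (length R) \<in> set (next_rows R t)"
proof -
  let ?k = "length R"
  let ?P = "\<lambda>j. F (o' + ?k) (o' + j)"
  define d where "d = 4 - backdeg R ?k"
  define c where "c = filter (\<lambda>v. backdeg R v < 4) [Suc ?k..<t]"
  define f where "f = forward b o' ?k"
  have f_eq: "f = filter ?P [Suc ?k..<n]" using bk by (simp add: f_def forward_def max_def)
  have fin: "finite {x. P x \<and> F x y}" for P y
    by (rule finite_subset[OF _ finite_neighbours[of y]]) (auto intro: adj_sym)
  have deg: "card {q. F q y} = 4" if "y < n" for y
    using degree_4[of y] that adj_commute[of y] by simp
  have len: "length f = d"
  proof -
    have "length f = card (set f)" by (rule distinct_card[symmetric]) (simp add: f_def forward_def)
    also have "set f = {j. ?k < j \<and> ?P j}" using bk by (auto simp: f_def set_forward)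
    also have "card \<dots> = card ((+) o' ` {j. ?k < j \<and> ?P j})" by (simp add: card_image)
    also have "(+) o' ` {j. ?k < j \<and> ?P j} = {x. o' + ?k < x \<and> F x (o' + ?k)}"
    proof (intro equalityI subsetI)
      fix x assume "x \<in> {x. o' + ?k < x \<and> F x (o' + ?k)}"
      then show "x \<in> (+) o' ` {j. ?k < j \<and> ?P j}"
        by (intro image_eqI[of _ _ "x - o'"]) (auto intro: adj_sym)
    qed (auto intro: adj_sym)
    finally have "length f = card {x. o' + ?k < x \<and> F x (o' + ?k)}" .
    moreover have "card {q. F q (o' + ?k)} = card {x. x < o' + ?k \<and> F x (o' + ?k)} + card {x. o' + ?k < x \<and> F x (o' + ?k)}"
    proof -
      have "{q. F q (o' + ?k)} = {x. x < o' + ?k \<and> F x (o' + ?k)} \<union> {x. o' + ?k < x \<and> F x (o' + ?k)}"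
      proof (rule Set.set_eqI)
        fix q show "q \<in> {q. F q (o' + ?k)} \<longleftrightarrow> q \<in> {x. x < o' + ?k \<and> F x (o' + ?k)} \<union> {x. o' + ?k < x \<and> F x (o' + ?k)}"
          by (cases q "o' + ?k" rule: linorder_cases) (use adj_irrefl[of "o' + ?k" "o' + ?k"] in auto)
      qed
      then show ?thesis using fin by (simp add: card_Un_disjoint disjoint_iff)
    qed
    ultimately show ?thesis using deg[OF kn] backdeg_eq[OF R bk] by (simp add: d_def)
  qed
  have kt': "Suc ?k \<le> t" using kt by simp
  define u where "u = filter ?P [t..<n]"
  have tn: "f = filter ?P [Suc ?k..<t] @ u"
  proof (cases "t \<le> n")
    case True
    then have "[Suc ?k..<n] = [Suc ?k..<t] @ [t..<n]" using kt' upt_add_eq_append[of "Suc ?k" t "n - t"] by simp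
    then show ?thesis unfolding f_eq u_def by simp
  next
    case False
    have "filter ?P [Suc ?k..<t] = filter ?P [Suc ?k..<n]"
    proof (cases "Suc ?k \<le> n")
      case True
      then have "[Suc ?k..<t] = [Suc ?k..<n] @ [n..<t]" using False upt_add_eq_append[of "Suc ?k" n "t - n"] by simp
      moreover have "filter ?P [n..<t] = []" using adj_less(2) by (fastforce simp: filter_empty_conv)
      ultimately show ?thesis by simp
    next
      case F: False
      have "filter ?P [Suc ?k..<t] = []" using adj_less(2) F by (fastforce simp: filter_empty_conv)
      then show ?thesis using F by simp
    qed
    then show ?thesis using False by (simp add: f_eq u_def)
  qed
  have "u = [t..<t + length u]" unfolding u_def
  proof (rule filter_down_closed)
    fix r s assume rs: "t \<le> r" "r < s" "?P s"
    show "?P r"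
    proof (rule ccontr)
      assume "\<not> ?P r"
      then have "backdeg R s < backdeg R r"
        using skip(1)[of "o' + ?k" "o' + r" "o' + s"] rs kt bk by (simp add: backdeg_eq[OF R])
      moreover have "backdeg R r = 0"
        unfolding backdeg_def using t rs(1) by (fastforce simp: filter_empty_conv in_set_conv_nth)
      ultimately show False by simp
    qed
  qed
  moreover have "filter ?P [Suc ?k..<t] = filter ?P c"
    unfolding c_def filter_filter
  proof (rule filter_cong[OF refl])
    fix v assume v: "v \<in> set [Suc ?k..<t]"
    have "backdeg R v < 4" if "?P v"
    proof -
      have "insert (o' + ?k) {x. x < o' + ?k \<and> F x (o' + v)} \<subseteq> {q. F q (o' + v)}" using that by auto
      from card_mono[OF _ this] fin[of "\<lambda>_. True" "o' + v"] fin[of "\<lambda>x. x < o' + ?k" "o' + v"]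
      have "Suc (backdeg R v) \<le> card {q. F q (o' + v)}"
        using v bk by (simp add: backdeg_eq[OF R])
      then show ?thesis using deg[OF adj_less(2)[OF that]] by simp
    qed
    then show "?P v \<longleftrightarrow> backdeg R v < 4 \<and> ?P v" by blast
  qed
  ultimately have f: "f = filter ?P c @ [t..<t + length u]" and lens: "length (filter ?P c) + length u = d"
    using tn len by (metis, metis length_append)
  have "filter ?P c \<in> set (subsets (d - length u) c)"
    using subsets_complete[of ?P c] lens by (metis add_diff_cancel_right')
  moreover have "length u \<in> set [0..<Suc d]" using lens by auto
  ultimately have "f \<in> set (next_rows R t)"
    unfolding next_rows_def Let_def d_def[symmetric] c_def[symmetric] f by auto
  then show ?thesis by (simp add: f_def)
qed

definition twins_ok :: "nat \<Rightarrow> (nat \<times> nat) list \<Rightarrow> bool" where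
  "twins_ok k eqs \<longleftrightarrow> (\<forall>(r, s) \<in> set eqs. r < s \<and>
     (\<forall>q\<ge>k. q \<noteq> r \<longrightarrow> q \<noteq> s \<longrightarrow> F (o' + q) (o' + r) = F (o' + q) (o' + s)))"

lemma forward_ok:
  assumes R: "consistent b o' R" and bk: "b \<le> length R" and eqs: "twins_ok (length R) eqs"
  shows "ok_row b R eqs (forward b o' (length R))"
proof -
  let ?k = "length R"
  let ?f = "forward b o' ?k"
  note mem = consistent_mem[OF R]
  have fmem: "j \<in> set ?f \<longleftrightarrow> ?k < j \<and> F (o' + ?k) (o' + j)" for j using bk by (auto simp: set_forward)
  have "ok_twins R eqs ?f"
    unfolding ok_twins_def Let_def list_all_iff
  proof (intro ballI, clarify)
    fix r s assume "(r, s) \<in> set eqs"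
    then have rs: "r < s" and eq: "\<And>q. ?k \<le> q \<Longrightarrow> q \<noteq> r \<Longrightarrow> q \<noteq> s \<Longrightarrow> F (o' + q) (o' + r) = F (o' + q) (o' + s)"
      using eqs unfolding twins_ok_def by auto
    show "if r = ?k then True
        else if s = ?k then filter (\<lambda>q. ?k < q) (R ! r) = ?f
        else if r < ?k then (?k \<in> set (R ! r)) = (if s < ?k then ?k \<in> set (R ! s) else s \<in> set ?f)
        else (r \<in> set ?f) = (s \<in> set ?f)"
    proof (cases "s = ?k")
      case True
      have "filter (\<lambda>q. ?k < q) (R ! r) = filter (\<lambda>q. F (o' + r) (o' + q)) [Suc ?k..<n]"
      proof -
        have "max (Suc r) b \<le> Suc ?k" using bk rs True by simp
        then have "filter (\<lambda>q. ?k < q) [max (Suc r) b..<n] = [Suc ?k..<n]" by (rule filter_greater_upt)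
        moreover have "filter f (filter g xs) = filter g (filter f xs)" for f g :: "nat \<Rightarrow> bool" and xs
          by (induction xs) auto
        moreover have "R ! r = forward b o' r" using R rs True by (simp add: consistent_def)
        ultimately show ?thesis unfolding forward_def by metis
      qed
      also have "\<dots> = filter (\<lambda>q. F (o' + ?k) (o' + q)) [Suc ?k..<n]"
      proof (rule filter_cong[OF refl])
        fix q assume "q \<in> set [Suc ?k..<n]"
        then show "F (o' + r) (o' + q) = F (o' + ?k) (o' + q)"
          using eq[of q] rs True adj_commute[of "o' + q"] by auto
      qed
      also have "\<dots> = ?f" using bk by (simp add: forward_def max_def)
      finally show ?thesis using True by simp
    next
      case False
      then show ?thesis
        using eq[of ?k] rs mem[of r ?k] mem[of s ?k] fmem[of r] fmem[of s] bk
          adj_commute[of "o' + ?k" "o' + r"] adj_commute[of "o' + ?k" "o' + s"] by auto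
    qed
  qed
  moreover have "ok_skipped R ?f"
    using skip_rel(1)[OF R bk] unfolding ok_skipped_def by (auto simp: list_all_iff)
  moreover have "ok_nested1 R ?f"
    unfolding ok_nested1_def list_all_iff
  proof (intro ballI)
    fix P s r assume P: "P \<in> set R" and s: "s \<in> set P" and r: "r \<in> set ?f"
    obtain p where p: "p < ?k" "P = R ! p" using P by (auto simp: in_set_conv_nth)
    show "s \<le> r \<or> r \<in> set P \<or> s \<in> set ?f"
      using nested1[of "o' + p" "o' + ?k" "o' + r" "o' + s"] s r p mem[of p] fmem bk by auto
  qed
  moreover have "ok_nested2 b R ?f"
    unfolding ok_nested2_def Let_def list_all_iff
  proof (intro ballI)
    fix q assume q: "q \<in> set [b..<?k]"
    have main: "q \<in> set (R ! p) \<or> s \<le> ?k \<or> s \<in> set ?f" if kq: "?k \<in> set (R ! q)" and p: "p < q" and s: "s \<in> set (R ! p)" for p s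
      using nested2[of "o' + p" "o' + q" "o' + ?k" "o' + s"] q kq p s mem[of q] mem[of p] fmem[of s] by auto
    show "?k \<notin> set (R ! q) \<or> (\<forall>p\<in>set [0..<q]. q \<in> set (R ! p) \<or> (\<forall>s\<in>set (R ! p). s \<le> ?k \<or> s \<in> set ?f))"
    proof (cases "?k \<in> set (R ! q)")
      case True
      have "q \<in> set (R ! p) \<or> (\<forall>s\<in>set (R ! p). s \<le> ?k \<or> s \<in> set ?f)" if "p \<in> set [0..<q]" for p
      proof -
        have "p < q" using that by simp
        then show ?thesis using main[OF True] by blast
      qed
      then show ?thesis by blast
    qed simp
  qed
  moreover have "ok_crossing b R ?f"
    unfolding ok_crossing_def Let_def list_all_iff list_ex_iff
  proof (intro ballI)
    fix q p assume q: "q \<in> set [b..<?k]" and p: "p \<in> set [0..<q]"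
    have qk: "q < ?k" "b \<le> q" "p < q" "p < ?k" using q p by auto
    have "s \<le> ?k \<or> s \<in> set ?f \<or> \<not> (s \<in> set (R ! p) \<or> ?k \<in> set (R ! q) \<or>
        (\<exists>x\<in>set (R ! p @ R ! q). x < ?k \<and> (?k \<in> set (R ! x) \<or> s \<in> set (R ! x))))"
      if kp: "?k \<in> set (R ! p)" and nq: "q \<notin> set (R ! p)" and s: "s \<in> set (R ! q)" for s
    proof (rule ccontr)
      assume no: "\<not> ?thesis"
      have F: "F (o' + p) (o' + ?k)" "F (o' + q) (o' + s)" "\<not> F (o' + p) (o' + q)" "\<not> F (o' + ?k) (o' + s)"
        using kp s nq no qk mem[of p] mem[of q] fmem[of s] by auto
      obtain S where S: "cut2 {..<n} F S (o' + p) (o' + ?k) (o' + q) (o' + s)"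
        using crossing[of "o' + p" "o' + q" "o' + ?k" "o' + s"] F no qk by auto
      have Sm: "o' + p \<in> S" "o' + q \<in> S" "o' + ?k \<notin> S" "o' + s \<notin> S" using S by (simp_all add: cut2_def)
      note lv = cut2_leave[OF S]
      have "\<not> F (o' + p) (o' + s)" "\<not> F (o' + q) (o' + ?k)"
        using lv[of "o' + p" "o' + s"] lv[of "o' + q" "o' + ?k"] Sm no qk by auto
      then obtain x where x: "x \<in> set (R ! p) \<or> x \<in> set (R ! q)" "x < ?k" "?k \<in> set (R ! x) \<or> s \<in> set (R ! x)"
        using no qk mem[of p] mem[of q] by auto
      have "x \<noteq> p" "x \<noteq> q" using x(1) nq qk mem[of p x] mem[of q x] by auto
      then have "o' + x \<notin> S"
        using x lv[of "o' + x" "o' + ?k"] lv[of "o' + x" "o' + s"] mem[of x] Sm no by auto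
      moreover have "F (o' + p) (o' + x) \<or> F (o' + q) (o' + x)" using x(1) qk mem[of p x] mem[of q x] by auto
      ultimately show False using lv[of "o' + p" "o' + x"] lv[of "o' + q" "o' + x"] Sm x(2) no by auto
    qed
    then show "?k \<notin> set (R ! p) \<or> q \<in> set (R ! p) \<or> (\<forall>s\<in>set (R ! q). s \<le> ?k \<or> s \<in> set ?f \<or>
       \<not> (s \<in> set (R ! p) \<or> ?k \<in> set (R ! q) \<or> (\<exists>x\<in>set (R ! p @ R ! q). x < ?k \<and> (?k \<in> set (R ! x) \<or> s \<in> set (R ! x)))))"
      by blast
  qed
  ultimately show ?thesis by (simp add: ok_row_def)
qed

text \<open>The proof follows the branch of the true rows. The last hypothesis guarantees that the
  next offset is a vertex of the graph, so that its degree is 4; it persists as long as the state is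
  not final.\<close>

lemma explore_sound:
  assumes "consistent b o' R" "b \<le> length R" "twins_ok (length R) eqs"
    and "\<And>i j. i < length R \<Longrightarrow> j \<in> set (R ! i) \<Longrightarrow> j < t"
    and "\<exists>v\<in>set (concat R). length R \<le> v"
  shows "\<exists>R'\<in>set (explore b f R eqs t). consistent b o' R'"
  using assms
proof (induction f arbitrary: R eqs t)
  case (Suc f)
  note R = Suc.prems(1) and bk = Suc.prems(2)
  let ?k = "length R"
  define ns where "ns = forward b o' ?k"
  obtain v l where "?k \<le> v" "v \<in> set l" "l \<in> set R" using Suc.prems(5) by auto
  then obtain i where v: "?k \<le> v" "v \<in> set (R ! i)" "i < ?k" by (metis in_set_conv_nth)
  have "v < t" using Suc.prems(4) v by blast
  have "o' + v < n" using v consistent_mem[OF R] adj_less(2) by blast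
  then have ns: "ns \<in> set (filter (ok_row b R eqs) (next_rows R t))"
  proof -
    have "forward b o' ?k \<in> set (next_rows R t)"
      by (rule forward_in_next_rows[OF R bk Suc.prems(4)]) (use v(1) \<open>v < t\<close> \<open>o' + v < n\<close> in auto)
    then show ?thesis using forward_ok[OF R bk Suc.prems(3)] by (simp add: ns_def)
  qed
  define R' where "R' = R @ [ns]"
  have R': "consistent b o' R'" using R by (auto simp: consistent_def R'_def ns_def nth_append less_Suc_eq)
  show ?case
  proof (cases "final R'")
    case True
    then have "R' \<in> set (explore b (Suc f) R eqs t)" using ns by (auto simp: R'_def Let_def)
    then show ?thesis using R' by blast
  next
    case False
    let ?t = "max t (Suc (foldr max ns 0))"
    have tw: "twins_ok (length R') (new_twins R ns @ eqs)"
      using Suc.prems(3) skip_rel[OF R bk] unfolding twins_ok_def new_twins_def R'_def ns_def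
      by (fastforce simp del: set_concat)
    have bd: "j < ?t" if "i < length R'" "j \<in> set (R' ! i)" for i j
      using that Suc.prems(4)[of i j] le_foldr_max[of j ns]
      by (auto simp: R'_def nth_append less_Suc_eq split: if_splits)
    have cr: "\<exists>v\<in>set (concat R'). length R' \<le> v"
    proof (rule ccontr)
      assume "\<not> ?thesis"
      then have "filter (\<lambda>v. length R' \<le> v) (concat R') = []" by (auto simp: filter_empty_conv)
      then show False using False by (simp add: final_def)
    qed
    have "b \<le> length R'" using bk by (simp add: R'_def)
    then have "\<exists>R''\<in>set (explore b f R' (new_twins R ns @ eqs) ?t). consistent b o' R''"
      using tw bd cr by (intro Suc.IH[OF R'])
    then obtain R'' where "R'' \<in> set (explore b f R' (new_twins R ns @ eqs) ?t)" "consistent b o' R''" by blast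
    moreover from this(1) have "R'' \<in> set (explore b (Suc f) R eqs t)"
      using ns False by (auto simp: R'_def Let_def)
    ultimately show ?thesis by blast
  qed
qed auto

end

end

section \<open>Isomorphisms of pieces\<close>

definition wf_piece :: "'a piece \<Rightarrow> bool" where
  "wf_piece P \<longleftrightarrow> parcs (body P) \<subseteq> pverts (body P) \<times> pverts (body P) \<and>
     lports P \<subseteq> pverts (body P) \<and> rports P \<subseteq> pverts (body P)"

text \<open>An isomorphism given by its vertex map alone: as head and tail are projections, the arc
  map is forced.\<close>

definition piece_map :: "('a \<Rightarrow> 'b) \<Rightarrow> 'a piece \<Rightarrow> 'b piece \<Rightarrow> bool" where
  "piece_map g P Q \<longleftrightarrow> inj_on g (pverts (body P)) \<and> pverts (body Q) = g ` pverts (body P) \<and>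
     parcs (body Q) = map_prod g g ` parcs (body P) \<and> lports Q = g ` lports P \<and> rports Q = g ` rports P"

lemma piece_iso_of_map:
  assumes wf: "wf_piece P" and g: "piece_map g P Q"
  shows "piece_iso P Q"
proof -
  let ?h = "\<lparr>iso_verts = g, iso_arcs = map_prod g g, iso_head = snd, iso_tail = fst\<rparr>"
  have "wf_digraph (with_proj (body P))"
    using wf by unfold_locales (auto simp: wf_piece_def)
  moreover have "inj_on (map_prod g g) (parcs (body P))"
    using inj_on_subset[OF map_prod_inj_on[of g "pverts (body P)" g "pverts (body P)"]] g wf
    by (simp add: piece_map_def wf_piece_def)
  ultimately have "pre_digraph.digraph_isomorphism (with_proj (body P)) ?h"
    using g by (auto simp: pre_digraph.digraph_isomorphism_def piece_map_def)
  moreover have "with_proj (body Q) = app_iso ?h (with_proj (body P))"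
    using g by (simp add: app_iso_def piece_map_def with_proj_def)
  ultimately show ?thesis using g unfolding piece_iso_def piece_map_def
    by (intro exI[of _ ?h]) simp
qed

lemma piece_isoE:
  assumes "piece_iso P Q"
  obtains g where "piece_map g P Q"
proof -
  obtain h where h: "pre_digraph.digraph_isomorphism (with_proj (body P)) h"
    "with_proj (body Q) = app_iso h (with_proj (body P))"
    "lports Q = iso_verts h ` lports P" "rports Q = iso_verts h ` rports P"
    using assms unfolding piece_iso_def by blast
  have eqs: "pverts (body Q) = iso_verts h ` pverts (body P)" "parcs (body Q) = iso_arcs h ` parcs (body P)"
    "fst = iso_tail h" "snd = iso_head h"
    using arg_cong[OF h(2), of verts] arg_cong[OF h(2), of arcs] arg_cong[OF h(2), of tail]
      arg_cong[OF h(2), of head] by simp_all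
  have "iso_arcs h a = map_prod (iso_verts h) (iso_verts h) a" if "a \<in> parcs (body P)" for a
  proof -
    have "iso_verts h (fst a) = iso_tail h (iso_arcs h a)" "iso_verts h (snd a) = iso_head h (iso_arcs h a)"
      using h(1) that by (auto simp: pre_digraph.digraph_isomorphism_def)
    then have "fst (iso_arcs h a) = iso_verts h (fst a)" "snd (iso_arcs h a) = iso_verts h (snd a)"
      unfolding eqs(3,4)[symmetric] by simp_all
    then show ?thesis by (metis fst_map_prod snd_map_prod prod_eq_iff)
  qed
  then have "piece_map (iso_verts h) P Q"
    using h eqs by (auto simp: piece_map_def pre_digraph.digraph_isomorphism_def intro!: image_cong)
  then show thesis by (rule that)
qed

lemma piece_map_comp:
  assumes "piece_map g P Q" "piece_map h Q T"
  shows "piece_map (h \<circ> g) P T"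
  using assms by (auto simp: piece_map_def comp_inj_on image_comp map_prod.comp)

lemma piece_map_inv:
  assumes wf: "wf_piece P" and g: "piece_map g P Q"
  shows "piece_map (inv_into (pverts (body P)) g) Q P"
proof -
  let ?h = "inv_into (pverts (body P)) g"
  have inv: "?h (g u) = u" if "u \<in> pverts (body P)" for u
    using g that by (auto simp: piece_map_def)
  have im: "?h ` g ` A = A" if "A \<subseteq> pverts (body P)" for A
    using inv that by (force simp: image_image)
  have "map_prod ?h ?h ` map_prod g g ` parcs (body P) = parcs (body P)"
  proof -
    have "map_prod ?h ?h (map_prod g g a) = a" if "a \<in> parcs (body P)" for a
      using wf that inv by (cases a) (auto simp: wf_piece_def)
    then show ?thesis by (force simp: image_image)
  qed
  then show ?thesis
    using g wf im by (auto simp: piece_map_def wf_piece_def inj_on_inv_into)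
qed

lemma wf_piece_map:
  assumes "wf_piece P" "piece_map g P Q"
  shows "wf_piece Q"
  using assms by (auto simp: piece_map_def wf_piece_def)

lemma piece_iso_trans:
  assumes "wf_piece P" "piece_map g P Q" "piece_iso Q T"
  shows "piece_iso P T"
  using assms piece_iso_of_map piece_map_comp piece_isoE by metis

lemma piece_iso_of_inverse_map:
  assumes "wf_piece Q" "piece_map g Q P"
  shows "piece_iso P Q"
  using piece_iso_of_map[OF wf_piece_map[OF assms] piece_map_inv[OF assms]] .

lemma long_block_trans:
  assumes "wf_piece P" "piece_map g P Q" "long_block S T Q"
  shows "long_block S T P"
  using assms piece_iso_trans unfolding long_block_def by metis

lemma left_end_type_trans:
  assumes "wf_piece P" "piece_map g P Q" "left_end_type Q"
  shows "left_end_type P"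
  using assms piece_iso_trans[OF assms(1,2)] long_block_trans[OF assms(1,2)]
  unfolding left_end_type_def long_end_block_def by blast

lemma middle_type_trans:
  assumes "wf_piece P" "piece_map g P Q" "middle_type Q"
  shows "middle_type P"
  using assms piece_iso_trans[OF assms(1,2)] long_block_trans[OF assms(1,2)]
  unfolding middle_type_def long_middle_block_def by blast

section \<open>Joining bricks one at a time\<close>

lemma join_bricks_single: "piece_map (Pair 0) B (join_bricks [B] m)"
  by (auto simp: piece_map_def join_bricks_def link_arcs_def inj_on_def)

lemma join_bricks_snoc:
  assumes ne: "Bs \<noteq> []" and m': "m' = m(length Bs - 1 := m0)"
  defines "L \<equiv> {((length Bs - 1, p), (length Bs, m0 p)) | p. p \<in> rports (last Bs)}"
  shows "pverts (body (join_bricks (Bs @ [B]) m')) = pverts (body (join_bricks Bs m)) \<union> Pair (length Bs) ` pverts (body B)"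
    and "parcs (body (join_bricks (Bs @ [B]) m')) = parcs (body (join_bricks Bs m))
      \<union> map_prod (Pair (length Bs)) (Pair (length Bs)) ` parcs (body B) \<union> L \<union> L\<inverse>"
    and "lports (join_bricks (Bs @ [B]) m') = lports (join_bricks Bs m)"
    and "rports (join_bricks (Bs @ [B]) m') = Pair (length Bs) ` rports B"
proof -
  have last: "Bs ! (length Bs - 1) = last Bs" using ne by (simp add: last_conv_nth)
  have "link_arcs (Bs @ [B]) m' = link_arcs Bs m \<union> L"
  proof (intro equalityI subsetI)
    fix a assume "a \<in> link_arcs (Bs @ [B]) m'"
    then obtain i p where a: "a = ((i, p), (Suc i, m' i p))" "Suc i < Suc (length Bs)" "p \<in> rports ((Bs @ [B]) ! i)"
      by (auto simp: link_arcs_def)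
    show "a \<in> link_arcs Bs m \<union> L"
    proof (cases "Suc i < length Bs")
      case True
      then have "a \<in> link_arcs Bs m" using a by (auto simp: link_arcs_def m' nth_append)
      then show ?thesis by simp
    next
      case False
      then have "i = length Bs - 1" "Suc i = length Bs" using a(2) ne by auto
      then have "a \<in> L" using a ne last by (auto simp: L_def m' nth_append)
      then show ?thesis by simp
    qed
  next
    fix a assume "a \<in> link_arcs Bs m \<union> L"
    then show "a \<in> link_arcs (Bs @ [B]) m'"
    proof
      assume "a \<in> link_arcs Bs m"
      then obtain i p where a: "a = ((i, p), (Suc i, m i p))" "Suc i < length Bs" "p \<in> rports (Bs ! i)"
        by (auto simp: link_arcs_def)
      then have "m' i = m i" by (auto simp: m')
      then show ?thesis using a by (auto simp: link_arcs_def nth_append)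
    next
      assume "a \<in> L"
      then obtain p where p: "a = ((length Bs - 1, p), (length Bs, m0 p))" "p \<in> rports (last Bs)" by (auto simp: L_def)
      have "a = ((length Bs - 1, p), (Suc (length Bs - 1), m' (length Bs - 1) p))"
        using p ne by (simp add: m')
      moreover have "p \<in> rports ((Bs @ [B]) ! (length Bs - 1))" using p ne last by (simp add: nth_append)
      moreover have "Suc (length Bs - 1) < length (Bs @ [B])" using ne by simp
      ultimately show ?thesis unfolding link_arcs_def by blast
    qed
  qed
  then show "parcs (body (join_bricks (Bs @ [B]) m')) = parcs (body (join_bricks Bs m))
      \<union> map_prod (Pair (length Bs)) (Pair (length Bs)) ` parcs (body B) \<union> L \<union> L\<inverse>"
    by (auto simp: join_bricks_def nth_append less_Suc_eq)
  show "pverts (body (join_bricks (Bs @ [B]) m')) = pverts (body (join_bricks Bs m)) \<union> Pair (length Bs) ` pverts (body B)"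
    by (auto simp: join_bricks_def nth_append less_Suc_eq)
  show "lports (join_bricks (Bs @ [B]) m') = lports (join_bricks Bs m)"
    "rports (join_bricks (Bs @ [B]) m') = Pair (length Bs) ` rports B"
    using ne by (simp_all add: join_bricks_def)
qed

lemma wf_join_bricks:
  assumes wf: "\<And>B. B \<in> set Bs \<Longrightarrow> wf_piece B" and ne: "Bs \<noteq> []" and m: "port_matching Bs m"
  shows "wf_piece (join_bricks Bs m)"
proof -
  have wfn: "wf_piece (Bs ! i)" if "i < length Bs" for i using wf that by simp
  have wfa: "u \<in> pverts (body (Bs ! i)) \<and> w \<in> pverts (body (Bs ! i))"
    if "i < length Bs" "(u, w) \<in> parcs (body (Bs ! i))" for i u w
    using wfn[OF that(1)] that(2) by (auto simp: wf_piece_def)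
  have "link_arcs Bs m \<subseteq> pverts (body (join_bricks Bs m)) \<times> pverts (body (join_bricks Bs m))"
  proof
    fix a assume "a \<in> link_arcs Bs m"
    then obtain i p where a: "a = ((i, p), (Suc i, m i p))" "Suc i < length Bs" "p \<in> rports (Bs ! i)"
      by (auto simp: link_arcs_def)
    then have "m i p \<in> lports (Bs ! Suc i)" using m by (auto simp: port_matching_def dest: bij_betwE)
    then show "a \<in> pverts (body (join_bricks Bs m)) \<times> pverts (body (join_bricks Bs m))"
      using a wfn[of i] wfn[of "Suc i"] by (auto simp: join_bricks_def wf_piece_def)
  qed
  moreover have "{((i, u), (i, w)) | i u w. i < length Bs \<and> (u, w) \<in> parcs (body (Bs ! i))}
      \<subseteq> pverts (body (join_bricks Bs m)) \<times> pverts (body (join_bricks Bs m))"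
    using wfa by (auto simp: join_bricks_def)
  ultimately have "parcs (body (join_bricks Bs m)) \<subseteq> pverts (body (join_bricks Bs m)) \<times> pverts (body (join_bricks Bs m))"
    by (auto simp: join_bricks_def)
  moreover have "wf_piece (hd Bs)" "wf_piece (last Bs)" using ne wf by auto
  then have "Pair 0 ` lports (hd Bs) \<subseteq> pverts (body (join_bricks Bs m))"
    "Pair (length Bs - 1) ` rports (last Bs) \<subseteq> pverts (body (join_bricks Bs m))"
    using ne by (auto simp: wf_piece_def join_bricks_def hd_conv_nth last_conv_nth)
  ultimately show ?thesis by (simp add: wf_piece_def join_bricks_def)
qed

definition segment :: "(nat \<Rightarrow> nat \<Rightarrow> bool) \<Rightarrow> nat set \<Rightarrow> nat set \<Rightarrow> nat set \<Rightarrow> nat piece" where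
  "segment F A L R = \<lparr>body = \<lparr>pverts = A, parcs = {(i, j). i \<in> A \<and> j \<in> A \<and> F i j}\<rparr>, lports = L, rports = R\<rparr>"

lemma segment_simps [simp]:
  "pverts (body (segment F A L R)) = A" "parcs (body (segment F A L R)) = {(i, j). i \<in> A \<and> j \<in> A \<and> F i j}"
  "lports (segment F A L R) = L" "rports (segment F A L R) = R"
  by (simp_all add: segment_def)

lemma append_brick:
  assumes f: "piece_map f (join_bricks Bs m) (segment F {v..<p + 2} L {p, p + 1})"
    and m: "port_matching Bs m" and ne: "Bs \<noteq> []" and wf: "\<And>B. B \<in> set Bs \<Longrightarrow> wf_piece B"
    and g: "piece_map g B (segment F {p + 2..<k} {p + 2, p + 3} R)" and wfB: "wf_piece B"
    and sym: "\<And>i j. F i j \<Longrightarrow> F j i" and vp: "v \<le> p" and k: "p + 4 \<le> k"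
    and cross: "\<And>i j. i < p + 2 \<Longrightarrow> p + 2 \<le> j \<Longrightarrow> F i j \<longleftrightarrow> i = p \<and> j = p + 2 \<or> i = p + 1 \<and> j = p + 3"
  obtains m' f' where "port_matching (Bs @ [B]) m'"
    "piece_map f' (join_bricks (Bs @ [B]) m') (segment F {v..<k} L R)"
proof -
  define l where "l = length Bs"
  \<comment> \<open>The matching is read off from the graph: the crossing edges lead from
    \<open>p\<close> to \<open>p + 2\<close> and from \<open>p + 1\<close> to \<open>p + 3\<close>,
    hence the shift by 2.\<close>
  define m0 where "m0 q = inv_into (lports B) g (f (l - 1, q) + 2)" for q
  define m' where "m' = m(l - 1 := m0)"
  define f' where "f' = (\<lambda>(i, u). if i < l then f (i, u) else g u)"
  let ?J = "join_bricks Bs m" and ?J' = "join_bricks (Bs @ [B]) m'"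
  have l: "0 < l" using ne by (simp add: l_def)
  have wfJ: "wf_piece ?J" by (rule wf_join_bricks[OF wf ne m])
  note snoc = join_bricks_snoc[OF ne m'_def[unfolded l_def], of B, folded l_def]
  have Jfst: "fst a < l" if "a \<in> pverts (body ?J)" for a using that by (auto simp: join_bricks_def l_def)
  have finj: "inj_on f (pverts (body ?J))" and fverts: "f ` pverts (body ?J) = {v..<p + 2}"
    and farcs: "map_prod f f ` parcs (body ?J) = {(i, j). i \<in> {v..<p + 2} \<and> j \<in> {v..<p + 2} \<and> F i j}"
    and fl: "f ` lports ?J = L" and fr: "f ` rports ?J = {p, p + 1}"
    using f unfolding piece_map_def segment_simps by (blast, metis, metis, metis, metis)
  have ginj: "inj_on g (pverts (body B))" and gverts: "g ` pverts (body B) = {p + 2..<k}"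
    and garcs: "map_prod g g ` parcs (body B) = {(i, j). i \<in> {p + 2..<k} \<and> j \<in> {p + 2..<k} \<and> F i j}"
    and gl: "g ` lports B = {p + 2, p + 3}" and gr: "g ` rports B = R"
    using g unfolding piece_map_def segment_simps by (blast, metis, metis, metis, metis)
  have rJ: "rports ?J = Pair (l - 1) ` rports (last Bs)" by (simp add: join_bricks_def l_def)
  have rsub: "Pair (l - 1) ` rports (last Bs) \<subseteq> pverts (body ?J)" using wfJ rJ by (simp add: wf_piece_def)
  have fbij: "bij_betw (\<lambda>q. f (l - 1, q)) (rports (last Bs)) {p, p + 1}"
    unfolding bij_betw_def
  proof
    show "inj_on (\<lambda>q. f (l - 1, q)) (rports (last Bs))"
      using inj_on_subset[OF finj rsub] by (auto simp: inj_on_def)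
    show "(\<lambda>q. f (l - 1, q)) ` rports (last Bs) = {p, p + 1}" using fr rJ by (simp add: image_image)
  qed
  have glbij: "bij_betw g (lports B) {p + 2, p + 3}"
    using ginj wfB gl by (auto simp: bij_betw_def wf_piece_def intro: inj_on_subset)
  have "bij_betw (\<lambda>i. i + 2) {p, p + 1} {p + 2, p + 3}" by (auto simp: bij_betw_def inj_on_def)
  from bij_betw_trans[OF bij_betw_trans[OF fbij this] bij_betw_inv_into[OF glbij]]
  have m0: "bij_betw m0 (rports (last Bs)) (lports B)" by (simp add: m0_def[abs_def] o_def)
  have gm0: "g (m0 q) = f (l - 1, q) + 2" if "q \<in> rports (last Bs)" for q
    unfolding m0_def using fbij that gl by (intro f_inv_into_f) (auto dest: bij_betwE)
  have "port_matching (Bs @ [B]) m'"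
    unfolding port_matching_def
  proof (intro allI impI)
    fix i assume i: "Suc i < length (Bs @ [B])"
    show "bij_betw (m' i) (rports ((Bs @ [B]) ! i)) (lports ((Bs @ [B]) ! Suc i))"
    proof (cases "Suc i < l")
      case True
      then have "m' i = m i" by (auto simp: m'_def)
      then show ?thesis using m True by (simp add: port_matching_def l_def nth_append)
    next
      case False
      then have "i = l - 1" "Suc i = l" using i by (auto simp: l_def)
      then show ?thesis using m0 ne by (simp add: m'_def nth_append l_def last_conv_nth)
    qed
  qed
  moreover have "piece_map f' ?J' (segment F {v..<k} L R)"
  proof -
    have f'J: "f' a = f a" if "a \<in> pverts (body ?J)" for a
      using Jfst[OF that] by (cases a) (simp add: f'_def)
    have f'B: "f' (l, u) = g u" for u by (simp add: f'_def)
    have imJ: "f' ` A = f ` A" if "A \<subseteq> pverts (body ?J)" for A using f'J that by (intro image_cong) auto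
    have "inj_on f' (pverts (body ?J) \<union> Pair l ` pverts (body B))"
      unfolding inj_on_Un
    proof (intro conjI)
      show "inj_on f' (pverts (body ?J))" using finj f'J by (simp add: inj_on_def)
      show "inj_on f' (Pair l ` pverts (body B))" using ginj by (auto simp: inj_on_def f'B)
      have "f' ` pverts (body ?J) = {v..<p + 2}" "f' ` Pair l ` pverts (body B) = {p + 2..<k}"
        using imJ[of "pverts (body ?J)"] fverts gverts by (simp_all add: image_image f'B)
      then have "f' ` (pverts (body ?J) - Pair l ` pverts (body B)) \<subseteq> {v..<p + 2}"
        "f' ` (Pair l ` pverts (body B) - pverts (body ?J)) \<subseteq> {p + 2..<k}" by blast+
      from Int_mono[OF this] have "f' ` (pverts (body ?J) - Pair l ` pverts (body B)) \<inter>
        f' ` (Pair l ` pverts (body B) - pverts (body ?J)) \<subseteq> {v..<p + 2} \<inter> {p + 2..<k}" .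
      then show "f' ` (pverts (body ?J) - Pair l ` pverts (body B)) \<inter> f' ` (Pair l ` pverts (body B) - pverts (body ?J)) = {}"
        by simp
    qed
    moreover have "f' ` (pverts (body ?J) \<union> Pair l ` pverts (body B)) = {v..<k}"
      unfolding image_Un imJ[OF subset_refl] fverts image_image f'B gverts using vp k by auto
    moreover have "map_prod f' f' ` parcs (body ?J') = {(i, j). i \<in> {v..<k} \<and> j \<in> {v..<k} \<and> F i j}"
    proof -
      let ?L = "{((l - 1, q), (l, m0 q)) | q. q \<in> rports (last Bs)}"
      have "map_prod f' f' ` parcs (body ?J) = map_prod f f ` parcs (body ?J)"
        using wfJ f'J by (intro image_cong) (auto simp: wf_piece_def)
      moreover have "map_prod f' f' ` map_prod (Pair l) (Pair l) ` parcs (body B) = map_prod g g ` parcs (body B)"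
        by (auto simp: image_image f'B map_prod_def split_def)
      moreover have "map_prod f' f' ` ?L = {(p, p + 2), (p + 1, p + 3)}"
      proof -
        have L: "?L = (\<lambda>q. ((l - 1, q), (l, m0 q))) ` rports (last Bs)" by blast
        have "map_prod f' f' ` ?L = (\<lambda>q. (f (l - 1, q), f (l - 1, q) + 2)) ` rports (last Bs)"
          unfolding L image_image by (rule image_cong[OF refl]) (use gm0 l in \<open>simp add: f'_def\<close>)
        also have "\<dots> = (\<lambda>i. (i, i + 2)) ` (\<lambda>q. f (l - 1, q)) ` rports (last Bs)" by (simp add: image_image)
        also have "(\<lambda>q. f (l - 1, q)) ` rports (last Bs) = {p, p + 1}" using fbij by (simp add: bij_betw_def)
        finally show ?thesis by (simp add: eval_nat_numeral)
      qed
      moreover have "map_prod f' f' ` ?L\<inverse> = (map_prod f' f' ` ?L)\<inverse>" by force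
      ultimately have "map_prod f' f' ` parcs (body ?J') =
        {(i, j). i \<in> {v..<p + 2} \<and> j \<in> {v..<p + 2} \<and> F i j} \<union> {(i, j). i \<in> {p + 2..<k} \<and> j \<in> {p + 2..<k} \<and> F i j}
        \<union> {(p, p + 2), (p + 1, p + 3)} \<union> {(p, p + 2), (p + 1, p + 3)}\<inverse>"
        unfolding snoc(2) image_Un by (simp only: farcs garcs)
      also have "\<dots> = {(i, j). i \<in> {v..<k} \<and> j \<in> {v..<k} \<and> F i j}" (is "?A = ?B")
      proof (rule Set.set_eqI, clarify)
        fix i j
        have "F i j \<longleftrightarrow> F j i" using sym by blast
        then show "(i, j) \<in> ?A \<longleftrightarrow> (i, j) \<in> ?B"
          using cross[of i j] cross[of j i] vp k by (cases "i < p + 2"; cases "j < p + 2") auto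
      qed
      finally show ?thesis .
    qed
    moreover have "f' ` lports ?J' = L"
      using imJ[of "lports ?J"] wfJ fl by (simp add: snoc(3) wf_piece_def)
    moreover have "f' ` rports ?J' = R" using gr by (simp add: snoc(4) image_image f'B)
    ultimately show ?thesis by (simp add: piece_map_def snoc(1))
  qed
  ultimately show thesis by (rule that)
qed

section \<open>The outcomes of the exploration\<close>

text \<open>
  An entry \<open>(R, Q, a)\<close> of the tables below consists of a final state of the exploration, the piece
  that it describes, and the offsets of the vertices of this piece.
\<close>

definition row_edges :: "nat \<Rightarrow> nat \<Rightarrow> nat list list \<Rightarrow> (nat \<times> nat) set" where
  "row_edges lo hi R = set (concat (map (\<lambda>i. map (Pair i) (filter (\<lambda>j. j < hi) (R ! i))) [lo..<length R]))"

definition layout :: "nat \<Rightarrow> nat \<Rightarrow> nat set \<Rightarrow> nat set \<Rightarrow> nat list list \<times> nat piece \<times> (nat \<Rightarrow> nat) \<Rightarrow> bool" where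
  "layout lo hi L P = (\<lambda>(R, Q, a). wf_piece Q \<and> inj_on a (pverts (body Q)) \<and> a ` pverts (body Q) = {lo..<hi} \<and>
     map_prod a a ` parcs (body Q) = row_edges lo hi R \<union> (row_edges lo hi R)\<inverse> \<and>
     a ` lports Q = L \<and> a ` rports Q = P)"

text \<open>Certifies that no cut vertex has been overlooked strictly inside the explored
  range.\<close>

definition jumps_all :: "nat \<Rightarrow> nat list list \<Rightarrow> bool" where
  "jumps_all m R \<longleftrightarrow> list_all (\<lambda>p. list_ex (\<lambda>i. list_ex (\<lambda>j. p < j) (R ! i)) [0..<p]) [1..<m]"

text \<open>That some edge reaches the last offset shows that all offsets below
  \<open>length R\<close> belong to vertices of the graph.\<close>

definition closes :: "nat list list \<Rightarrow> bool" where
  "closes R \<longleftrightarrow> list_all (list_all (\<lambda>j. j < length R)) R \<and> list_ex (\<lambda>ns. length R - 1 \<in> set ns) R \<and> jumps_all (length R - 1) R"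

text \<open>Offset \<open>length R\<close> is the cut vertex. It belongs to the piece but has no
  row, since the next exploration starts with it.\<close>

definition cuts :: "nat list list \<Rightarrow> bool" where
  "cuts R \<longleftrightarrow> list_all (list_all (\<lambda>j. j \<le> length R)) R \<and> backdeg R (length R) = 2 \<and> jumps_all (length R) R"

definition opens_ports :: "nat list list \<Rightarrow> bool" where
  "opens_ports R \<longleftrightarrow> (let k = length R in 2 < k \<and>
     list_all (\<lambda>i. list_all (\<lambda>j. j < k \<or> i = k - 2 \<and> j = k \<or> i = k - 1 \<and> j = k + 1) (R ! i)) [0..<k] \<and>
     k \<in> set (R ! (k - 2)) \<and> k + 1 \<in> set (R ! (k - 1)) \<and> jumps_all k R)"

definition plain :: "nat pair_pre_digraph \<Rightarrow> nat piece" where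
  "plain H = \<lparr>body = H, lports = {}, rports = {}\<rparr>"

text \<open>Two of the states describe \<open>graph_G8'\<close>; the second meets its vertices in an
  almost reversed order.\<close>

definition start_ends :: "(nat list list \<times> nat piece \<times> (nat \<Rightarrow> nat)) list" where
  "start_ends = [
    ([[1, 2, 3, 4], [2, 3, 4], [3, 4], [4], []], plain graph_G5, \<lambda>l. l - 1),
    ([[1, 2, 3, 4], [2, 3, 5], [4, 5], [4, 5], [5], []], plain graph_G6, \<lambda>l. l - 1),
    ([[1, 2, 3, 4], [2, 3, 4], [5, 6], [5, 6], [5, 6], [6], []], plain graph_G7, \<lambda>l. l - 1),
    ([[1, 2, 3, 4], [2, 3, 5], [3, 6], [7], [5, 6, 7], [6, 7], [7], []], plain graph_G8, \<lambda>l. l - 1),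
    ([[1, 2, 3, 4], [2, 3, 4], [5, 6], [5, 7], [6, 7], [6, 7], [7], []], plain graph_G8',
      \<lambda>l. if l = 7 then 7 else if l = 8 then 6 else l - 1),
    ([[1, 2, 3, 4], [2, 3, 5], [4, 5], [6, 7], [6, 7], [6, 7], [7], []], plain graph_G8',
      \<lambda>l. if l = 7 then 0 else if l = 8 then 1 else 8 - l),
    ([[1, 2, 3, 4], [2, 3, 4], [3, 5], [6], [7, 8], [6, 7, 8], [7, 8], [8], []], plain graph_G9, \<lambda>l. l - 1)]"

definition start_cuts :: "(nat list list \<times> nat piece \<times> (nat \<Rightarrow> nat)) list" where
  "start_cuts = [
    ([[1, 2, 3, 4], [2, 3, 4], [3, 4], [5], [5]], block_D4, \<lambda>l. l),
    ([[1, 2, 3, 4], [2, 3, 4], [3, 5], [5], [5, 6], [6]], block_D1, \<lambda>l. l - 1),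
    ([[1, 2, 3, 4], [2, 3, 4], [3, 5], [6], [5, 6], [6, 7], [7]], block_D2, \<lambda>l. l - 1),
    ([[1, 2, 3, 4], [2, 3, 4], [3, 5], [5], [6, 7], [6, 7], [7, 8], [8]], block_D3, \<lambda>l. l - 1)]"

definition start_ports :: "(nat list list \<times> nat piece \<times> (nat \<Rightarrow> nat)) list" where
  "start_ports = [
    ([[1, 2, 3, 4], [2, 3, 4], [3, 4], [5], [6]], delete_right block_D4, \<lambda>l. l),
    ([[1, 2, 3, 4], [2, 3, 4], [3, 5], [5], [6, 7], [6, 7], [7, 8], [9]], delete_right block_D3, \<lambda>l. l - 1)]"

text \<open>No pieces are attached, since the right end block is identified from the reversed
  numbering. What matters is only that no further cut vertex follows.\<close>

definition cut_ends :: "nat list list list" where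
  "cut_ends = [
    [[1, 2], [2, 3, 4], [3, 4], [5, 6], [7, 8], [6, 7, 8], [7, 8], [8], []],
    [[1, 2], [2, 3, 4], [3, 5], [6, 7], [5, 6, 7], [6, 7], [7], []],
    [[1, 2], [2, 3, 4], [5, 6], [4, 5, 6], [5, 6], [6], []],
    [[1, 2], [3, 4, 5], [3, 4, 5], [4, 5], [5], []]]"

definition cut_cuts :: "(nat list list \<times> nat piece \<times> (nat \<Rightarrow> nat)) list" where
  "cut_cuts = [
    ([[1, 2], [2, 3, 4], [3, 4], [4, 5], [5]], block_M1, \<lambda>l. l),
    ([[1, 2], [2, 3, 4], [3, 4], [5, 6], [5, 6], [6, 7], [7]], block_M2, \<lambda>l. l),
    ([[1, 2], [2, 3, 4], [3, 4], [5, 6], [5, 7], [6, 7], [7, 8], [8]], mirror block_M3, \<lambda>l. 8 - l),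
    ([[1, 2], [2, 3, 4], [3, 5], [4, 5], [5, 6], [6]], block_M, \<lambda>l. l),
    ([[1, 2], [2, 3, 4], [3, 5], [4, 5], [6, 7], [6, 7], [7, 8], [8]], block_M3, \<lambda>l. l)]"

definition cut_ports :: "(nat list list \<times> nat piece \<times> (nat \<Rightarrow> nat)) list" where
  "cut_ports = [
    ([[1, 2], [2, 3, 4], [3, 4], [4, 5], [6]], delete_right block_M1, \<lambda>l. l),
    ([[1, 2], [2, 3, 4], [3, 4], [5, 6], [5, 6], [6, 7], [8]], delete_right block_M2, \<lambda>l. l),
    ([[1, 2], [2, 3, 4], [3, 5], [4, 5], [6, 7], [6, 7], [7, 8], [9]], delete_right block_M3, \<lambda>l. l)]"

text \<open>Offsets 0 and 1 are the right ports of the previous brick, so the new brick starts at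
  offset 2. Here the piece is needed, as it closes a long complete block.\<close>

definition port_ends :: "(nat list list \<times> nat piece \<times> (nat \<Rightarrow> nat)) list" where
  "port_ends = [
    ([[2], [3], [3, 4, 5], [4, 5], [6, 7], [8, 9], [7, 8, 9], [8, 9], [9], []],
      mirror (delete_right block_D3), \<lambda>l. 10 - l),
    ([[2], [3], [4, 5, 6], [4, 5, 6], [5, 6], [6], []], mirror (delete_right block_D4), \<lambda>l. 6 - l)]"

definition port_cuts :: "(nat list list \<times> nat piece \<times> (nat \<Rightarrow> nat)) list" where
  "port_cuts = [
    ([[2], [3], [3, 4, 5], [4, 5], [5, 6], [6]], mirror (delete_right block_M1), \<lambda>l. 6 - l),
    ([[2], [3], [3, 4, 5], [4, 5], [6, 7], [6, 7], [7, 8], [8]], mirror (delete_right block_M2), \<lambda>l. 8 - l),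
    ([[2], [3], [3, 4, 5], [4, 5], [6, 7], [6, 8], [7, 8], [8, 9], [9]], mirror (delete_right block_M3), \<lambda>l. 9 - l)]"

definition port_ports :: "(nat list list \<times> nat piece \<times> (nat \<Rightarrow> nat)) list" where
  "port_ports = [
    ([[2], [3], [3, 4, 5], [4, 5], [5, 6], [7]], delete_left (delete_right block_M1), \<lambda>l. l + 1),
    ([[2], [3], [3, 4, 5], [4, 5], [6, 7], [6, 7], [7, 8], [9]], delete_left (delete_right block_M2), \<lambda>l. l + 1)]"

section \<open>Evaluation of the search and of the tables\<close>

text \<open>A branch that used up the fuel 12 would return 13 rows, or 14 when started at ports. No
  table contains a state with more than 10 rows, so the inclusion also shows that every branch ended
  in a final state.\<close>

lemma start_outcomes:
  "set (explore 1 12 [[1, 2, 3, 4]] [] 5) \<subseteq> set (map fst start_ends @ map fst start_cuts @ map fst start_ports)"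
  by code_simp

lemma cut_outcomes:
  "set (explore 1 12 [[1, 2]] [] 3) \<subseteq> set (cut_ends @ map fst cut_cuts @ map fst cut_ports)"
  by code_simp

lemma port_outcomes:
  "set (explore 2 12 [[2], [3]] [] 4) \<subseteq> set (map fst port_ends @ map fst port_cuts @ map fst port_ports)"
  by code_simp

lemma start_ends_layout:
  "list_all (\<lambda>X. layout 0 (length (fst X)) {} {} X \<and> closes (fst X) \<and> length (fst X) \<le> 9) start_ends"
  by code_simp

lemma start_cuts_layout: "list_all (\<lambda>X. layout 0 (Suc (length (fst X))) {} {length (fst X)} X \<and> cuts (fst X)) start_cuts"
  by code_simp

lemma start_ports_layout:
  "list_all (\<lambda>X. layout 0 (length (fst X)) {} {length (fst X) - 2, length (fst X) - 1} X \<and> opens_ports (fst X)) start_ports"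
  by code_simp

lemma cut_ends_close: "list_all closes cut_ends"
  by code_simp

lemma cut_cuts_layout: "list_all (\<lambda>X. layout 0 (Suc (length (fst X))) {0} {length (fst X)} X \<and> cuts (fst X)) cut_cuts"
  by code_simp

lemma cut_ports_layout:
  "list_all (\<lambda>X. layout 0 (length (fst X)) {0} {length (fst X) - 2, length (fst X) - 1} X \<and> opens_ports (fst X)) cut_ports"
  by code_simp

lemma port_ends_layout:
  "list_all (\<lambda>X. layout 2 (length (fst X)) {2, 3} {} X \<and> closes (fst X)) port_ends"
  by code_simp

lemma port_cuts_layout: "list_all (\<lambda>X. layout 2 (Suc (length (fst X))) {2, 3} {length (fst X)} X \<and> cuts (fst X)) port_cuts"
  by code_simp

lemma port_ports_layout:
  "list_all (\<lambda>X. layout 2 (length (fst X)) {2, 3} {length (fst X) - 2, length (fst X) - 1} X \<and> opens_ports (fst X)) port_ports"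
  by code_simp

lemma filter_eq_single: "a \<le> c \<Longrightarrow> c < m \<Longrightarrow> filter (\<lambda>j :: nat. j = c) [a..<m] = [c]"
proof (induction m)
  case (Suc m)
  show ?case
  proof (cases "c = m")
    case True
    then have "filter (\<lambda>j. j = c) [a..<m] = []" by (auto simp: filter_empty_conv)
    then show ?thesis using True Suc.prems by simp
  qed (use Suc in simp)
qed simp

section \<open>From final states back to the graph\<close>

context ordered_quartic
begin

definition jumped :: "nat \<Rightarrow> bool" where
  "jumped w \<longleftrightarrow> (\<exists>p<w. \<exists>s>w. F p s)"

text \<open>The bounds exclude the first and the last position, which no edge can pass
  either.\<close>

definition cutpos :: "nat \<Rightarrow> bool" where
  "cutpos w \<longleftrightarrow> 0 < w \<and> Suc w < n \<and> \<not> jumped w"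

definition port_state :: "nat \<Rightarrow> bool" where
  "port_state p \<longleftrightarrow> (\<forall>i j. i < p + 2 \<longrightarrow> p + 2 \<le> j \<longrightarrow> (F i j \<longleftrightarrow> i = p \<and> j = p + 2 \<or> i = p + 1 \<and> j = p + 3))"

text \<open>All edges leaving \<open>{..w}\<close> start at \<open>w\<close>, so their number is
  even. By connectedness \<open>w\<close> has neighbours on both sides, which excludes 0 and
  4.\<close>

lemma card_forward_cutpos:
  assumes w: "cutpos w"
  shows "card {j. w < j \<and> F w j} = 2"
proof -
  have wn: "w < n" "Suc w < n" "0 < w" and nj: "\<not> jumped w" using w by (auto simp: cutpos_def)
  have nojump: "\<not> F p s" if "p < w" "w < s" for p s using nj that by (auto simp: jumped_def)
  let ?A = "{j. w < j \<and> F w j}" and ?B = "{j. j < w \<and> F w j}"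
  have fin: "finite ?A" "finite ?B" by (rule finite_subset[OF _ finite_neighbours[of w]], blast)+
  have "w < x \<or> x < w" if "F w x" for x using adj_irrefl[OF that] by linarith
  then have "{j. F w j} = ?A \<union> ?B" by blast
  moreover have "?A \<inter> ?B = {}" by auto
  ultimately have sum: "card ?A + card ?B = 4" using degree_4[of w, unfolded lessThan_iff, OF wn(1)] card_Un_disjoint[OF fin] by metis
  have "{(u, v). u \<in> {..w} \<and> v \<notin> {..w} \<and> F u v} = Pair w ` ?A"
    using nojump by (auto simp: le_less)
  then have "even (card ?A)"
    using even_boundary[of "{..w}"] wn by (simp add: card_image inj_on_def subset_iff)
  moreover have "?A \<noteq> {}"
  proof
    assume e: "?A = {}"
    have "{..w} = {..<n}"
    proof (rule closed_set)
      fix u v assume uv: "u \<in> {..w}" "F u v"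
      have "\<not> w < v" using nojump[of u v] e uv by (cases "u = w") auto
      then show "v \<in> {..w}" by simp
    qed (use wn in auto)
    then have "Suc w \<in> {..w}" using wn by simp
    then show False by simp
  qed
  moreover have "?B \<noteq> {}"
  proof
    assume e: "?B = {}"
    have "{..<w} = {..<n}"
    proof (rule closed_set)
      fix u v assume uv: "u \<in> {..<w}" "F u v"
      have "v \<noteq> w" using e adj_sym[OF uv(2)] uv(1) by auto
      moreover have "\<not> w < v" using nojump[of u v] uv by auto
      ultimately show "v \<in> {..<w}" by simp
    qed (use wn in auto)
    then have "w \<in> {..<w}" using wn by simp
    then show False by simp
  qed
  then have "0 < card ?A" "0 < card ?B" using fin \<open>?A \<noteq> {}\<close> by (simp_all add: card_gt_0_iff)
  then have "card ?A \<in> {1, 2, 3}" using sum by auto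
  then show ?thesis using \<open>even (card ?A)\<close> by auto
qed

text \<open>As no edge passes \<open>o'\<close>, later vertices have no neighbours before it, and
  \<open>skip\<close> rules out gaps.\<close>

lemma forward_initial:
  assumes before: "\<And>i j. i < o' \<Longrightarrow> o' < j \<Longrightarrow> \<not> F i j"
  shows "forward 1 o' 0 = [1..<Suc (card {j. o' < j \<and> F o' j})]"
proof -
  let ?P = "\<lambda>j. F (o' + 0) (o' + j)"
  have "filter ?P [1..<n] = [1..<1 + length (filter ?P [1..<n])]"
  proof (rule filter_down_closed)
    fix r s :: nat assume rs: "1 \<le> r" "r < s" "?P s"
    show "?P r"
    proof (rule ccontr)
      assume "\<not> ?P r"
      then have "card {x. x < o' \<and> F x (o' + s)} < card {x. x < o' \<and> F x (o' + r)}"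
        using skip(1)[of o' "o' + r" "o' + s"] rs by simp
      moreover have "{x. x < o' \<and> F x (o' + r)} = {}" using before[of _ "o' + r"] rs by auto
      ultimately show False by simp
    qed
  qed
  moreover have "length (filter ?P [1..<n]) = card {j. o' < j \<and> F o' j}"
  proof -
    have "length (filter ?P [1..<n]) = card (set (filter ?P [1..<n]))" by (rule distinct_card[symmetric]) simp
    also have "set (filter ?P [1..<n]) = {j. 0 < j \<and> F o' (o' + j)}" using adj_less(2) by fastforce
    also have "card \<dots> = card ((+) o' ` {j. 0 < j \<and> F o' (o' + j)})" by (simp add: card_image)
    also have "(+) o' ` {j. 0 < j \<and> F o' (o' + j)} = {j. o' < j \<and> F o' j}"
    proof (intro equalityI subsetI)
      fix j assume "j \<in> {j. o' < j \<and> F o' j}"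
      then show "j \<in> (+) o' ` {j. 0 < j \<and> F o' (o' + j)}" by (intro image_eqI[of _ _ "j - o'"]) auto
    qed auto
    finally show ?thesis .
  qed
  ultimately have "filter ?P [1..<n] = [1..<Suc (card {j. o' < j \<and> F o' j})]" by (metis plus_1_eq_Suc)
  then show ?thesis unfolding forward_def by (simp del: upt_Suc)
qed

text \<open>With \<open>b \<le> Suc lo\<close> the rows from \<open>lo\<close> on record all forward
  neighbours. The range may exceed the rows by one vertex, because the last vertex has no forward
  edge within the range.\<close>

lemma piece_map_layout:
  assumes R: "consistent b o' R" and lay: "layout lo hi L P (R, Q, a)"
    and lo: "b \<le> Suc lo" and hi: "hi \<le> Suc (length R)"
  shows "piece_map (\<lambda>l. o' + a l) Q (segment F {o' + lo..<o' + hi} ((+) o' ` L) ((+) o' ` P))"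
proof -
  let ?E = "row_edges lo hi R"
  have E: "(i, j) \<in> ?E \<longleftrightarrow> lo \<le> i \<and> i < j \<and> j < hi \<and> F (o' + i) (o' + j)" for i j
  proof -
    have "(i, j) \<in> ?E \<longleftrightarrow> lo \<le> i \<and> i < length R \<and> j \<in> set (R ! i) \<and> j < hi"
      by (auto simp: row_edges_def)
    also have "\<dots> \<longleftrightarrow> lo \<le> i \<and> i < j \<and> j < hi \<and> F (o' + i) (o' + j)"
      using R set_forward[of b o' i] lo hi by (auto simp: consistent_def)
    finally show ?thesis .
  qed
  have Q: "inj_on a (pverts (body Q))" "a ` pverts (body Q) = {lo..<hi}"
    "map_prod a a ` parcs (body Q) = ?E \<union> ?E\<inverse>" "a ` lports Q = L" "a ` rports Q = P"
    using lay by (simp_all add: layout_def)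
  have "inj_on (\<lambda>l. o' + a l) (pverts (body Q))" using Q(1) by (simp add: inj_on_def)
  moreover have im: "(\<lambda>l. o' + a l) ` A = (+) o' ` a ` A" for A by (simp add: image_image)
  moreover have "(+) o' ` {lo..<hi} = {o' + lo..<o' + hi}" by (simp add: add.commute)
  moreover have "map_prod (\<lambda>l. o' + a l) (\<lambda>l. o' + a l) ` parcs (body Q)
      = {(i, j). i \<in> {o' + lo..<o' + hi} \<and> j \<in> {o' + lo..<o' + hi} \<and> F i j}"
  proof -
    have "map_prod (\<lambda>l. o' + a l) (\<lambda>l. o' + a l) ` parcs (body Q) = map_prod ((+) o') ((+) o') ` (?E \<union> ?E\<inverse>)"
      unfolding Q(3)[symmetric] by (simp add: image_image map_prod_def split_def)
    also have "\<dots> = {(i, j). i \<in> {o' + lo..<o' + hi} \<and> j \<in> {o' + lo..<o' + hi} \<and> F i j}"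
    proof (intro equalityI subsetI)
      fix z assume "z \<in> map_prod ((+) o') ((+) o') ` (?E \<union> ?E\<inverse>)"
      then obtain i j where "(i, j) \<in> ?E \<union> ?E\<inverse>" "z = (o' + i, o' + j)" by force
      then show "z \<in> {(i, j). i \<in> {o' + lo..<o' + hi} \<and> j \<in> {o' + lo..<o' + hi} \<and> F i j}"
        using E[of i j] E[of j i] adj_commute[of "o' + i" "o' + j"] by auto
    next
      fix z assume "z \<in> {(i, j). i \<in> {o' + lo..<o' + hi} \<and> j \<in> {o' + lo..<o' + hi} \<and> F i j}"
      then obtain x y where xy: "z = (x, y)" "x \<in> {o' + lo..<o' + hi}" "y \<in> {o' + lo..<o' + hi}" "F x y" by blast
      obtain i j where z: "z = (o' + i, o' + j)" "lo \<le> i" "i < hi" "lo \<le> j" "j < hi" "F (o' + i) (o' + j)"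
        by (rule that[of "x - o'" "y - o'"]) (use xy in auto)
      then have "i \<noteq> j" using adj_irrefl by blast
      then have "(i, j) \<in> ?E \<union> ?E\<inverse>"
        using E[of i j] E[of j i] z adj_commute[of "o' + i" "o' + j"] by auto
      then show "z \<in> map_prod ((+) o') ((+) o') ` (?E \<union> ?E\<inverse>)" using z(1) by force
    qed
    finally show ?thesis .
  qed
  ultimately show ?thesis using Q by (simp add: piece_map_def)
qed

context
  fixes b o' :: nat and R :: "nat list list"
  assumes b: "1 \<le> b" "b < length R" and before: "\<And>i j. i < o' \<Longrightarrow> o' + b \<le> j \<Longrightarrow> \<not> F i j"
    and R: "consistent b o' R"
begin

lemma mem_row: "i < length R \<Longrightarrow> j \<in> set (R ! i) \<longleftrightarrow> i < j \<and> b \<le> j \<and> F (o' + i) (o' + j)"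
  using R set_forward[of b o' i] by (simp add: consistent_def)

lemma crossing_row:
  assumes "F i j" "i < o' + length R" "o' + length R \<le> j"
  shows "o' \<le> i" "i - o' < length R" "j - o' \<in> set (R ! (i - o'))"
proof -
  show i: "o' \<le> i" using before[of i j] assms b by force
  show k: "i - o' < length R" using assms i by auto
  show "j - o' \<in> set (R ! (i - o'))" using mem_row[OF k, of "j - o'"] assms i b by auto
qed

lemma jumps_allD:
  assumes "jumps_all m R" "m \<le> length R" "o' < w" "w < o' + m"
  shows "jumped w"
proof -
  have "w - o' \<in> set [1..<m]" using assms by auto
  then obtain i j where ij: "i < w - o'" "w - o' < j" "j \<in> set (R ! i)"
    using assms(1) unfolding jumps_all_def list_all_iff list_ex_iff by fastforce
  then have "F (o' + i) (o' + j)" using mem_row[of i j] assms by auto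
  moreover have "o' + i < w" "w < o' + j" using ij by auto
  ultimately show ?thesis unfolding jumped_def by blast
qed

lemma closesD:
  assumes "closes R"
  shows "n = o' + length R" "o' < w \<Longrightarrow> Suc w < n \<Longrightarrow> jumped w"
proof -
  have lt: "j < length R" if "i < length R" "j \<in> set (R ! i)" for i j
    using assms that by (auto simp: closes_def list_all_iff)
  obtain ns where "ns \<in> set R" "length R - 1 \<in> set ns"
    using assms unfolding closes_def list_ex_iff by blast
  then obtain i where i: "i < length R" "length R - 1 \<in> set (R ! i)" by (metis in_set_conv_nth)
  then have "F (o' + i) (o' + (length R - 1))" using mem_row by blast
  then have kn: "o' + length R \<le> n" using adj_less(2) b by fastforce
  have "{..<o' + length R} = {..<n}"
  proof (rule closed_set)
    fix u v assume uv: "u \<in> {..<o' + length R}" "F u v"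
    show "v \<in> {..<o' + length R}"
    proof (rule ccontr)
      assume "\<not> ?thesis"
      then show False using crossing_row[OF uv(2)] uv(1) lt by fastforce
    qed
  next
    have "0 \<in> {..<o' + length R}" using b by (cases R) auto
    then show "{..<o' + length R} \<noteq> {}" by blast
  qed (use kn in auto)
  then show n: "n = o' + length R" by simp
  show "o' < w \<Longrightarrow> Suc w < n \<Longrightarrow> jumped w"
    using jumps_allD[of "length R - 1" w] assms n by (auto simp: closes_def)
qed

lemma cutsD:
  assumes "cuts R"
  shows "\<not> jumped (o' + length R)" "Suc (o' + length R) < n" "o' < w \<Longrightarrow> w < o' + length R \<Longrightarrow> jumped w"
proof -
  have le: "j \<le> length R" if "i < length R" "j \<in> set (R ! i)" for i j
    using assms that by (auto simp: cuts_def list_all_iff)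
  let ?k = "o' + length R"
  have region: "o' \<le> j" if "b \<le> i" "F (o' + i) j" for i j
    using before[of j "o' + i"] that adj_sym by force
  show nj: "\<not> jumped ?k"
  proof
    assume "jumped ?k"
    then obtain p s where ps: "p < ?k" "?k < s" "F p s" by (auto simp: jumped_def)
    then show False using crossing_row[OF ps(3)] le[of "p - o'" "s - o'"] by auto
  qed
  \<comment> \<open>Only two of the four neighbours come before the position, so it is not the last
    vertex.\<close>
  have c2: "card {x. x < ?k \<and> F x ?k} = 2"
    using backdeg_eq[of b o' R "length R", OF b(1) region R] assms b by (simp add: cuts_def)
  then have "{x. x < ?k \<and> F x ?k} \<noteq> {}" by (metis card.empty zero_neq_numeral)
  then have kn: "?k < n" using adj_less(2) by blast
  have "{x. F ?k x} = {x. F x ?k}" using adj_commute[of ?k] by blast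
  then have "card {x. F x ?k} = 4" using degree_4[of ?k] kn by simp
  then have "{x. x < ?k \<and> F x ?k} \<noteq> {x. F x ?k}" using c2 by fastforce
  then obtain x where x: "F x ?k" "\<not> x < ?k" by blast
  then have "?k < x" using adj_irrefl[OF x(1)] by linarith
  moreover have "x < n" using adj_less(1)[OF x(1)] .
  ultimately show "Suc ?k < n" by simp
  show "o' < w \<Longrightarrow> w < ?k \<Longrightarrow> jumped w"
    using jumps_allD[of "length R" w] assms by (auto simp: cuts_def)
qed

lemma opens_portsD:
  assumes "opens_ports R"
  shows "port_state (o' + (length R - 2))" "o' < w \<Longrightarrow> w < o' + length R \<Longrightarrow> jumped w" "o' + length R < n"
proof -
  let ?k = "length R"
  have k: "2 < ?k" and kmem: "?k \<in> set (R ! (?k - 2))" "?k + 1 \<in> set (R ! (?k - 1))" and sol: "jumps_all ?k R"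
    and tg: "\<And>i j. i < ?k \<Longrightarrow> j \<in> set (R ! i) \<Longrightarrow> j < ?k \<or> i = ?k - 2 \<and> j = ?k \<or> i = ?k - 1 \<and> j = ?k + 1"
    using assms by (auto simp: opens_ports_def Let_def list_all_iff)
  have F: "F (o' + (?k - 2)) (o' + ?k)" "F (o' + (?k - 1)) (o' + (?k + 1))"
    using mem_row kmem k by auto
  show "o' + ?k < n" using adj_less(2)[OF F(1)] .
  show "port_state (o' + (?k - 2))"
    unfolding port_state_def
  proof (intro allI impI)
    fix i j assume ij: "i < o' + (?k - 2) + 2" "o' + (?k - 2) + 2 \<le> j"
    then have ij': "i < o' + ?k" "o' + ?k \<le> j" using k by auto
    show "F i j \<longleftrightarrow> i = o' + (?k - 2) \<and> j = o' + (?k - 2) + 2 \<or> i = o' + (?k - 2) + 1 \<and> j = o' + (?k - 2) + 3"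
    proof
      assume Fij: "F i j"
      note cr = crossing_row[OF Fij ij']
      from tg[OF cr(2,3)] show "i = o' + (?k - 2) \<and> j = o' + (?k - 2) + 2 \<or> i = o' + (?k - 2) + 1 \<and> j = o' + (?k - 2) + 3"
        using cr(1) ij' k by auto
    next
      assume "i = o' + (?k - 2) \<and> j = o' + (?k - 2) + 2 \<or> i = o' + (?k - 2) + 1 \<and> j = o' + (?k - 2) + 3"
      moreover have "o' + (?k - 2) + 2 = o' + ?k" "o' + (?k - 2) + 1 = o' + (?k - 1)" "o' + (?k - 2) + 3 = o' + (?k + 1)"
        using k by auto
      ultimately show "F i j" using F by auto
    qed
  qed
  show "o' < w \<Longrightarrow> w < o' + ?k \<Longrightarrow> jumped w" using jumps_allD[OF sol] by simp
qed

end

lemma explore_sound_Nil: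
  assumes "1 \<le> b" "\<And>i j. b \<le> i \<Longrightarrow> F (o' + i) j \<Longrightarrow> o' \<le> j"
    and "consistent b o' R" "b \<le> length R"
    and "\<And>i j. i < length R \<Longrightarrow> j \<in> set (R ! i) \<Longrightarrow> j < t" "\<exists>v\<in>set (concat R). length R \<le> v"
  shows "\<exists>R'\<in>set (explore b f R [] t). consistent b o' R'"
proof -
  have "twins_ok o' (length R) []" by (subst twins_ok_def[OF assms(1)]) (erule assms(2), simp_all)
  from explore_sound[OF assms(1-4) this assms(5,6)] show ?thesis .
qed

lemma start_consistent: "\<exists>R \<in> set (explore 1 12 [[1, 2, 3, 4]] [] 5). consistent 1 0 R"
proof (rule explore_sound_Nil)
  have n: "0 < n" using verts_nonempty by auto
  have "{j. 0 < j \<and> F 0 j} = {j. F 0 j}" using adj_irrefl by fastforce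
  then have "forward 1 0 0 = [1..<5]" using forward_initial[of 0] degree_4[of 0] n by simp
  then show "consistent 1 0 [[1, 2, 3, 4]]" by (simp add: consistent_def upt_rec)
qed auto

lemma cut_consistent:
  assumes w: "cutpos w"
  shows "\<exists>R \<in> set (explore 1 12 [[1, 2]] [] 3). consistent 1 w R"
proof (rule explore_sound_Nil)
  have before: "\<not> F i j" if "i < w" "w < j" for i j using w that by (auto simp: cutpos_def jumped_def)
  then have "forward 1 w 0 = [1..<3]" using forward_initial[of w] card_forward_cutpos[OF w] by simp
  then show "consistent 1 w [[1, 2]]" by (simp add: consistent_def upt_rec)
  show "w \<le> j" if "1 \<le> i" "F (w + i) j" for i j
    using before[of j "w + i"] that adj_sym by force
qed auto

lemma port_consistent:
  assumes p: "port_state p"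
  shows "\<exists>R \<in> set (explore 2 12 [[2], [3]] [] 4). consistent 2 p R"
proof (rule explore_sound_Nil)
  have P: "F i j \<longleftrightarrow> i = p \<and> j = p + 2 \<or> i = p + 1 \<and> j = p + 3" if "i < p + 2" "p + 2 \<le> j" for i j
    using p that unfolding port_state_def by blast
  have n: "2 < n" "3 < n" using P[of p "p + 2"] P[of "p + 1" "p + 3"] adj_less(2) by force+
  have "filter (\<lambda>j. F p (p + j)) [2..<n] = filter (\<lambda>j. j = 2) [2..<n]"
    by (rule filter_cong[OF refl]) (use P in auto)
  moreover have "filter (\<lambda>j. F (p + 1) (p + j)) [2..<n] = filter (\<lambda>j. j = 3) [2..<n]"
    by (rule filter_cong[OF refl]) (use P in auto)
  ultimately have "forward 2 p 0 = [2]" "forward 2 p 1 = [3]"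
    using n filter_eq_single[of 2 2 n] filter_eq_single[of 2 3 n] by (simp_all add: forward_def max_def)
  then show "consistent 2 p [[2], [3]]" by (auto simp: consistent_def less_Suc_eq)
  show "p \<le> j" if "2 \<le> i" "F (p + i) j" for i j
    using P[of j "p + i"] that adj_sym by force
qed (auto simp: less_Suc_eq)

end

section \<open>Assembling bricks into blocks\<close>

lemma start_end_pieces: "(R, Q, a) \<in> set start_ends \<Longrightarrow> Q \<in> plain ` {graph_G5, graph_G6, graph_G7, graph_G8, graph_G8', graph_G9} \<and> 2 < length R"
  and start_cut_pieces: "(R, Q, a) \<in> set start_cuts \<Longrightarrow> Q \<in> {block_D1, block_D2, block_D3, block_D4} \<and> 2 < length R"
  and start_port_pieces: "(R, Q, a) \<in> set start_ports \<Longrightarrow> Q \<in> D_bricks \<and> 2 < length R"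
  and cut_end_length: "R \<in> set cut_ends \<Longrightarrow> 2 < length R"
  and cut_cut_pieces: "(R, Q, a) \<in> set cut_cuts \<Longrightarrow> Q \<in> {block_M, block_M1, block_M2, block_M3, mirror block_M3} \<and> 2 < length R"
  and cut_port_pieces: "(R, Q, a) \<in> set cut_ports \<Longrightarrow> Q \<in> M_bricks \<and> 2 < length R"
  and port_end_pieces: "(R, Q, a) \<in> set port_ends \<Longrightarrow> Q \<in> mirror ` D_bricks \<and> 5 < length R"
  and port_cut_pieces: "(R, Q, a) \<in> set port_cuts \<Longrightarrow> Q \<in> mirror ` M_bricks \<and> 5 < length R"
  and port_port_pieces: "(R, Q, a) \<in> set port_ports \<Longrightarrow> Q \<in> inner_bricks \<and> 5 < length R"
  by (auto simp: start_ends_def start_cuts_def start_ports_def cut_ends_def cut_cuts_def cut_ports_def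
      port_ends_def port_cuts_def port_ports_def D_bricks_def M_bricks_def inner_bricks_def)

lemma D_brick_card: "Q \<in> D_bricks \<Longrightarrow> finite (pverts (body Q)) \<and> 5 \<le> card (pverts (body Q))"
proof -
  have "pverts (body (delete_right block_D3)) = {1..<9}" "pverts (body (delete_right block_D4)) = {0..<5}"
    by code_simp+
  then show "Q \<in> D_bricks \<Longrightarrow> finite (pverts (body Q)) \<and> 5 \<le> card (pverts (body Q))"
    by (auto simp: D_bricks_def)
qed

lemma map_fst_obtain:
  assumes "R \<in> set (map fst xs)"
  obtains Q a where "(R, Q, a) \<in> set xs"
  using assms by auto

context ordered_quartic
begin

text \<open>Here and in the two analogous steps, the clause on \<open>jumped\<close> records that
  the stretch just explored contains no cut position, so that its end is the next one.\<close>

lemma start_step: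
  obtains (whole) Q f where "Q \<in> plain ` {graph_G5, graph_G6, graph_G7, graph_G8, graph_G8', graph_G9}" "n \<le> 9"
      "wf_piece Q" "piece_map f Q (segment F {0..<n} {} {})" "\<And>w. 0 < w \<Longrightarrow> Suc w < n \<Longrightarrow> jumped w"
  | (cut) k Q f where "Q \<in> {block_D1, block_D2, block_D3, block_D4}" "wf_piece Q"
      "piece_map f Q (segment F {0..<Suc k} {} {k})" "0 < k" "\<not> jumped k" "Suc k < n" "\<And>w. 0 < w \<Longrightarrow> w < k \<Longrightarrow> jumped w"
  | (ports) p Q f where "Q \<in> D_bricks" "wf_piece Q" "piece_map f Q (segment F {0..<p + 2} {} {p, p + 1})"
      "port_state p" "\<And>w. 0 < w \<Longrightarrow> w < p + 2 \<Longrightarrow> jumped w"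
proof -
  obtain R where R: "R \<in> set (explore 1 12 [[1, 2, 3, 4]] [] 5)" "consistent 1 0 R" using start_consistent by blast
  have before: "\<And>i j. i < 0 \<Longrightarrow> 0 + 1 \<le> j \<Longrightarrow> \<not> F i j" by simp
  note ctx = _ _ before R(2)
  have "R \<in> set (map fst start_ends) \<or> R \<in> set (map fst start_cuts) \<or> R \<in> set (map fst start_ports)"
    using R(1) start_outcomes by auto
  then consider "R \<in> set (map fst start_ends)" | "R \<in> set (map fst start_cuts)" | "R \<in> set (map fst start_ports)" by blast
  then show thesis
  proof cases
    case 1
    then obtain Q a where X: "(R, Q, a) \<in> set start_ends" by (rule map_fst_obtain)
    have lay: "layout 0 (length R) {} {} (R, Q, a)" "closes R" "length R \<le> 9"
      using start_ends_layout X unfolding list_all_iff by auto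
    have len: "1 < length R" using start_end_pieces[OF X] by simp
    note cl = closesD[OF le_refl len before R(2) lay(2)]
    have n: "n = length R" using cl(1) by simp
    have pm: "piece_map (\<lambda>l. 0 + a l) Q (segment F {0 + 0..<0 + length R} ((+) 0 ` {}) ((+) 0 ` {}))"
      by (rule piece_map_layout[OF R(2) lay(1)]) simp_all
    show thesis
      by (rule whole[of Q "\<lambda>l. 0 + a l"]) (use pm start_end_pieces[OF X] lay n cl(2) in \<open>auto simp: layout_def\<close>)
  next
    case 2
    then obtain Q a where X: "(R, Q, a) \<in> set start_cuts" by (rule map_fst_obtain)
    have lay: "layout 0 (Suc (length R)) {} {length R} (R, Q, a)" "cuts R"
      using start_cuts_layout X unfolding list_all_iff by auto
    have len: "1 < length R" using start_cut_pieces[OF X] by simp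
    note cl = cutsD[OF le_refl len before R(2) lay(2)]
    have pm: "piece_map (\<lambda>l. 0 + a l) Q (segment F {0 + 0..<0 + Suc (length R)} ((+) 0 ` {}) ((+) 0 ` {length R}))"
      by (rule piece_map_layout[OF R(2) lay(1)]) simp_all
    show thesis
      by (rule cut[of Q "\<lambda>l. 0 + a l" "length R"])
        (use pm start_cut_pieces[OF X] lay cl len in \<open>auto simp: layout_def\<close>)
  next
    case 3
    then obtain Q a where X: "(R, Q, a) \<in> set start_ports" by (rule map_fst_obtain)
    have lay: "layout 0 (length R) {} {length R - 2, length R - 1} (R, Q, a)" "opens_ports R"
      using start_ports_layout X unfolding list_all_iff by auto
    have len: "1 < length R" "2 < length R" using start_port_pieces[OF X] by simp_all
    note cl = opens_portsD[OF le_refl len(1) before R(2) lay(2)]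
    have pm: "piece_map (\<lambda>l. 0 + a l) Q (segment F {0 + 0..<0 + length R} ((+) 0 ` {}) ((+) 0 ` {length R - 2, length R - 1}))"
      by (rule piece_map_layout[OF R(2) lay(1)]) simp_all
    have eq: "length R - 2 + 2 = length R" "length R - 2 + 1 = length R - 1" using len by auto
    show thesis
      by (rule ports[of Q "\<lambda>l. 0 + a l" "length R - 2"], unfold eq)
        (use pm start_port_pieces[OF X] lay cl in \<open>auto simp: layout_def\<close>)
  qed
qed

lemma cut_step:
  assumes v: "cutpos v"
  obtains (whole) "\<And>w. v < w \<Longrightarrow> Suc w < n \<Longrightarrow> jumped w"
  | (cut) k Q f where "Q \<in> {block_M, block_M1, block_M2, block_M3, mirror block_M3}" "wf_piece Q"
      "piece_map f Q (segment F {v..<Suc k} {v} {k})" "v < k" "\<not> jumped k" "Suc k < n" "\<And>w. v < w \<Longrightarrow> w < k \<Longrightarrow> jumped w"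
  | (ports) p Q f where "Q \<in> M_bricks" "wf_piece Q" "piece_map f Q (segment F {v..<p + 2} {v} {p, p + 1})"
      "port_state p" "v \<le> p" "\<And>w. v < w \<Longrightarrow> w < p + 2 \<Longrightarrow> jumped w"
proof -
  obtain R where R: "R \<in> set (explore 1 12 [[1, 2]] [] 3)" "consistent 1 v R" using cut_consistent[OF v] by blast
  have before: "\<And>i j. i < v \<Longrightarrow> v + 1 \<le> j \<Longrightarrow> \<not> F i j" using v by (auto simp: cutpos_def jumped_def)
  have "R \<in> set cut_ends \<or> R \<in> set (map fst cut_cuts) \<or> R \<in> set (map fst cut_ports)"
    using R(1) cut_outcomes by auto
  then consider "R \<in> set cut_ends" | "R \<in> set (map fst cut_cuts)" | "R \<in> set (map fst cut_ports)" by blast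
  then show thesis
  proof cases
    case 1
    have "closes R" using cut_ends_close 1 unfolding list_all_iff by auto
    moreover have len: "1 < length R" using cut_end_length[OF 1] by simp
    ultimately show thesis using closesD[OF le_refl len before R(2)] by (intro whole) auto
  next
    case 2
    then obtain Q a where X: "(R, Q, a) \<in> set cut_cuts" by (rule map_fst_obtain)
    have lay: "layout 0 (Suc (length R)) {0} {length R} (R, Q, a)" "cuts R"
      using cut_cuts_layout X unfolding list_all_iff by auto
    have len: "1 < length R" using cut_cut_pieces[OF X] by simp
    note cl = cutsD[OF le_refl len before R(2) lay(2)]
    have pm: "piece_map (\<lambda>l. v + a l) Q (segment F {v + 0..<v + Suc (length R)} ((+) v ` {0}) ((+) v ` {length R}))"
      by (rule piece_map_layout[OF R(2) lay(1)]) simp_all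
    show thesis
      by (rule cut[of Q "\<lambda>l. v + a l" "v + length R"])
        (use pm cut_cut_pieces[OF X] lay cl len in \<open>auto simp: layout_def\<close>)
  next
    case 3
    then obtain Q a where X: "(R, Q, a) \<in> set cut_ports" by (rule map_fst_obtain)
    have lay: "layout 0 (length R) {0} {length R - 2, length R - 1} (R, Q, a)" "opens_ports R"
      using cut_ports_layout X unfolding list_all_iff by auto
    have len: "1 < length R" "2 < length R" using cut_port_pieces[OF X] by simp_all
    note cl = opens_portsD[OF le_refl len(1) before R(2) lay(2)]
    have pm: "piece_map (\<lambda>l. v + a l) Q (segment F {v + 0..<v + length R} ((+) v ` {0}) ((+) v ` {length R - 2, length R - 1}))"
      by (rule piece_map_layout[OF R(2) lay(1)]) simp_all
    have eq: "v + (length R - 2) + 2 = v + length R" "v + (length R - 2) + 1 = v + (length R - 1)" using len by auto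
    show thesis
      by (rule ports[of Q "\<lambda>l. v + a l" "v + (length R - 2)"], unfold eq)
        (use pm cut_port_pieces[OF X] lay cl in \<open>auto simp: layout_def\<close>)
  qed
qed

lemma port_step:
  assumes p: "port_state p"
  obtains (whole) Q f where "Q \<in> mirror ` D_bricks" "wf_piece Q" "piece_map f Q (segment F {p + 2..<n} {p + 2, p + 3} {})"
      "p + 4 \<le> n" "\<And>w. p < w \<Longrightarrow> Suc w < n \<Longrightarrow> jumped w"
  | (cut) k Q f where "Q \<in> mirror ` M_bricks" "wf_piece Q"
      "piece_map f Q (segment F {p + 2..<Suc k} {p + 2, p + 3} {k})" "p + 4 \<le> k" "\<not> jumped k" "Suc k < n"
      "\<And>w. p < w \<Longrightarrow> w < k \<Longrightarrow> jumped w"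
  | (ports) q Q f where "Q \<in> inner_bricks" "wf_piece Q" "piece_map f Q (segment F {p + 2..<q + 2} {p + 2, p + 3} {q, q + 1})"
      "port_state q" "p + 2 \<le> q" "q + 2 < n" "\<And>w. p < w \<Longrightarrow> w < q + 2 \<Longrightarrow> jumped w"
proof -
  obtain R where R: "R \<in> set (explore 2 12 [[2], [3]] [] 4)" "consistent 2 p R" using port_consistent[OF p] by blast
  have before: "\<not> F i j" if "i < p" "p + 2 \<le> j" for i j
  proof -
    have "F i j \<longleftrightarrow> i = p \<and> j = p + 2 \<or> i = p + 1 \<and> j = p + 3"
      using p that(2) trans_less_add1[OF that(1), of 2] unfolding port_state_def by blast
    then show ?thesis using that by auto
  qed
  have b: "1 \<le> (2 :: nat)" by simp
  have "R \<in> set (map fst port_ends) \<or> R \<in> set (map fst port_cuts) \<or> R \<in> set (map fst port_ports)"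
    using R(1) port_outcomes by auto
  then consider "R \<in> set (map fst port_ends)" | "R \<in> set (map fst port_cuts)" | "R \<in> set (map fst port_ports)" by blast
  then show thesis
  proof cases
    case 1
    then obtain Q a where X: "(R, Q, a) \<in> set port_ends" by (rule map_fst_obtain)
    have lay: "layout 2 (length R) {2, 3} {} (R, Q, a)" "closes R"
      using port_ends_layout X unfolding list_all_iff by auto
    have len: "2 < length R" "5 < length R" using port_end_pieces[OF X] by simp_all
    note cl = closesD[OF b len(1) before R(2) lay(2)]
    have pm: "piece_map (\<lambda>l. p + a l) Q (segment F {p + 2..<p + length R} ((+) p ` {2, 3}) ((+) p ` {}))"
      by (rule piece_map_layout[OF R(2) lay(1)]) simp_all
    show thesis
      by (rule whole[of Q "\<lambda>l. p + a l"]) (use pm port_end_pieces[OF X] lay cl len in \<open>auto simp: layout_def\<close>)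
  next
    case 2
    then obtain Q a where X: "(R, Q, a) \<in> set port_cuts" by (rule map_fst_obtain)
    have lay: "layout 2 (Suc (length R)) {2, 3} {length R} (R, Q, a)" "cuts R"
      using port_cuts_layout X unfolding list_all_iff by auto
    have len: "2 < length R" "5 < length R" using port_cut_pieces[OF X] by simp_all
    note cl = cutsD[OF b len(1) before R(2) lay(2)]
    have pm: "piece_map (\<lambda>l. p + a l) Q (segment F {p + 2..<p + Suc (length R)} ((+) p ` {2, 3}) ((+) p ` {length R}))"
      by (rule piece_map_layout[OF R(2) lay(1)]) simp_all
    show thesis
      by (rule cut[of Q "\<lambda>l. p + a l" "p + length R"])
        (use pm port_cut_pieces[OF X] lay cl len in \<open>auto simp: layout_def\<close>)
  next
    case 3
    then obtain Q a where X: "(R, Q, a) \<in> set port_ports" by (rule map_fst_obtain)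
    have lay: "layout 2 (length R) {2, 3} {length R - 2, length R - 1} (R, Q, a)" "opens_ports R"
      using port_ports_layout X unfolding list_all_iff by auto
    have len: "2 < length R" "5 < length R" using port_port_pieces[OF X] by simp_all
    note cl = opens_portsD[OF b len(1) before R(2) lay(2)]
    have pm: "piece_map (\<lambda>l. p + a l) Q (segment F {p + 2..<p + length R} ((+) p ` {2, 3}) ((+) p ` {length R - 2, length R - 1}))"
      by (rule piece_map_layout[OF R(2) lay(1)]) simp_all
    have eq: "p + (length R - 2) + 2 = p + length R" "p + (length R - 2) + 1 = p + (length R - 1)" using len by auto
    show thesis
      by (rule ports[of Q "\<lambda>l. p + a l" "p + (length R - 2)"], unfold eq)
        (use pm port_port_pieces[OF X] lay cl len in \<open>auto simp: layout_def\<close>)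
  qed
qed

section \<open>Chains of bricks\<close>

text \<open>A long block under construction. Only the first brick is restricted, so that a chain can
  be extended before it is known which brick is the last.\<close>

definition chain :: "nat piece set \<Rightarrow> nat piece list \<Rightarrow> nat piece \<Rightarrow> bool" where
  "chain S Bs P \<longleftrightarrow> Bs \<noteq> [] \<and> hd Bs \<in> S \<and> (\<forall>B\<in>set Bs. wf_piece B) \<and>
     (\<exists>m f. port_matching Bs m \<and> piece_map f (join_bricks Bs m) P)"

lemma chain_single: "B \<in> S \<Longrightarrow> wf_piece B \<Longrightarrow> piece_map f B P \<Longrightarrow> chain S [B] P"
  unfolding chain_def port_matching_def
  using piece_map_comp[OF piece_map_inv[OF _ join_bricks_single[of B "\<lambda>_ u. u"]], of f P] by auto

lemma chain_snoc:
  assumes ch: "chain S Bs (segment F {v..<p + 2} L {p, p + 1})" and p: "port_state p" and vp: "v \<le> p"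
    and B: "wf_piece B" "piece_map g B (segment F {p + 2..<k} {p + 2, p + 3} R)" and k: "p + 4 \<le> k"
  shows "chain S (Bs @ [B]) (segment F {v..<k} L R)"
proof -
  obtain m f where m: "port_matching Bs m" "piece_map f (join_bricks Bs m) (segment F {v..<p + 2} L {p, p + 1})"
    using ch by (auto simp: chain_def)
  have Bs: "Bs \<noteq> []" "hd Bs \<in> S" "\<And>B. B \<in> set Bs \<Longrightarrow> wf_piece B" using ch by (auto simp: chain_def)
  have cross: "F i j \<longleftrightarrow> i = p \<and> j = p + 2 \<or> i = p + 1 \<and> j = p + 3" if "i < p + 2" "p + 2 \<le> j" for i j
    using p that unfolding port_state_def by blast
  obtain m' f' where "port_matching (Bs @ [B]) m'" "piece_map f' (join_bricks (Bs @ [B]) m') (segment F {v..<k} L R)"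
    using append_brick[OF m(2,1) Bs(1,3) B(2,1) adj_sym vp k cross] by blast
  then show ?thesis using Bs B(1) by (auto simp: chain_def)
qed

lemma chain_long_block:
  assumes ch: "chain S (Bs @ [B]) P" and ne: "Bs \<noteq> []" and inner: "set (tl Bs) \<subseteq> inner_bricks" and B: "B \<in> T"
  shows "long_block S T P"
proof -
  obtain m f where m: "port_matching (Bs @ [B]) m" "piece_map f (join_bricks (Bs @ [B]) m) P"
    using ch by (auto simp: chain_def)
  have "wf_piece (join_bricks (Bs @ [B]) m)"
    by (rule wf_join_bricks[OF _ _ m(1)]) (use ch in \<open>auto simp: chain_def\<close>)
  from piece_iso_of_inverse_map[OF this m(2)] have iso: "piece_iso P (join_bricks (Bs @ [B]) m)" .
  have "(Bs @ [B]) ! i \<in> inner_bricks" if "0 < i" "Suc i < length (Bs @ [B])" for i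
  proof -
    have "(Bs @ [B]) ! i = tl Bs ! (i - 1)" "i - 1 < length (tl Bs)" using that by (auto simp: nth_append nth_tl)
    then show ?thesis using inner nth_mem by (metis subsetD)
  qed
  moreover have "2 \<le> length (Bs @ [B])" using ne by (cases Bs) auto
  ultimately show ?thesis
    unfolding long_block_def using m(1) iso B ch by (intro exI[of _ "Bs @ [B]"] exI[of _ m]) (auto simp: chain_def)
qed

text \<open>Each inner brick moves the two-edge cut to the right, so the process stops at a cut
  position or at the end of the graph; the brick found there is the last one.\<close>

lemma port_chain:
  assumes "chain S Bs (segment F {v..<p + 2} L {p, p + 1})" "set (tl Bs) \<subseteq> inner_bricks" "port_state p" "v \<le> p"
    "\<And>w. v < w \<Longrightarrow> w < p + 2 \<Longrightarrow> jumped w"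
  shows "(\<exists>k Bs' B. chain S (Bs' @ [B]) (segment F {v..<Suc k} L {k}) \<and> Bs' \<noteq> [] \<and> set (tl Bs') \<subseteq> inner_bricks \<and>
        B \<in> mirror ` M_bricks \<and> \<not> jumped k \<and> Suc k < n \<and> v < k \<and> (\<forall>w. v < w \<longrightarrow> w < k \<longrightarrow> jumped w)) \<or>
    (\<exists>Bs' B. chain S (Bs' @ [B]) (segment F {v..<n} L {}) \<and> Bs' \<noteq> [] \<and> set (tl Bs') \<subseteq> inner_bricks \<and>
        B \<in> mirror ` D_bricks \<and> (\<forall>w. v < w \<longrightarrow> Suc w < n \<longrightarrow> jumped w))"
  using assms
proof (induction "n - p" arbitrary: p Bs rule: less_induct)
  case less
  have ne: "Bs \<noteq> []" using less.prems(1) by (simp add: chain_def)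
  show ?case
  proof (rule port_step[OF less.prems(3)], goal_cases)
    case (1 Q f)
    have "chain S (Bs @ [Q]) (segment F {v..<n} L {})"
      by (rule chain_snoc[OF less.prems(1,3,4) 1(2,3,4)])
    moreover have "jumped w" if "v < w" "Suc w < n" for w
      using less.prems(5)[of w] 1(5)[of w] that by (cases "w < p + 2") auto
    ultimately show ?thesis using ne less.prems(2) 1(1) by blast
  next
    case (2 k Q f)
    have "chain S (Bs @ [Q]) (segment F {v..<Suc k} L {k})"
      by (rule chain_snoc[OF less.prems(1,3,4) 2(2,3)]) (use 2(4) in simp)
    moreover have "jumped w" if "v < w" "w < k" for w
      using less.prems(5)[of w] 2(7)[of w] that by (cases "w < p + 2") auto
    moreover have "v < k" using less.prems(4) 2(4) by simp
    ultimately show ?thesis using ne less.prems(2) 2(1,5,6) by blast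
  next
    case (3 q Q f)
    have ch: "chain S (Bs @ [Q]) (segment F {v..<q + 2} L {q, q + 1})"
      by (rule chain_snoc[OF less.prems(1,3,4) 3(2,3)]) (use 3(5) in simp)
    have inn: "set (tl (Bs @ [Q])) \<subseteq> inner_bricks" using ne less.prems(2) 3(1) by simp
    have "jumped w" if "v < w" "w < q + 2" for w
      using less.prems(5)[of w] 3(7)[of w] that by (cases "w < p + 2") auto
    moreover have "n - q < n - p" "v \<le> q" using 3(5,6) less.prems(4) by auto
    ultimately show ?thesis using less.hyps[OF _ ch inn 3(4)] by blast
  qed
qed

text \<open>The search from 0 stops at a position that no edge passes while all positions before it
  are passed, and this must be \<open>w\<close>.\<close>

lemma left_end:
  assumes w: "cutpos w" and least: "\<And>u. cutpos u \<Longrightarrow> w \<le> u"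
  shows "left_end_type (segment F {0..<Suc w} {} {w})"
proof -
  have w': "0 < w" "Suc w < n" "\<not> jumped w" using w by (auto simp: cutpos_def)
  have eq: "k = w" if "0 < k" "Suc k < n" "\<not> jumped k" "\<And>u. 0 < u \<Longrightarrow> u < k \<Longrightarrow> jumped u" for k
  proof -
    have "w \<le> k" using least[of k] that by (simp add: cutpos_def)
    moreover have "\<not> w < k" using that(4)[of w] w' by blast
    ultimately show ?thesis by simp
  qed
  show ?thesis
  proof (rule start_step, goal_cases)
    case (1 Q f)
    then show ?thesis using w' by blast
  next
    case (2 k Q f)
    then have "k = w" using eq by blast
    then have "piece_iso (segment F {0..<Suc w} {} {w}) Q" using piece_iso_of_inverse_map[OF 2(2,3)] by simp
    then show ?thesis using 2(1) unfolding left_end_type_def by blast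
  next
    case (3 p Q f)
    from port_chain[OF chain_single[OF 3(1,2,3)] _ 3(4) le0 3(5)]
    consider k Bs B where "chain D_bricks (Bs @ [B]) (segment F {0..<Suc k} {} {k})" "Bs \<noteq> []" "set (tl Bs) \<subseteq> inner_bricks"
        "B \<in> mirror ` M_bricks" "\<not> jumped k" "Suc k < n" "0 < k" "\<forall>w. 0 < w \<longrightarrow> w < k \<longrightarrow> jumped w"
      | "\<forall>w. 0 < w \<longrightarrow> Suc w < n \<longrightarrow> jumped w" by auto
    then show ?thesis
    proof cases
      case 1
      then have "k = w" using eq by blast
      then have "long_end_block (segment F {0..<Suc w} {} {w})"
        using chain_long_block[OF 1(1-4)] by (simp add: long_end_block_def)
      then show ?thesis by (simp add: left_end_type_def)
    next
      case 2
      then show ?thesis using w' by blast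
    qed
  qed
qed

lemma middle:
  assumes v: "cutpos v" and w: "cutpos w" and vw: "v < w" and least: "\<And>u. cutpos u \<Longrightarrow> v < u \<Longrightarrow> w \<le> u"
  shows "middle_type (segment F {v..<Suc w} {v} {w})"
proof -
  have w': "0 < w" "Suc w < n" "\<not> jumped w" using w by (auto simp: cutpos_def)
  have eq: "k = w" if "v < k" "Suc k < n" "\<not> jumped k" "\<And>u. v < u \<Longrightarrow> u < k \<Longrightarrow> jumped u" for k
  proof -
    have "w \<le> k" using least[of k] that by (simp add: cutpos_def)
    moreover have "\<not> w < k" using that(4)[of w] vw w' by blast
    ultimately show ?thesis by simp
  qed
  show ?thesis
  proof (rule cut_step[OF v], goal_cases)
    case 1
    then show ?thesis using w' vw by blast
  next
    case (2 k Q f)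
    then have "k = w" using eq by blast
    then have "piece_iso (segment F {v..<Suc w} {v} {w}) Q" using piece_iso_of_inverse_map[OF 2(2,3)] by simp
    then show ?thesis using 2(1) unfolding middle_type_def by blast
  next
    case (3 p Q f)
    from port_chain[OF chain_single[OF 3(1,2,3)] _ 3(4,5,6)]
    consider k Bs B where "chain M_bricks (Bs @ [B]) (segment F {v..<Suc k} {v} {k})" "Bs \<noteq> []" "set (tl Bs) \<subseteq> inner_bricks"
        "B \<in> mirror ` M_bricks" "\<not> jumped k" "Suc k < n" "v < k" "\<forall>w. v < w \<longrightarrow> w < k \<longrightarrow> jumped w"
      | "\<forall>w. v < w \<longrightarrow> Suc w < n \<longrightarrow> jumped w" by auto
    then show ?thesis
    proof cases
      case 1
      then have "k = w" using eq by blast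
      then have "long_middle_block (segment F {v..<Suc w} {v} {w})"
        using chain_long_block[OF 1(1-4)] by (simp add: long_middle_block_def)
      then show ?thesis by (simp add: middle_type_def)
    next
      case 2
      then show ?thesis using w' vw by blast
    qed
  qed
qed

text \<open>The bound 10 holds because a long complete block contains two end bricks with at least
  five vertices each.\<close>

lemma no_cutpos:
  assumes none: "\<And>w. \<not> cutpos w"
  shows "n \<le> 9 \<and> (\<exists>H \<in> {graph_G5, graph_G6, graph_G7, graph_G8, graph_G8', graph_G9}.
      piece_iso (segment F {0..<n} {} {}) (plain H)) \<or>
    10 \<le> n \<and> long_block D_bricks (mirror ` D_bricks) (segment F {0..<n} {} {})"
proof (rule start_step, goal_cases)
  case (1 Q f)
  then show ?thesis using piece_iso_of_inverse_map[OF 1(3,4)] by blast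
next
  case (2 k Q f)
  then show ?thesis using none[of k] by (simp add: cutpos_def)
next
  case (3 p Q f)
  from port_chain[OF chain_single[OF 3(1,2,3)] _ 3(4) le0 3(5)]
  consider k where "\<not> jumped k" "Suc k < n" "0 < k"
    | Bs B where "chain D_bricks (Bs @ [B]) (segment F {0..<n} {} {})" "Bs \<noteq> []" "set (tl Bs) \<subseteq> inner_bricks"
        "B \<in> mirror ` D_bricks" by auto
  then show ?thesis
  proof cases
    case 1
    then show ?thesis using none[of k] by (simp add: cutpos_def)
  next
    case 2
    obtain m f where f: "piece_map f (join_bricks (Bs @ [B]) m) (segment F {0..<n} {} {})" and hd: "hd Bs \<in> D_bricks"
      using 2(1,2) by (auto simp: chain_def)
    let ?V = "pverts (body (join_bricks (Bs @ [B]) m))"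
    have "card ?V = n" "finite ?V"
    proof -
      have "inj_on f ?V" "f ` ?V = {0..<n}" using f by (simp_all add: piece_map_def)
      then show "card ?V = n" "finite ?V" using card_image[of f ?V] finite_image_iff[of f ?V] by auto
    qed
    obtain B0 where B0: "B0 \<in> D_bricks" "B = mirror B0" using 2(4) by blast
    have "Pair 0 ` pverts (body (hd Bs)) \<union> Pair (length Bs) ` pverts (body B0) \<subseteq> ?V"
      using 2(2) B0(2) by (auto simp: join_bricks_def nth_append hd_conv_nth mirror_def)
    then have "card (Pair 0 ` pverts (body (hd Bs)) \<union> Pair (length Bs) ` pverts (body B0)) \<le> n"
      using card_mono[OF \<open>finite ?V\<close>] \<open>card ?V = n\<close> by metis
    moreover have "card (Pair 0 ` pverts (body (hd Bs)) \<union> Pair (length Bs) ` pverts (body B0))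
        = card (pverts (body (hd Bs))) + card (pverts (body B0))"
      using 2(2) D_brick_card[OF hd] D_brick_card[OF B0(1)]
      by (subst card_Un_disjoint) (auto simp: card_image inj_on_def)
    ultimately have "10 \<le> n" using D_brick_card[OF hd] D_brick_card[OF B0(1)] by simp
    then show ?thesis using chain_long_block[OF 2] by simp
  qed
qed

end

section \<open>Cut vertices and blocks\<close>

text \<open>The arcs that survive the deletion of \<open>v\<close>; with them the cut vertex
  condition becomes one on ordinary transitive closures.\<close>

definition arcs_off :: "'a pair_pre_digraph \<Rightarrow> 'a \<Rightarrow> 'a rel" where
  "arcs_off K v = {(a, b) \<in> parcs K. a \<noteq> v \<and> b \<noteq> v}"

lemma rtrancl_image:
  assumes "(x, y) \<in> r\<^sup>*" "\<And>x y. (x, y) \<in> r \<Longrightarrow> (f x, f y) \<in> s"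
  shows "(f x, f y) \<in> s\<^sup>*"
  using assms(1) by induction (auto intro: rtrancl_into_rtrancl assms(2))

lemma reachable_iff_rtrancl:
  assumes "parcs K \<subseteq> pverts K \<times> pverts K"
  shows "u \<rightarrow>\<^sup>*\<^bsub>with_proj K\<^esub> w \<longleftrightarrow> u \<in> pverts K \<and> w \<in> pverts K \<and> (u, w) \<in> (parcs K)\<^sup>*"
proof
  assume r: "u \<rightarrow>\<^sup>*\<^bsub>with_proj K\<^esub> w"
  then have "(u, w) \<in> rtrancl_on (pverts K) (parcs K)" by (simp add: reachable_def)
  then have "(u, w) \<in> (parcs K)\<^sup>*" by (rule rtrancl_on_rtranclI)
  moreover have "u \<in> pverts K" "w \<in> pverts K"
    using \<open>(u, w) \<in> rtrancl_on (pverts K) (parcs K)\<close> by (induction rule: rtrancl_on_induct) auto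
  ultimately show "u \<in> pverts K \<and> w \<in> pverts K \<and> (u, w) \<in> (parcs K)\<^sup>*" by simp
next
  assume "u \<in> pverts K \<and> w \<in> pverts K \<and> (u, w) \<in> (parcs K)\<^sup>*"
  then show "u \<rightarrow>\<^sup>*\<^bsub>with_proj K\<^esub> w"
    unfolding reachable_def using assms by (auto intro!: rtrancl_consistent_rtrancl_on)
qed

lemma cut_vertex_iff:
  assumes "parcs K \<subseteq> pverts K \<times> pverts K"
  shows "cut_vertex (with_proj K) v \<longleftrightarrow> v \<in> pverts K \<and>
    (\<exists>u w. u \<in> pverts K - {v} \<and> w \<in> pverts K - {v} \<and> (u, w) \<in> (parcs K)\<^sup>* \<and> (u, w) \<notin> (arcs_off K v)\<^sup>*)"
proof -
  have "pre_digraph.del_vert (with_proj K) v = with_proj \<lparr>pverts = pverts K - {v}, parcs = arcs_off K v\<rparr>"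
    unfolding pre_digraph.del_vert_def with_proj_def arcs_off_def by auto
  moreover have "arcs_off K v \<subseteq> (pverts K - {v}) \<times> (pverts K - {v})"
    using assms by (auto simp: arcs_off_def)
  ultimately show ?thesis
    unfolding cut_vertex_def by (auto simp: reachable_iff_rtrancl assms)
qed

lemma is_block_iff:
  "is_block (with_proj K) \<longleftrightarrow> pair_graph K \<and> pverts K \<noteq> {} \<and>
    (\<forall>u\<in>pverts K. \<forall>w\<in>pverts K. (u, w) \<in> (parcs K)\<^sup>*) \<and>
    (\<forall>v\<in>pverts K. \<forall>u\<in>pverts K - {v}. \<forall>w\<in>pverts K - {v}. (u, w) \<in> (arcs_off K v)\<^sup>*)"
proof (cases "pair_graph K")
  case True
  then interpret pair_graph K .
  have sub: "parcs K \<subseteq> pverts K \<times> pverts K" using in_arcsD1 in_arcsD2 by auto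
  have "mk_symmetric (with_proj K) = K"
    using pair_sym_arcs by (cases K) (auto simp: mk_symmetric_def symmetric_def dest: symD)
  then have "Digraph_Component.connected (with_proj K) \<longleftrightarrow> strongly_connected (with_proj K)"
    by (simp add: Digraph_Component.connected_def)
  also have "\<dots> \<longleftrightarrow> pverts K \<noteq> {} \<and> (\<forall>u\<in>pverts K. \<forall>w\<in>pverts K. (u, w) \<in> (parcs K)\<^sup>*)"
    by (auto simp: strongly_connected_def reachable_iff_rtrancl sub)
  finally have conn: "Digraph_Component.connected (with_proj K) \<longleftrightarrow>
    pverts K \<noteq> {} \<and> (\<forall>u\<in>pverts K. \<forall>w\<in>pverts K. (u, w) \<in> (parcs K)\<^sup>*)" .
  have "graph (with_proj K)" by unfold_locales
  then show ?thesis using True unfolding is_block_def conn cut_vertex_iff[OF sub] by blast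
next
  case False
  then show ?thesis using pair_graphI_graph by (auto simp: is_block_def)
qed

lemma subgraph_with_projE:
  assumes "subgraph H (with_proj G)"
  obtains K where "H = with_proj K" "pverts K \<subseteq> pverts G" "parcs K \<subseteq> parcs G"
proof
  show "H = with_proj \<lparr>pverts = verts H, parcs = arcs H\<rparr>"
    using assms by (cases H) (auto simp: subgraph_def compatible_def with_proj_def)
qed (use assms in \<open>auto simp: subgraph_def\<close>)

context ordered_quartic
begin

text \<open>Otherwise connectedness provides an edge \<open>ps\<close> passing \<open>r\<close>, and
  \<open>skip\<close> then demands a neighbour of \<open>r\<close> before \<open>p\<close>.\<close>

lemma earlier_neighbour:
  assumes "0 < r" "r < n"
  shows "\<exists>j<r. F j r"
proof (rule ccontr)
  assume none: "\<not> ?thesis"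
  have "\<exists>p s. p < r \<and> r < s \<and> F p s"
  proof (rule ccontr)
    assume no: "\<not> ?thesis"
    have "{..<r} = {..<n}"
    proof (rule closed_set)
      show "{..<r} \<noteq> {}" using assms by (auto simp: lessThan_empty_iff)
      fix u v assume "u \<in> {..<r}" "F u v"
      then have "\<not> r < v" "v \<noteq> r" using no none by auto
      then show "v \<in> {..<r}" by simp
    qed (use assms in auto)
    then show False using assms by (metis lessThan_iff less_irrefl)
  qed
  then obtain p s where ps: "p < r" "r < s" "F p s" by blast
  have "card {x. x < p \<and> F x r} = 0" using none ps(1) less_trans by (auto simp: card_eq_0_iff)
  moreover have "\<not> F p r" using none ps(1) by blast
  ultimately show False using skip(1)[OF ps(1,2,3)] by (metis not_less_zero)
qed

text \<open>Each nesting condition is its own mirror image, and the cut for crossing edges passes to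
  the complement. This yields later neighbours and right end blocks without another search.\<close>

lemma reversed: "ordered_quartic n (\<lambda>i j. i < n \<and> j < n \<and> F (n - 1 - i) (n - 1 - j))"
proof -
  let ?\<rho> = "\<lambda>i. n - 1 - i"
  let ?F = "\<lambda>i j. i < n \<and> j < n \<and> F (?\<rho> i) (?\<rho> j)"
  have inv: "?\<rho> (?\<rho> i) = i" "?\<rho> i < n" if "i < n" for i using that by auto
  have image: "(\<lambda>i. ?\<rho> i) ` {j. ?F i j} = {j. F (?\<rho> i) j}" if "i < n" for i
  proof (intro equalityI subsetI)
    fix j assume "j \<in> {j. F (?\<rho> i) j}"
    then have "F (?\<rho> i) j" "j < n" using adj_less(2) by auto
    then show "j \<in> (\<lambda>i. ?\<rho> i) ` {j. ?F i j}" using that inv by (intro image_eqI[of _ _ "?\<rho> j"]) auto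
  qed auto
  interpret R: quartic_rel "{..<n}" ?F
  proof (rule quartic_rel.intro)
    fix u assume u: "u \<in> {..<n}"
    have "inj_on ?\<rho> {j. ?F u j}" by (rule inj_onI) auto
    then have "card {j. ?F u j} = card {j. F (?\<rho> u) j}" using image[of u] u card_image by fastforce
    then show "card {v. ?F u v} = 4" using degree_4[of "?\<rho> u"] u by auto
  next
    fix S assume S: "S \<subseteq> {..<n}" "S \<noteq> {}" and cl: "\<And>u v. u \<in> S \<Longrightarrow> ?F u v \<Longrightarrow> v \<in> S"
    have "?\<rho> ` S = {..<n}"
    proof (rule closed_set)
      show "?\<rho> ` S \<subseteq> {..<n}" using S(1) by auto
      fix u v assume "u \<in> ?\<rho> ` S" and uv: "F u v"
      then obtain i where i: "i \<in> S" "u = ?\<rho> i" by blast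
      have "v < n" using adj_less(2)[OF uv] .
      then have "?F i (?\<rho> v)" using i uv inv S(1) by auto
      then have "?\<rho> v \<in> S" using cl i(1) by blast
      then show "v \<in> ?\<rho> ` S" using inv(1)[OF \<open>v < n\<close>] by (metis image_eqI)
    qed (use S in simp)
    moreover have "?\<rho> ` ?\<rho> ` S = S"
    proof -
      have "?\<rho> (?\<rho> i) = i" if "i \<in> S" for i using S(1) that inv by auto
      then show ?thesis by (force simp: image_image)
    qed
    moreover have "?\<rho> ` {..<n} = {..<n}"
    proof (intro equalityI subsetI)
      fix i assume "i \<in> {..<n}"
      then show "i \<in> ?\<rho> ` {..<n}" using inv by (intro image_eqI[of _ _ "?\<rho> i"]) auto
    qed auto
    ultimately show "S = {..<n}" by metis
  next
    show "?F u v \<Longrightarrow> u \<noteq> v" for u v using adj_irrefl by blast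
    show "?F u v \<Longrightarrow> ?F v u" for u v using adj_sym by blast
  qed (use verts_nonempty in auto)
  show ?thesis
  proof (rule ordered_quartic.intro[OF R.quartic_rel_axioms], rule ordered_quartic_axioms.intro)
    fix p q r s :: nat assume ord: "p < q" "q < r" "r < s"
    {
      assume "?F p s" "?F q r"
      then have lt: "s < n" and "F (?\<rho> s) (?\<rho> p)" "F (?\<rho> r) (?\<rho> q)" using adj_sym by auto
      moreover have "?\<rho> s < ?\<rho> r" "?\<rho> r < ?\<rho> q" "?\<rho> q < ?\<rho> p" using ord lt by auto
      ultimately have "F (?\<rho> s) (?\<rho> q) \<or> F (?\<rho> r) (?\<rho> p)" "F (?\<rho> s) (?\<rho> r) \<or> F (?\<rho> q) (?\<rho> p)"
        using nested1[of "?\<rho> s" "?\<rho> r" "?\<rho> q" "?\<rho> p"] nested2[of "?\<rho> s" "?\<rho> r" "?\<rho> q" "?\<rho> p"] by auto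
      moreover have "p < n" "q < n" "r < n" using ord lt by auto
      ultimately show "?F p r \<or> ?F q s" "?F p q \<or> ?F r s" using lt adj_sym by blast+
    }
    assume prqs: "?F p r" "?F q s"
    then have lt: "p < n" "q < n" "r < n" "s < n" and "F (?\<rho> s) (?\<rho> q)" "F (?\<rho> r) (?\<rho> p)" using adj_sym by auto
    moreover have "?\<rho> s < ?\<rho> r" "?\<rho> r < ?\<rho> q" "?\<rho> q < ?\<rho> p" using ord lt by auto
    ultimately consider "F (?\<rho> s) (?\<rho> r)" | "F (?\<rho> q) (?\<rho> p)" | S where "cut2 {..<n} F S (?\<rho> s) (?\<rho> q) (?\<rho> r) (?\<rho> p)"
      using crossing[of "?\<rho> s" "?\<rho> r" "?\<rho> q" "?\<rho> p"] by blast
    then show "?F p q \<or> ?F r s \<or> (\<exists>S. cut2 {..<n} ?F S p r q s)"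
    proof cases
      case 1
      then show ?thesis using lt adj_sym by blast
    next
      case 2
      then show ?thesis using lt adj_sym by blast
    next
      case 3
      have "cut2 {..<n} ?F {i. i < n \<and> ?\<rho> i \<notin> S} p r q s"
        unfolding cut2_def
      proof (intro conjI allI impI)
        fix u v assume uv: "?F u v" "u \<in> {i. i < n \<and> ?\<rho> i \<notin> S}" "v \<notin> {i. i < n \<and> ?\<rho> i \<notin> S}"
        then have "F (?\<rho> v) (?\<rho> u)" "?\<rho> v \<in> S" "?\<rho> u \<notin> S" "u < n" "v < n" using adj_sym by auto
        with cut2_leave[OF 3, of "?\<rho> v" "?\<rho> u"] have "?\<rho> v = ?\<rho> s \<and> ?\<rho> u = ?\<rho> q \<or> ?\<rho> v = ?\<rho> r \<and> ?\<rho> u = ?\<rho> p"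
          by blast
        then show "u = p \<and> v = r \<or> u = q \<and> v = s" using lt \<open>u < n\<close> \<open>v < n\<close> by auto
      qed (use 3 lt in \<open>auto simp: cut2_def\<close>)
      then show ?thesis by blast
    qed
  qed
qed

lemma later_neighbour:
  assumes "Suc r < n"
  shows "\<exists>j>r. F r j"
proof -
  interpret R: ordered_quartic n "\<lambda>i j. i < n \<and> j < n \<and> F (n - 1 - i) (n - 1 - j)" by (rule reversed)
  have "0 < n - 1 - r" "n - 1 - r < n" using assms by auto
  from R.earlier_neighbour[OF this] obtain j where "j < n - 1 - r" "F (n - 1 - j) (n - 1 - (n - 1 - r))" by blast
  then have "F (n - 1 - j) r" "r < n - 1 - j" using assms by auto
  then show ?thesis using adj_sym by blast
qed

section \<open>Stretches between consecutive positions that no edge passes\<close>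

definition stretch :: "nat \<Rightarrow> nat \<Rightarrow> bool" where
  "stretch a b \<longleftrightarrow> a < b \<and> b < n \<and> \<not> jumped a \<and> \<not> jumped b \<and> (\<forall>w. a < w \<longrightarrow> w < b \<longrightarrow> jumped w)"

lemma not_jumpedD: "\<not> jumped w \<Longrightarrow> F p s \<Longrightarrow> p < w \<Longrightarrow> s \<le> w"
  unfolding jumped_def by (meson not_le)

lemma not_jumpedD2: "\<not> jumped w \<Longrightarrow> F p s \<Longrightarrow> w < p \<Longrightarrow> w \<le> s"
  using not_jumpedD[OF _ adj_sym, of w p s] by (metis not_le)

text \<open>Avoiding \<open>w\<close>, vertices after it climb to \<open>b\<close> through later
  neighbours and vertices before it descend to \<open>a\<close> through earlier ones. If
  \<open>w\<close> lies strictly inside, an edge passing it joins the two parts.\<close>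

lemma stretch_connected:
  assumes st: "stretch a b" and ij: "i \<in> {a..b} - {w}" "j \<in> {a..b} - {w}"
  shows "(i, j) \<in> {(i, j). i \<in> {a..b} - {w} \<and> j \<in> {a..b} - {w} \<and> F i j}\<^sup>*" (is "_ \<in> ?R\<^sup>*")
proof -
  have ab: "a < b" "b < n" "\<not> jumped a" "\<not> jumped b" and btw: "\<And>w. a < w \<Longrightarrow> w < b \<Longrightarrow> jumped w"
    using st by (auto simp: stretch_def)
  have symR: "(u, v) \<in> ?R\<^sup>* \<Longrightarrow> (v, u) \<in> ?R\<^sup>*" for u v
    by (rule symD[OF sym_rtrancl]) (auto intro: symI dest: adj_sym)
  have up: "(u, b) \<in> ?R\<^sup>*" if "u \<in> {a..b}" "w < u" for u
    using that
  proof (induction "b - u" arbitrary: u rule: less_induct)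
    case less
    show ?case
    proof (cases "u = b")
      case False
      then have "u < b" using less.prems by simp
      then obtain v where v: "u < v" "F u v" using later_neighbour[of u] ab by auto
      then have "v \<le> b" using not_jumpedD[OF ab(4) v(2)] \<open>u < b\<close> by simp
      then have "(u, v) \<in> ?R" "(v, b) \<in> ?R\<^sup>*" using v less.prems less.hyps[of v] by auto
      then show ?thesis by (rule converse_rtrancl_into_rtrancl)
    qed simp
  qed
  have down: "(u, a) \<in> ?R\<^sup>*" if "u \<in> {a..b}" "u < w" for u
    using that
  proof (induction u rule: less_induct)
    case (less u)
    show ?case
    proof (cases "u = a")
      case False
      then have "a < u" using less.prems by simp
      then obtain v where v: "v < u" "F v u" using earlier_neighbour[of u] ab less.prems by auto
      have "a \<le> v" using not_jumpedD2[OF ab(3) adj_sym[OF v(2)]] \<open>a < u\<close> by simp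
      then have "(u, v) \<in> ?R" "(v, a) \<in> ?R\<^sup>*" using v less.prems less.IH[of v] adj_sym[OF v(2)] by auto
      then show ?thesis by (rule converse_rtrancl_into_rtrancl)
    qed simp
  qed
  consider "w \<le> a" | "b \<le> w" | "a < w" "w < b" by linarith
  then show ?thesis
  proof cases
    case 1
    then have "(i, b) \<in> ?R\<^sup>*" "(j, b) \<in> ?R\<^sup>*" using up[of i] up[of j] ij by auto
    then show ?thesis by (rule rtrancl_trans[OF _ symR])
  next
    case 2
    then have "(i, a) \<in> ?R\<^sup>*" "(j, a) \<in> ?R\<^sup>*" using down[of i] down[of j] ij by auto
    then show ?thesis by (rule rtrancl_trans[OF _ symR])
  next
    case 3
    obtain p s where ps: "p < w" "w < s" "F p s" using btw[OF 3] by (auto simp: jumped_def)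
    have "a \<le> p" using not_jumpedD2[OF ab(3) adj_sym[OF ps(3)]] ps 3 by simp
    moreover have "s \<le> b" using not_jumpedD[OF ab(4) ps(3)] ps 3 by simp
    ultimately have ps': "(p, s) \<in> ?R" "(p, a) \<in> ?R\<^sup>*" "(s, b) \<in> ?R\<^sup>*"
      using ps 3 up[of s] down[of p] by simp_all
    have ba: "(a, b) \<in> ?R\<^sup>*"
      by (rule rtrancl_trans[OF symR[OF ps'(2)] converse_rtrancl_into_rtrancl[OF ps'(1,3)]])
    have "(u, b) \<in> ?R\<^sup>*" if "u \<in> {a..b} - {w}" for u
    proof (cases "w < u")
      case False
      then have "(u, a) \<in> ?R\<^sup>*" using down[of u] that by auto
      then show ?thesis using ba by (rule rtrancl_trans)
    qed (use up that in auto)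
    from this[OF ij(1)] symR[OF this[OF ij(2)]] show ?thesis by (rule rtrancl_trans)
  qed
qed

lemma stretch_ending_at:
  assumes "\<not> jumped b" "0 < b" "b < n"
  obtains a where "stretch a b"
proof -
  let ?A = "{w. w < b \<and> \<not> jumped w}"
  have "0 \<in> ?A" using assms by (auto simp: jumped_def)
  then have "Max ?A \<in> ?A" by (intro Max_in) auto
  moreover have "jumped w" if "Max ?A < w" "w < b" for w
  proof (rule ccontr)
    assume "\<not> jumped w"
    then have "w \<le> Max ?A" using that(2) by (intro Max_ge) auto
    then show False using that(1) by simp
  qed
  ultimately have "stretch (Max ?A) b" using assms unfolding stretch_def by blast
  then show thesis by (rule that)
qed

lemma stretch_unique:
  assumes "stretch a b" "stretch a' b'" "a' \<le> a" "b \<le> b'"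
  shows "a' = a \<and> b' = b"
proof -
  have "\<not> a' < a" "\<not> b < b'" using assms unfolding stretch_def by (meson le_less_trans less_le_trans)+
  then show ?thesis using assms(3,4) by simp
qed

lemma not_jumped_last: "\<not> jumped (n - 1)"
  using adj_less(2) by (fastforce simp: jumped_def)

lemma two_verts: "Suc 0 < n"
proof (rule ccontr)
  assume "\<not> ?thesis"
  then have "v = 0" if "F 0 v" for v using adj_less(2)[OF that] by simp
  then have "card {v. F 0 v} \<le> card {0 :: nat}" by (intro card_mono) auto
  moreover have "card {v. F 0 v} = 4" using degree_4[of 0] verts_nonempty by (simp add: lessThan_empty_iff)
  ultimately show False by simp
qed

lemma card_backward_cutpos:
  assumes w: "cutpos w"
  shows "card {j. j < w \<and> F w j} = 2"
proof -
  have "j < w \<or> w < j" if "F w j" for j using adj_irrefl[OF that] by linarith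
  then have eq: "{j. F w j} = {j. w < j \<and> F w j} \<union> {j. j < w \<and> F w j}" by blast
  have fin: "finite {j. w < j \<and> F w j}" "finite {j. j < w \<and> F w j}"
    by (rule finite_subset[OF _ finite_neighbours[of w]], blast)+
  have "card {j. F w j} = card {j. w < j \<and> F w j} + card {j. j < w \<and> F w j}"
    unfolding eq by (rule card_Un_disjoint[OF fin]) auto
  then show ?thesis using degree_4[of w] card_forward_cutpos[OF w] w by (simp add: cutpos_def)
qed

end

context ordered_quartic
begin

text \<open>Reversal maps positions passed by an edge to such positions, so the last cut position
  becomes the first one of the reversed numbering and \<open>left_end\<close> applies.\<close>

lemma right_end:
  assumes w: "cutpos w" and greatest: "\<And>u. cutpos u \<Longrightarrow> u \<le> w"
  shows "left_end_type (segment F {w..<n} {} {w})"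
proof -
  let ?\<rho> = "\<lambda>i. n - 1 - i"
  let ?F = "\<lambda>i j. i < n \<and> j < n \<and> F (?\<rho> i) (?\<rho> j)"
  interpret R: ordered_quartic n ?F by (rule reversed)
  have wn: "0 < w" "Suc w < n" "\<not> jumped w" using w by (auto simp: cutpos_def)
  have jumpedR: "R.jumped u" if u: "jumped (?\<rho> u)" "u < n" for u
  proof -
    obtain p s where ps: "p < ?\<rho> u" "?\<rho> u < s" "F p s" using u(1) by (auto simp: jumped_def)
    have lt: "s < n" "p < n" using adj_less[OF ps(3)] by auto
    then have "?\<rho> s < u" "u < ?\<rho> p" "?F (?\<rho> s) (?\<rho> p)" using ps adj_sym[OF ps(3)] by auto
    then show ?thesis unfolding R.jumped_def by blast
  qed
  have Rjumped: "jumped (?\<rho> u)" if u: "R.jumped u" for u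
  proof -
    obtain p s where ps: "p < u" "u < s" "?F p s" using u unfolding R.jumped_def by blast
    then have "?\<rho> s < ?\<rho> u" "?\<rho> u < ?\<rho> p" by auto
    moreover have "F (?\<rho> s) (?\<rho> p)" using ps(3) adj_sym by blast
    ultimately show ?thesis unfolding jumped_def by blast
  qed
  have inv: "?\<rho> (?\<rho> w) = w" using wn by simp
  have "\<not> R.jumped (?\<rho> w)" using Rjumped[of "?\<rho> w"] wn(3) unfolding inv by blast
  moreover have "0 < ?\<rho> w" "Suc (?\<rho> w) < n" using wn by auto
  ultimately have cR: "R.cutpos (?\<rho> w)" unfolding R.cutpos_def by blast
  have least: "?\<rho> w \<le> u" if "R.cutpos u" for u
  proof -
    have u: "0 < u" "Suc u < n" "\<not> R.jumped u" using that unfolding R.cutpos_def by blast+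
    then have "\<not> jumped (?\<rho> u)" using jumpedR[of u] by linarith
    moreover have "0 < ?\<rho> u" "Suc (?\<rho> u) < n" using u by auto
    ultimately have "cutpos (?\<rho> u)" unfolding cutpos_def by blast
    then show ?thesis using greatest[of "?\<rho> u"] u by auto
  qed
  note R.left_end[OF cR least]
  moreover have "piece_map ?\<rho> (segment F {w..<n} {} {w}) (segment ?F {0..<Suc (?\<rho> w)} {} {?\<rho> w})"
  proof -
    have verts: "?\<rho> ` {w..<n} = {0..<Suc (?\<rho> w)}"
    proof (intro equalityI subsetI)
      fix i assume "i \<in> {0..<Suc (?\<rho> w)}"
      then have "?\<rho> i \<in> {w..<n}" "i = ?\<rho> (?\<rho> i)" using wn by auto
      then show "i \<in> ?\<rho> ` {w..<n}" by blast
    qed (use wn in auto)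
    have "map_prod ?\<rho> ?\<rho> ` {(i, j). i \<in> {w..<n} \<and> j \<in> {w..<n} \<and> F i j} =
        {(i, j). i \<in> {0..<Suc (?\<rho> w)} \<and> j \<in> {0..<Suc (?\<rho> w)} \<and> ?F i j}" (is "?L = ?R")
    proof (intro equalityI subsetI)
      fix e assume "e \<in> ?L"
      then obtain i j where ij: "i \<in> {w..<n}" "j \<in> {w..<n}" "F i j" "e = (?\<rho> i, ?\<rho> j)" by force
      then have "?\<rho> (?\<rho> i) = i" "?\<rho> (?\<rho> j) = j" by auto
      then have "?F (?\<rho> i) (?\<rho> j)" using ij by auto
      then show "e \<in> ?R" using ij verts by blast
    next
      fix e assume "e \<in> ?R"
      then obtain i j where ij: "i \<in> {0..<Suc (?\<rho> w)}" "j \<in> {0..<Suc (?\<rho> w)}" "?F i j" "e = (i, j)" by blast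
      then have "?\<rho> i \<in> {w..<n}" "?\<rho> j \<in> {w..<n}" "F (?\<rho> i) (?\<rho> j)" "e = map_prod ?\<rho> ?\<rho> (?\<rho> i, ?\<rho> j)"
        using wn by auto
      then show "e \<in> ?L" by blast
    qed
    moreover have "inj_on ?\<rho> {w..<n}" by (rule inj_onI) auto
    ultimately show ?thesis using verts by (simp add: piece_map_def)
  qed
  moreover have "wf_piece (segment F {w..<n} {} {w})" using wn by (auto simp: wf_piece_def)
  ultimately show ?thesis using left_end_type_trans by blast
qed

end

section \<open>Transfer to the vertices of the given graph\<close>

locale numbered_graph = ordered_quartic n F for n :: nat and F +
  fixes G :: "'a pair_pre_digraph" and vt :: "nat \<Rightarrow> 'a"
  assumes bij: "bij_betw vt {..<n} (pverts G)"
    and arcs_iff: "(u, v) \<in> parcs G \<longleftrightarrow> (\<exists>i j. F i j \<and> u = vt i \<and> v = vt j)"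
begin

lemma vt_eq_iff: "i < n \<Longrightarrow> j < n \<Longrightarrow> vt i = vt j \<longleftrightarrow> i = j"
  using bij by (auto simp: bij_betw_def inj_on_def)

lemma vert_obtain: "u \<in> pverts G \<Longrightarrow> \<exists>i<n. u = vt i"
  using bij by (auto simp: bij_betw_def)

lemma vt_vert: "i < n \<Longrightarrow> vt i \<in> pverts G"
  using bij by (auto simp: bij_betw_def)

definition part :: "nat set \<Rightarrow> 'a pair_pre_digraph" where
  "part A = \<lparr>pverts = vt ` A, parcs = {(vt i, vt j) | i j. i \<in> A \<and> j \<in> A \<and> F i j}\<rparr>"

lemma part_simps [simp]:
  "pverts (part A) = vt ` A" "parcs (part A) = {(vt i, vt j) | i j. i \<in> A \<and> j \<in> A \<and> F i j}"
  by (simp_all add: part_def)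

lemma part_all: "part {..<n} = G"
proof -
  have "pverts (part {..<n}) = pverts G" using bij by (simp add: bij_betw_def)
  moreover have "parcs (part {..<n}) = parcs G" 
  proof (intro equalityI subsetI)
    fix e assume "e \<in> parcs G"
    then obtain i j where ij: "F i j" "e = (vt i, vt j)" using arcs_iff by (cases e) blast
    then show "e \<in> parcs (part {..<n})" using adj_less[OF ij(1)] by auto
  next
    fix e assume "e \<in> parcs (part {..<n})"
    then obtain i j where "F i j" "e = (vt i, vt j)" by auto
    then show "e \<in> parcs G" using arcs_iff by blast
  qed
  ultimately show ?thesis by (simp add: pair_pre_digraph.equality)
qed

lemma pair_graph_part:
  assumes "A \<subseteq> {..<n}"
  shows "pair_graph (part A)"
proof -
  have fin: "finite (vt ` A)" using assms finite_subset by blast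
  have sub: "parcs (part A) \<subseteq> vt ` A \<times> vt ` A" by auto
  show ?thesis
  proof
    show "finite (parcs (part A))" using finite_subset[OF sub] fin by blast
    show "symmetric (with_proj (part A))"
      unfolding symmetric_def by (rule symI) (auto dest: adj_sym)
    fix e assume "e \<in> parcs (part A)"
    then obtain i j where e: "e = (vt i, vt j)" "i \<in> A" "j \<in> A" "F i j" by auto
    show "fst e \<in> pverts (part A)" "snd e \<in> pverts (part A)" using e by auto
    show "fst e \<noteq> snd e" using e adj_irrefl[OF e(4)] vt_eq_iff[OF adj_less[OF e(4)]] by simp
  qed (use fin in simp)
qed

lemma subgraph_part:
  assumes "A \<subseteq> B" "B \<subseteq> {..<n}"
  shows "subgraph (with_proj (part A)) (with_proj (part B))"
proof -
  interpret A: pair_graph "part A" by (rule pair_graph_part) (use assms in blast)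
  interpret B: pair_graph "part B" by (rule pair_graph_part) (use assms in blast)
  show ?thesis
    unfolding subgraph_def using assms(1) A.wf_digraph B.wf_digraph
    by (auto simp: compatible_def)
qed

lemma is_block_stretch:
  assumes st: "stretch a b"
  shows "is_block (with_proj (part {a..b}))"
proof -
  have ab: "a < b" "b < n" using st by (auto simp: stretch_def)
  have off: "(vt i, vt j) \<in> (arcs_off (part {a..b}) (vt w))\<^sup>*"
    if "i \<in> {a..b} - {w}" "j \<in> {a..b} - {w}" "w < n" for i j w
  proof (rule rtrancl_image[OF stretch_connected[OF st that(1,2)]])
    fix k l assume "(k, l) \<in> {(i, j). i \<in> {a..b} - {w} \<and> j \<in> {a..b} - {w} \<and> F i j}"
    then have kl: "k \<in> {a..b}" "l \<in> {a..b}" "k \<noteq> w" "l \<noteq> w" "F k l" by auto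
    then have "vt k \<noteq> vt w" "vt l \<noteq> vt w" using vt_eq_iff that(3) adj_less[OF kl(5)] by auto
    then show "(vt k, vt l) \<in> arcs_off (part {a..b}) (vt w)" using kl by (auto simp: arcs_off_def)
  qed
  \<comment> \<open>Removing \<open>n\<close>, which is not a vertex, leaves the interval unchanged
    and gives plain connectedness.\<close>
  have conn: "(vt i, vt j) \<in> (parcs (part {a..b}))\<^sup>*" if "i \<in> {a..b}" "j \<in> {a..b}" for i j
  proof (rule rtrancl_image[OF stretch_connected[OF st, of i n j]])
    show "i \<in> {a..b} - {n}" "j \<in> {a..b} - {n}" using that ab by auto
    fix k l assume "(k, l) \<in> {(i, j). i \<in> {a..b} - {n} \<and> j \<in> {a..b} - {n} \<and> F i j}"
    then show "(vt k, vt l) \<in> parcs (part {a..b})" by auto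
  qed
  have "pair_graph (part {a..b})" by (rule pair_graph_part) (use ab in auto)
  moreover have "(u, w) \<in> (arcs_off (part {a..b}) v)\<^sup>*"
    if v: "v \<in> vt ` {a..b}" and u: "u \<in> vt ` {a..b} - {v}" and w: "w \<in> vt ` {a..b} - {v}" for u v w
  proof -
    obtain k i j where "k \<in> {a..b}" "i \<in> {a..b}" "j \<in> {a..b}" "v = vt k" "u = vt i" "w = vt j"
      using v u w by blast
    then show ?thesis using off[of i k j] u w ab by auto
  qed
  ultimately show ?thesis unfolding is_block_iff using conn ab by auto
qed

text \<open>By induction, a walk that starts before \<open>w\<close> and avoids it stays before it,
  since no edge passes \<open>w\<close>.\<close>

lemma separates:
  assumes K: "pverts K \<subseteq> pverts G" "parcs K \<subseteq> parcs G" and w: "\<not> jumped w"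
    and i: "i < w" and j: "w < j" "j < n"
  shows "(vt i, vt j) \<notin> (arcs_off K (vt w))\<^sup>*"
proof
  assume "(vt i, vt j) \<in> (arcs_off K (vt w))\<^sup>*"
  then have "vt j \<in> vt ` {..<w}"
  proof induction
    case (step y z)
    obtain k where k: "k < w" "y = vt k" using step.IH by blast
    have yz: "(y, z) \<in> parcs G" "z \<noteq> vt w" using step.hyps(2) K(2) by (auto simp: arcs_off_def)
    then obtain k' l where kl: "F k' l" "y = vt k'" "z = vt l" using arcs_iff by blast
    have "k' = k" using vt_eq_iff[of k' k] kl k w adj_less[OF kl(1)] j by simp
    then have "l \<le> w" using not_jumpedD[OF w kl(1)] k by simp
    moreover have "l \<noteq> w" using yz(2) kl(3) by blast
    ultimately show ?case using kl(3) by simp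
  qed (use i in blast)
  then obtain k where "k < w" "vt j = vt k" by blast
  then show False using vt_eq_iff[of j k] j by simp
qed

lemma block_not_separated:
  assumes blk: "is_block (with_proj K)" and K: "pverts K \<subseteq> pverts G" "parcs K \<subseteq> parcs G" and w: "\<not> jumped w"
    and i: "i < w" "vt i \<in> pverts K" and j: "w < j" "j < n" "vt j \<in> pverts K"
  shows False
proof -
  note sep = separates[OF K w i(1) j(1,2)]
  interpret pair_graph K using blk unfolding is_block_iff by blast
  show False
  proof (cases "vt w \<in> pverts K")
    case True
    have "vt i \<noteq> vt w" "vt j \<noteq> vt w" using vt_eq_iff i j by simp_all
    then show False using blk sep True i(2) j(3) unfolding is_block_iff by blast
  next
    case False
    have "arcs_off K (vt w) = parcs K" using False in_arcsD1 in_arcsD2 by (auto simp: arcs_off_def)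
    then show False using blk sep i(2) j(3) unfolding is_block_iff by auto
  qed
qed

lemma block_within_stretch:
  assumes blk: "is_block (with_proj K)" and K: "pverts K \<subseteq> pverts G" "parcs K \<subseteq> parcs G"
  obtains a b where "stretch a b" "pverts K \<subseteq> vt ` {a..b}" "parcs K \<subseteq> parcs (part {a..b})"
proof -
  interpret pair_graph K using blk unfolding is_block_iff by blast
  let ?I = "{i. i < n \<and> vt i \<in> pverts K}"
  have "pverts K \<noteq> {}" using blk by (simp add: is_block_iff)
  then have "?I \<noteq> {}" using vert_obtain K(1) by blast
  then have m: "Min ?I \<in> ?I" by (intro Min_in) auto
  have least: "Min ?I \<le> i" if "i \<in> ?I" for i using that by (intro Min_le) auto
  define m where "m = Min ?I"
  have m: "m < n" "vt m \<in> pverts K" "\<And>i. i < n \<Longrightarrow> vt i \<in> pverts K \<Longrightarrow> m \<le> i"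
    using m least unfolding m_def by auto
  \<comment> \<open>The first position after \<open>m\<close> that no edge passes; the alternative
    \<open>b = n - 1\<close> covers the case that \<open>m\<close> is the last vertex.\<close>
  define b where "b = (LEAST b. \<not> jumped b \<and> (m < b \<or> b = n - 1))"
  have b: "\<not> jumped b" "m < b \<or> b = n - 1" and b_least: "\<And>w. \<not> jumped w \<Longrightarrow> m < w \<or> w = n - 1 \<Longrightarrow> b \<le> w"
    using LeastI[of "\<lambda>b. \<not> jumped b \<and> (m < b \<or> b = n - 1)" "n - 1"] not_jumped_last
      Least_le[of "\<lambda>b. \<not> jumped b \<and> (m < b \<or> b = n - 1)"] unfolding b_def by blast+
  have "b \<le> n - 1" using b_least[of "n - 1"] not_jumped_last by blast
  then have bn: "0 < b" "b < n" using b(2) two_verts by auto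
  obtain a where st: "stretch a b" using stretch_ending_at[OF b(1) bn] .
  have a: "a < b" "\<not> jumped a" using st by (auto simp: stretch_def)
  have "\<not> m < a" using b_least[of a] a by auto
  have within: "i \<in> {a..b}" if i: "i < n" "vt i \<in> pverts K" for i
  proof -
    have "\<not> b < i"
    proof
      assume "b < i"
      then have "m < b" using b(2) i(1) by auto
      then show False using block_not_separated[OF blk K b(1) _ m(2) \<open>b < i\<close> i] by blast
    qed
    then show ?thesis using m(3)[OF i] \<open>\<not> m < a\<close> by auto
  qed
  have verts: "pverts K \<subseteq> vt ` {a..b}"
  proof
    fix u assume u: "u \<in> pverts K"
    then obtain i where "i < n" "u = vt i" using vert_obtain K(1) by blast
    then show "u \<in> vt ` {a..b}" using within u by blast
  qed
  moreover have "parcs K \<subseteq> parcs (part {a..b})"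
  proof
    fix e assume e: "e \<in> parcs K"
    obtain i j where ij: "F i j" "e = (vt i, vt j)" using K(2) e arcs_iff by (cases e) blast
    have "vt i \<in> pverts K" "vt j \<in> pverts K" using e ij(2) in_arcsD1 in_arcsD2 by auto
    then show "e \<in> parcs (part {a..b})" using ij within adj_less[OF ij(1)] by auto
  qed
  ultimately show thesis using st that by blast
qed

text \<open>Every subgraph that is a block lies within a stretch, stretches are themselves blocks,
  and none lies properly within another; so they are the maximal ones.\<close>

lemma block_of_iff: "block_of G C \<longleftrightarrow> (\<exists>a b. stretch a b \<and> C = part {a..b})"
proof -
  have sub: "subgraph (with_proj (part {a..b})) (with_proj G)" if "stretch a b" for a b
  proof -
    have "{a..b} \<subseteq> {..<n}" using that by (auto simp: stretch_def)
    then show ?thesis using subgraph_part[of "{a..b}" "{..<n}"] part_all by simp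
  qed
  have inside: "\<exists>a b. stretch a b \<and> subgraph H (with_proj (part {a..b}))"
    if H: "subgraph H (with_proj G)" "is_block H" for H
  proof -
    obtain K where K: "H = with_proj K" "pverts K \<subseteq> pverts G" "parcs K \<subseteq> parcs G" using subgraph_with_projE[OF H(1)] .
    obtain a b where ab: "stretch a b" "pverts K \<subseteq> vt ` {a..b}" "parcs K \<subseteq> parcs (part {a..b})"
      using block_within_stretch[of K] H(2) K by blast
    have "wf_digraph (with_proj (part {a..b}))" using sub[OF ab(1)] by (simp add: subgraph_def)
    then have "subgraph H (with_proj (part {a..b}))"
      using H(1) ab K(1) by (auto simp: subgraph_def compatible_def)
    then show ?thesis using ab(1) by blast
  qed
  have antisym: "H = H'" if "subgraph H H'" "subgraph H' H" for H H' :: "('a, 'a \<times> 'a) pre_digraph"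
    using that by (auto simp: subgraph_def compatible_def)
  have inj: "C = D" if "with_proj C = with_proj D" for C D :: "'a pair_pre_digraph"
    using that by (cases C, cases D) (simp add: with_proj_def)
  show ?thesis
  proof
    assume C: "block_of G C"
    then obtain a b where ab: "stretch a b" "subgraph (with_proj C) (with_proj (part {a..b}))"
      using inside unfolding block_of_def pre_digraph.max_subgraph_def by blast
    have "with_proj (part {a..b}) = with_proj C"
      using C ab(2) sub[OF ab(1)] is_block_stretch[OF ab(1)]
      unfolding block_of_def pre_digraph.max_subgraph_def by blast
    then show "\<exists>a b. stretch a b \<and> C = part {a..b}" using ab(1) inj by blast
  next
    assume "\<exists>a b. stretch a b \<and> C = part {a..b}"
    then obtain a b where ab: "stretch a b" and C: "C = part {a..b}" by blast
    have "H = with_proj (part {a..b})"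
      if H: "subgraph (with_proj (part {a..b})) H" "subgraph H (with_proj G)" "is_block H" for H
    proof -
      obtain a' b' where ab': "stretch a' b'" "subgraph H (with_proj (part {a'..b'}))" using inside[OF H(2,3)] by blast
      have "vt ` {a..b} \<subseteq> vt ` {a'..b'}" using H(1) ab'(2) unfolding subgraph_def by auto
      moreover have le: "a < b" "b < n" "b' < n" using ab ab'(1) by (auto simp: stretch_def)
      ultimately have "vt a \<in> vt ` {a'..b'}" "vt b \<in> vt ` {a'..b'}" by auto
      then have "a' \<le> a" "b \<le> b'" using le vt_eq_iff by (auto simp: image_iff)
      then have "a' = a \<and> b' = b" by (rule stretch_unique[OF ab ab'(1)])
      then show ?thesis using antisym H(1) ab'(2) by blast
    qed
    then show "block_of G C"
      unfolding block_of_def pre_digraph.max_subgraph_def C using sub[OF ab] is_block_stretch[OF ab] by blast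
  qed
qed

lemma connected_arcs: "u \<in> pverts G \<Longrightarrow> w \<in> pverts G \<Longrightarrow> (u, w) \<in> (parcs G)\<^sup>*"
proof -
  assume u: "u \<in> pverts G" and w: "w \<in> pverts G"
  obtain k where k: "k < n" "u = vt k" using vert_obtain[OF u] by blast
  have "{i. i < n \<and> (u, vt i) \<in> (parcs G)\<^sup>*} = {..<n}"
  proof (rule closed_set)
    fix i j assume i: "i \<in> {i. i < n \<and> (u, vt i) \<in> (parcs G)\<^sup>*}" and ij: "F i j"
    have "(vt i, vt j) \<in> parcs G" using ij arcs_iff by blast
    then show "j \<in> {i. i < n \<and> (u, vt i) \<in> (parcs G)\<^sup>*}"
      using i adj_less[OF ij] by (auto intro: rtrancl_into_rtrancl)
  qed (use k in auto)
  then show "(u, w) \<in> (parcs G)\<^sup>*" using vert_obtain[OF w] by blast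
qed

lemma cut_vertex_cutpos:
  assumes w: "cutpos w"
  shows "cut_vertex (with_proj G) (vt w)"
proof -
  interpret pair_graph G using pair_graph_part[of "{..<n}"] part_all by simp
  have w': "0 < w" "Suc w < n" "\<not> jumped w" using w by (auto simp: cutpos_def)
  have lt: "0 < n" "n - 1 < n" "w < n" "w < n - 1" using w' by auto
  have "(vt 0, vt (n - 1)) \<notin> (arcs_off G (vt w))\<^sup>*"
    by (rule separates[OF subset_refl subset_refl w'(3,1) lt(4,2)])
  moreover have "vt 0 \<noteq> vt w" "vt (n - 1) \<noteq> vt w" using vt_eq_iff lt w' by auto
  moreover have "parcs G \<subseteq> pverts G \<times> pverts G" using in_arcsD1 in_arcsD2 by auto
  ultimately show ?thesis
    using connected_arcs vt_vert lt unfolding cut_vertex_iff[OF \<open>parcs G \<subseteq> _\<close>] by blast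
qed

text \<open>Without cut positions the whole range from 0 to \<open>n - 1\<close> is a single
  stretch.\<close>

lemma is_block_iff_no_cutpos: "is_block (with_proj G) \<longleftrightarrow> (\<forall>w. \<not> cutpos w)"
proof
  assume "is_block (with_proj G)"
  then show "\<forall>w. \<not> cutpos w" using cut_vertex_cutpos unfolding is_block_def by blast
next
  assume none: "\<forall>w. \<not> cutpos w"
  have "jumped w" if "0 < w" "w < n - 1" for w
  proof -
    have "Suc w < n" using that by simp
    then show ?thesis using none that unfolding cutpos_def by blast
  qed
  moreover have "\<not> jumped 0" by (simp add: jumped_def)
  ultimately have "stretch 0 (n - 1)" using not_jumped_last two_verts by (simp add: stretch_def)
  moreover have "{0..n - 1} = {..<n}" using two_verts by auto
  ultimately show "is_block (with_proj G)" using is_block_stretch[of 0 "n - 1"] part_all by simp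
qed


section \<open>The blocks in order\<close>

text \<open>Both extremes 0 and \<open>n - 1\<close> are included, so that consecutive entries
  delimit the blocks.\<close>

definition boundaries :: "nat list" where
  "boundaries = sorted_list_of_set {w. w < n \<and> \<not> jumped w}"

lemma set_boundaries: "set boundaries = {w. w < n \<and> \<not> jumped w}"
  by (simp add: boundaries_def)

lemma boundaries_nth: "i < length boundaries \<Longrightarrow> boundaries ! i < n \<and> \<not> jumped (boundaries ! i)"
  using nth_mem[of i boundaries] set_boundaries by auto

lemma boundaries_less: "i < j \<Longrightarrow> j < length boundaries \<Longrightarrow> boundaries ! i < boundaries ! j"
  unfolding boundaries_def using sorted_wrt_nth_less[OF strict_sorted_list_of_set] by blast

lemma boundaries_obtain:
  assumes "w < n" "\<not> jumped w"
  obtains i where "i < length boundaries" "boundaries ! i = w"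
  using assms set_boundaries by (metis (mono_tags, lifting) in_set_conv_nth mem_Collect_eq)

lemma boundaries_first: "boundaries \<noteq> []" "boundaries ! 0 = 0"
proof -
  have "\<not> jumped 0" "0 < n" using two_verts by (auto simp: jumped_def)
  then obtain i where i: "i < length boundaries" "boundaries ! i = 0" using boundaries_obtain by blast
  then show "boundaries \<noteq> []" by auto
  have "\<not> 0 < i" using boundaries_less[of 0 i] i by auto
  then show "boundaries ! 0 = 0" using i by simp
qed

lemma boundaries_last: "boundaries ! (length boundaries - 1) = n - 1"
proof -
  have "n - 1 < n" using two_verts by simp
  then obtain i where i: "i < length boundaries" "boundaries ! i = n - 1"
    using boundaries_obtain not_jumped_last by blast
  have "\<not> i < length boundaries - 1"
  proof
    assume "i < length boundaries - 1"
    then have "boundaries ! (length boundaries - 1) < n" "n - 1 < boundaries ! (length boundaries - 1)"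
      using boundaries_nth[of "length boundaries - 1"] boundaries_less[of i "length boundaries - 1"] i by auto
    then show False by simp
  qed
  then have "i = length boundaries - 1" using i(1) by simp
  then show ?thesis using i(2) by simp
qed

lemma stretch_boundaries:
  assumes "Suc i < length boundaries"
  shows "stretch (boundaries ! i) (boundaries ! Suc i)"
proof -
  have "jumped w" if w: "boundaries ! i < w" "w < boundaries ! Suc i" for w
  proof (rule ccontr)
    assume "\<not> jumped w"
    moreover have "w < n" using boundaries_nth[OF assms] w by simp
    ultimately obtain k where k: "k < length boundaries" "boundaries ! k = w" using boundaries_obtain by blast
    have "\<not> k < i" "k \<noteq> i" "\<not> Suc i < k" "k \<noteq> Suc i"
      using boundaries_less[of k i] boundaries_less[of "Suc i" k] k w assms by auto
    then show False by linarith
  qed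
  then show ?thesis
    unfolding stretch_def using boundaries_nth[of i] boundaries_nth[OF assms] boundaries_less[of i "Suc i"] assms by auto
qed

lemma stretch_boundariesE:
  assumes "stretch a b"
  obtains i where "Suc i < length boundaries" "a = boundaries ! i" "b = boundaries ! Suc i"
proof -
  have ab: "a < b" "b < n" "\<not> jumped a" "\<not> jumped b" "\<And>w. a < w \<Longrightarrow> w < b \<Longrightarrow> jumped w"
    using assms by (auto simp: stretch_def)
  have "a < n" using ab by simp
  obtain i where i: "i < length boundaries" "boundaries ! i = a" using boundaries_obtain[OF \<open>a < n\<close> ab(3)] .
  obtain j where j: "j < length boundaries" "boundaries ! j = b" using boundaries_obtain[OF ab(2,4)] .
  have "\<not> j \<le> i" using boundaries_less[of j i] i j ab(1) by (cases "j = i") auto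
  moreover have "\<not> Suc i < j"
  proof
    assume *: "Suc i < j"
    then have "a < boundaries ! Suc i" "boundaries ! Suc i < b"
      using boundaries_less[of i "Suc i"] boundaries_less[of "Suc i" j] i j by auto
    then show False using ab(5) boundaries_nth[of "Suc i"] * j by auto
  qed
  ultimately have "j = Suc i" by simp
  then show thesis using that i j by blast
qed

lemma cutpos_boundaries: "0 < i \<Longrightarrow> Suc i < length boundaries \<Longrightarrow> cutpos (boundaries ! i)"
  using boundaries_less[of 0 i] boundaries_less[of i "Suc i"] boundaries_nth[of i] boundaries_nth[of "Suc i"]
  by (auto simp: cutpos_def)

definition parts :: "'a pair_pre_digraph list" where
  "parts = map (\<lambda>i. part {boundaries ! i..boundaries ! Suc i}) [0..<length boundaries - 1]"

lemma length_parts: "length parts = length boundaries - 1"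
  by (simp add: parts_def)

lemma parts_nth: "i < length parts \<Longrightarrow> parts ! i = part {boundaries ! i..boundaries ! Suc i}"
  by (simp add: parts_def)

lemma set_parts: "set parts = {C. block_of G C}"
proof (intro equalityI subsetI)
  fix C assume "C \<in> set parts"
  then obtain i where i: "i < length parts" "parts ! i = C" by (auto simp: in_set_conv_nth)
  then have "Suc i < length boundaries" by (simp add: length_parts)
  then show "C \<in> {C. block_of G C}" using stretch_boundaries parts_nth[OF i(1)] i(2) block_of_iff by blast
next
  fix C assume "C \<in> {C. block_of G C}"
  then obtain a b where ab: "stretch a b" "C = part {a..b}" using block_of_iff by blast
  obtain i where i: "Suc i < length boundaries" "a = boundaries ! i" "b = boundaries ! Suc i"
    using stretch_boundariesE[OF ab(1)] .
  then have "i < length parts" by (simp add: length_parts)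
  then show "C \<in> set parts" using parts_nth[of i] i ab(2) nth_mem[of i parts] by simp
qed

lemma vt_image_Int: "A \<subseteq> {..<n} \<Longrightarrow> B \<subseteq> {..<n} \<Longrightarrow> vt ` A \<inter> vt ` B = vt ` (A \<inter> B)"
  using bij inj_on_image_Int[of vt "{..<n}" A B] unfolding bij_betw_def by blast

lemma parts_verts:
  assumes "i < length parts"
  shows "pverts (parts ! i) = vt ` {boundaries ! i..boundaries ! Suc i}" "{boundaries ! i..boundaries ! Suc i} \<subseteq> {..<n}"
    "boundaries ! i < boundaries ! Suc i"
proof -
  have lt: "Suc i < length boundaries" using assms by (simp add: length_parts)
  show "pverts (parts ! i) = vt ` {boundaries ! i..boundaries ! Suc i}" using parts_nth[OF assms] by simp
  show "{boundaries ! i..boundaries ! Suc i} \<subseteq> {..<n}" using boundaries_nth[OF lt] by auto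
  show "boundaries ! i < boundaries ! Suc i" using boundaries_less[OF lessI lt] .
qed

lemma parts_Int_next:
  assumes "Suc i < length parts"
  shows "pverts (parts ! i) \<inter> pverts (parts ! Suc i) = {vt (boundaries ! Suc i)}"
proof -
  have "{boundaries ! i..boundaries ! Suc i} \<inter> {boundaries ! Suc i..boundaries ! Suc (Suc i)} = {boundaries ! Suc i}"
    using parts_verts(3)[of i] parts_verts(3)[OF assms] assms by auto
  then show ?thesis
    using parts_verts(1,2)[of i] parts_verts(1,2)[OF assms] assms by (simp add: vt_image_Int)
qed

lemma parts_Int_far:
  assumes "Suc i < j" "j < length parts"
  shows "pverts (parts ! i) \<inter> pverts (parts ! j) = {}"
proof -
  have "boundaries ! Suc i < boundaries ! j" using boundaries_less[OF assms(1)] assms(2) by (simp add: length_parts)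
  then have "{boundaries ! i..boundaries ! Suc i} \<inter> {boundaries ! j..boundaries ! Suc j} = {}" by auto
  then show ?thesis
    using parts_verts(1,2)[of i] parts_verts(1,2)[OF assms(2)] assms by (simp add: vt_image_Int)
qed

lemma distinct_parts: "distinct parts"
proof -
  have "parts ! i \<noteq> parts ! j" if ij: "i < j" "j < length parts" for i j
  proof
    assume eq: "parts ! i = parts ! j"
    have j: "boundaries ! j < boundaries ! Suc j" "boundaries ! Suc j < n"
      using parts_verts(3)[OF ij(2)] boundaries_nth[of "Suc j"] ij by (auto simp: length_parts)
    have "vt (boundaries ! Suc j) \<in> pverts (parts ! i)" unfolding eq using parts_verts(1)[OF ij(2)] j by simp
    then obtain k where k: "k \<le> boundaries ! Suc i" "vt (boundaries ! Suc j) = vt k"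
      using parts_verts(1)[of i] ij by auto
    have le: "boundaries ! Suc i < boundaries ! Suc j"
      using boundaries_less[of "Suc i" "Suc j"] ij by (simp add: length_parts)
    then have "k < n" using k j by simp
    then have "boundaries ! Suc j = k" using k(2) vt_eq_iff j(2) by blast
    then show False using k(1) le by simp
  qed
  then have "parts ! i \<noteq> parts ! j" if "i < length parts" "j < length parts" "i \<noteq> j" for i j
    using that by (metis nat_neq_iff)
  then show ?thesis by (simp add: distinct_conv_nth)
qed

lemma out_degree_part:
  assumes "A \<subseteq> {..<n}" "w \<in> A"
  shows "out_degree (with_proj (part A)) (vt w) = card {j. j \<in> A \<and> F w j}"
proof -
  have "out_arcs (with_proj (part A)) (vt w) = (\<lambda>j. (vt w, vt j)) ` {j. j \<in> A \<and> F w j}"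
  proof (intro equalityI subsetI)
    fix e assume "e \<in> out_arcs (with_proj (part A)) (vt w)"
    then obtain i j where ij: "e = (vt i, vt j)" "i \<in> A" "j \<in> A" "F i j" "vt i = vt w" by (auto simp: out_arcs_def)
    then have "i = w" using vt_eq_iff assms by auto
    then show "e \<in> (\<lambda>j. (vt w, vt j)) ` {j. j \<in> A \<and> F w j}" using ij by blast
  qed (use assms(2) in \<open>auto simp: out_arcs_def\<close>)
  moreover have "inj_on (\<lambda>j. (vt w, vt j)) {j. j \<in> A \<and> F w j}"
    using assms(1) vt_eq_iff by (auto simp: inj_on_def)
  ultimately show ?thesis by (simp add: out_degree_def card_image)
qed

lemma path_like_parts:
  assumes "cutpos w"
  shows "path_like_structure G parts"
proof -
  have w: "0 < w" "w < n" "w < n - 1" "\<not> jumped w" using assms by (auto simp: cutpos_def)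
  obtain k where k: "k < length boundaries" "boundaries ! k = w" using boundaries_obtain[OF w(2,4)] .
  have "k \<noteq> 0" "k \<noteq> length boundaries - 1" using k w boundaries_first boundaries_last by (metis less_irrefl)+
  then have len: "2 \<le> length parts" using k by (simp add: length_parts)
  have "\<exists>v. pverts (parts ! i) \<inter> pverts (parts ! Suc i) = {v} \<and> cut_vertex (with_proj G) v \<and>
      out_degree (with_proj (parts ! i)) v = 2 \<and> out_degree (with_proj (parts ! Suc i)) v = 2"
    if i: "Suc i < length parts" for i
  proof -
    let ?c = "boundaries ! Suc i"
    have i': "i < length parts" using i by simp
    have c: "cutpos ?c" using cutpos_boundaries[of "Suc i"] i by (simp add: length_parts)
    then have nj: "\<not> jumped ?c" by (simp add: cutpos_def)
    have st: "stretch (boundaries ! i) ?c" "stretch ?c (boundaries ! Suc (Suc i))"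
      using stretch_boundaries i by (auto simp: length_parts)
    have lo: "boundaries ! i \<le> j" if "j < ?c" "F ?c j" for j
      using not_jumpedD2[of "boundaries ! i" ?c j] st(1) that by (simp add: stretch_def)
    have hi: "j \<le> boundaries ! Suc (Suc i)" if "?c < j" "F ?c j" for j
      using not_jumpedD[of "boundaries ! Suc (Suc i)" ?c j] st(2) that by (simp add: stretch_def)
    have ne: "j < ?c \<or> ?c < j" if "F ?c j" for j using adj_irrefl[OF that] by linarith
    have "{j. j \<in> {boundaries ! i..?c} \<and> F ?c j} = {j. j < ?c \<and> F ?c j}"
      using lo ne by fastforce
    then have "out_degree (with_proj (parts ! i)) (vt ?c) = 2"
      using out_degree_part[OF parts_verts(2)[OF i'], of ?c] parts_verts(3)[OF i'] card_backward_cutpos[OF c]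
      by (simp add: parts_nth[OF i'])
    moreover have "{j. j \<in> {?c..boundaries ! Suc (Suc i)} \<and> F ?c j} = {j. ?c < j \<and> F ?c j}"
      using hi ne by fastforce
    then have "out_degree (with_proj (parts ! Suc i)) (vt ?c) = 2"
      using out_degree_part[OF parts_verts(2)[OF i], of ?c] parts_verts(3)[OF i] card_forward_cutpos[OF c]
      by (simp add: parts_nth[OF i])
    ultimately show ?thesis using parts_Int_next[OF i] cut_vertex_cutpos[OF c] by blast
  qed
  then show ?thesis
    unfolding path_like_structure_def using len distinct_parts set_parts parts_Int_far by blast
qed

lemma placed_parts:
  assumes "i < length parts"
  shows "placed_block parts i = \<lparr>body = part {boundaries ! i..<Suc (boundaries ! Suc i)},
    lports = vt ` (if i = 0 then {} else {boundaries ! i}),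
    rports = vt ` (if Suc i < length parts then {boundaries ! Suc i} else {})\<rparr>"
proof -
  have "pverts (parts ! (i - 1)) \<inter> pverts (parts ! i) = {vt (boundaries ! i)}" if "i \<noteq> 0"
    using parts_Int_next[of "i - 1"] assms that by simp
  moreover have "pverts (parts ! i) \<inter> pverts (parts ! Suc i) = {vt (boundaries ! Suc i)}" if "Suc i < length parts"
    using parts_Int_next[OF that] .
  ultimately show ?thesis
    unfolding placed_block_def parts_nth[OF assms, symmetric] atLeastLessThanSuc_atLeastAtMost by simp
qed

lemma part_piece_map:
  assumes "A \<subseteq> {..<n}" "L \<subseteq> A" "R \<subseteq> A"
  obtains g where "piece_map g \<lparr>body = part A, lports = vt ` L, rports = vt ` R\<rparr> (segment F A L R)"
    "wf_piece \<lparr>body = part A, lports = vt ` L, rports = vt ` R\<rparr>"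
proof -
  have wf: "wf_piece (segment F A L R)" using assms by (auto simp: wf_piece_def)
  have "inj_on vt A" using assms(1) vt_eq_iff by (auto simp: inj_on_def)
  moreover have "parcs (part A) = map_prod vt vt ` {(i, j). i \<in> A \<and> j \<in> A \<and> F i j}" by force
  ultimately have "piece_map vt (segment F A L R) \<lparr>body = part A, lports = vt ` L, rports = vt ` R\<rparr>"
    by (simp add: piece_map_def)
  from piece_map_inv[OF wf this] wf_piece_map[OF wf this] show thesis by (rule that)
qed

lemma left_end_part:
  assumes "cutpos w"
  shows "left_end_type (placed_block parts 0)"
proof -
  have len: "2 \<le> length parts" using path_like_parts[OF assms] by (simp add: path_like_structure_def)
  have st: "stretch 0 (boundaries ! 1)" using stretch_boundaries[of 0] boundaries_first len by (simp add: length_parts)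
  have c: "cutpos (boundaries ! 1)" using cutpos_boundaries[of 1] len by (simp add: length_parts)
  have "boundaries ! 1 \<le> u" if "cutpos u" for u
    using st that unfolding stretch_def cutpos_def by (meson not_le)
  from left_end[OF c this] have lt: "left_end_type (segment F {0..<Suc (boundaries ! 1)} {} {boundaries ! 1})" .
  have "{0..<Suc (boundaries ! 1)} \<subseteq> {..<n}" using c by (auto simp: cutpos_def)
  then obtain g where g: "piece_map g \<lparr>body = part {0..<Suc (boundaries ! 1)}, lports = vt ` {}, rports = vt ` {boundaries ! 1}\<rparr>
      (segment F {0..<Suc (boundaries ! 1)} {} {boundaries ! 1})"
    "wf_piece \<lparr>body = part {0..<Suc (boundaries ! 1)}, lports = vt ` {}, rports = vt ` {boundaries ! 1}\<rparr>"
    by (rule part_piece_map[of _ "{}" "{boundaries ! 1}"]) auto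
  have eq: "placed_block parts 0 = \<lparr>body = part {0..<Suc (boundaries ! 1)}, lports = vt ` {}, rports = vt ` {boundaries ! 1}\<rparr>"
  proof -
    have "0 < length parts" "Suc 0 < length parts" using len by linarith+
    then show ?thesis using placed_parts[of 0] boundaries_first by simp
  qed
  show ?thesis unfolding eq by (rule left_end_type_trans[OF g(2,1) lt])
qed

lemma middle_part:
  assumes i: "0 < i" "Suc i < length parts"
  shows "middle_type (placed_block parts i)"
proof -
  let ?v = "boundaries ! i" and ?w = "boundaries ! Suc i"
  have st: "stretch ?v ?w" using stretch_boundaries[of i] i by (simp add: length_parts)
  have c: "cutpos ?v" "cutpos ?w" using cutpos_boundaries[of i] cutpos_boundaries[of "Suc i"] i by (simp_all add: length_parts)
  have vw: "?v < ?w" using st by (simp add: stretch_def)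
  have "?w \<le> u" if "cutpos u" "?v < u" for u
    using st that unfolding stretch_def cutpos_def by (meson not_le)
  from middle[OF c vw this] have mid: "middle_type (segment F {?v..<Suc ?w} {?v} {?w})" .
  have "{?v..<Suc ?w} \<subseteq> {..<n}" using c by (auto simp: cutpos_def)
  then obtain g where g: "piece_map g \<lparr>body = part {?v..<Suc ?w}, lports = vt ` {?v}, rports = vt ` {?w}\<rparr>
      (segment F {?v..<Suc ?w} {?v} {?w})"
    "wf_piece \<lparr>body = part {?v..<Suc ?w}, lports = vt ` {?v}, rports = vt ` {?w}\<rparr>"
    by (rule part_piece_map[of _ "{?v}" "{?w}"]) (use vw in auto)
  have eq: "placed_block parts i = \<lparr>body = part {?v..<Suc ?w}, lports = vt ` {?v}, rports = vt ` {?w}\<rparr>"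
    using placed_parts[of i] i by auto
  show ?thesis unfolding eq by (rule middle_type_trans[OF g(2,1) mid])
qed

lemma right_end_part:
  assumes "cutpos w"
  shows "right_end_type (placed_block parts (length parts - 1))"
proof -
  have len: "2 \<le> length parts" using path_like_parts[OF assms] by (simp add: path_like_structure_def)
  let ?k = "length parts - 1"
  let ?w = "boundaries ! ?k"
  have k: "Suc ?k < length boundaries" "0 < ?k" "Suc ?k = length boundaries - 1" using len by (auto simp: length_parts)
  have last: "boundaries ! Suc ?k = n - 1" unfolding k(3) by (rule boundaries_last)
  have st: "stretch ?w (n - 1)" using stretch_boundaries[OF k(1)] last by simp
  have c: "cutpos ?w" using cutpos_boundaries[OF k(2,1)] .
  then have wn: "Suc ?w < n" by (simp add: cutpos_def)
  have "u \<le> ?w" if u: "cutpos u" for u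
  proof -
    have "\<not> jumped u" "u < n - 1" using u by (auto simp: cutpos_def)
    then show ?thesis using st unfolding stretch_def by (meson not_le)
  qed
  from right_end[OF c this] have lt: "left_end_type (segment F {?w..<n} {} {?w})" .
  have "{?w..<n} \<subseteq> {..<n}" by auto
  then obtain g where g: "piece_map g \<lparr>body = part {?w..<n}, lports = vt ` {}, rports = vt ` {?w}\<rparr> (segment F {?w..<n} {} {?w})"
    "wf_piece \<lparr>body = part {?w..<n}, lports = vt ` {}, rports = vt ` {?w}\<rparr>"
    by (rule part_piece_map[of _ "{}" "{?w}"]) (use wn in auto)
  have "Suc (n - 1) = n" using wn by simp
  then have eq: "mirror (placed_block parts ?k) = \<lparr>body = part {?w..<n}, lports = vt ` {}, rports = vt ` {?w}\<rparr>"
    using placed_parts[of ?k] len k last by (auto simp: mirror_def)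
  show ?thesis unfolding right_end_type_def eq by (rule left_end_type_trans[OF g(2,1) lt])
qed

lemma whole_graph:
  assumes none: "\<And>w. \<not> cutpos w"
  shows "n \<le> 9 \<and> (\<exists>H \<in> {graph_G5, graph_G6, graph_G7, graph_G8, graph_G8', graph_G9}.
      digraph_iso (with_proj G) (with_proj H)) \<or> 10 \<le> n \<and> long_complete_block G"
proof -
  let ?P = "\<lparr>body = G, lports = {}, rports = {}\<rparr> :: 'a piece"
  have G: "part {0..<n} = G" using part_all by (simp add: atLeast0LessThan)
  obtain g where g: "piece_map g ?P (segment F {0..<n} {} {})" "wf_piece ?P"
    by (rule part_piece_map[of "{0..<n}" "{}" "{}", unfolded G image_empty]) auto
  have small: "digraph_iso (with_proj G) (with_proj H)" if "piece_iso (segment F {0..<n} {} {}) (plain H)" for H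
    using piece_iso_trans[OF g(2,1) that] by (auto simp: piece_iso_def digraph_iso_def plain_def)
  have large: "long_complete_block G" if "long_block D_bricks (mirror ` D_bricks) (segment F {0..<n} {} {})"
    using long_block_trans[OF g(2,1) that] by (simp add: long_complete_block_def)
  from no_cutpos[OF none] show ?thesis
  proof
    assume a: "n \<le> 9 \<and> (\<exists>H \<in> {graph_G5, graph_G6, graph_G7, graph_G8, graph_G8', graph_G9}.
      piece_iso (segment F {0..<n} {} {}) (plain H))"
    then obtain H where "H \<in> {graph_G5, graph_G6, graph_G7, graph_G8, graph_G8', graph_G9}"
      "piece_iso (segment F {0..<n} {} {}) (plain H)" by blast
    then show ?thesis using small a by blast
  next
    assume "10 \<le> n \<and> long_block D_bricks (mirror ` D_bricks) (segment F {0..<n} {} {})"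
    then show ?thesis using large by blast
  qed
qed

end

theorem theorem3p1:
  fixes G :: "'a pair_pre_digraph" and n :: nat
  assumes "G \<in> connected_quartic_graphs n"
    and "\<forall>H \<in> (connected_quartic_graphs n :: 'a pair_pre_digraph set).
           spectral_gap G \<le> spectral_gap H"
  shows "(is_block (with_proj G) \<longrightarrow>
           (n \<le> 9 \<and>
             (\<exists>H \<in> {graph_G5, graph_G6, graph_G7, graph_G8, graph_G8', graph_G9}.
                digraph_iso (with_proj G) (with_proj H))) \<or>
           (10 \<le> n \<and> long_complete_block G)) \<and>
         (\<not> is_block (with_proj G) \<longrightarrow>
           (\<exists>Cs. path_like_structure G Cs \<and>
             left_end_type (placed_block Cs 0) \<and>
             (\<forall>i. 0 < i \<and> Suc i < length Cs \<longrightarrow> middle_type (placed_block Cs i)) \<and>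
             right_end_type (placed_block Cs (length Cs - 1))))"
proof -
  define V where "V = pverts G"
  define E where "E = (\<lambda>u v. (u, v) \<in> parcs G)"
  have quartic: "quartic_rel V E" and n: "card V = n"
    using quartic_rel_of_graph[OF assms(1)] by (auto simp: V_def E_def)
  obtain x \<mu> where x: "0 < \<mu>" "\<exists>u\<in>V. \<exists>v\<in>V. x u \<noteq> x v"
    "\<And>F u. quartic_rel V F \<Longrightarrow> energy V F x \<le> energy V E x \<Longrightarrow> u \<in> V \<Longrightarrow> laplacian V F x u = \<mu> * x u"
    using fiedler_vector_of_minimal[OF assms V_def E_def] by metis
  \<comment> \<open>The energy bound is that of \<open>x\<close> on the given graph itself, which is
    therefore one of the graphs covered by \<open>opt\<close>.\<close>
  interpret optimal V x \<mu> "energy V E x" by (rule optimal.intro) (use x in auto)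
  have "opt E" using quartic by (simp add: opt_def)
  then obtain vt where vt: "bij_betw vt {..<n} V"
    "ordered_quartic n (\<lambda>i j. i < n \<and> j < n \<and> E (vt i) (vt j))"
    by (rule ordered_quartic_exists[unfolded n])
  let ?F = "\<lambda>i j. i < n \<and> j < n \<and> E (vt i) (vt j)"
  have "(u, v) \<in> parcs G \<longleftrightarrow> (\<exists>i j. ?F i j \<and> u = vt i \<and> v = vt j)" for u v
  proof
    assume uv: "(u, v) \<in> parcs G"
    then have "u \<in> V" "v \<in> V" using quartic_relD(3,4)[OF quartic, of u v] by (auto simp: E_def)
    then obtain i j where "i < n" "j < n" "u = vt i" "v = vt j" using vt(1) by (auto simp: bij_betw_def)
    then show "\<exists>i j. ?F i j \<and> u = vt i \<and> v = vt j" using uv unfolding E_def by blast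
  qed (auto simp: E_def)
  then interpret numbered_graph n ?F G vt
    by (intro numbered_graph.intro numbered_graph_axioms.intro vt(2)) (use vt(1) in \<open>simp_all add: V_def\<close>)
  show ?thesis
  proof (cases "\<exists>w. cutpos w")
    case True
    then obtain w where w: "cutpos w" by blast
    then show ?thesis
      using is_block_iff_no_cutpos path_like_parts[OF w] left_end_part[OF w] middle_part right_end_part[OF w] by blast
  next
    case False
    then show ?thesis using is_block_iff_no_cutpos whole_graph by blast
  qed
qed

end
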